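(* Let $b\ge 2$ be an integer, let $\mathcal{N}_b\subseteq[0,1)$ be the set of real numbers in $[0,1)$ that are Borel normal in base $b$, and let $\mathcal{P}_b\subseteq[0,1)$ be the set of real numbers in $[0,1)$ that are Poisson generic in base $b$. Then $\mathcal{N}_b\setminus\mathcal{P}_b$ is $D_2\text{-}\boldsymbol{\Pi}^0_3$-complete.
   Context: Each $x\in[0,1)$ is identified with its base-$b$ expansion $x=\sum_{j\ge1}x_jb^{-j}$, $x_j\in\{0,\dots,b-1\}$, with $x_j\neq0$ for infinitely many $j$. For real $r>1$, $x\restriction r$ denotes $x_1\cdots x_{\lfloor r\rfloor}$. Occurrences of a word $w$ in a word $u$ are counted over all starting positions (overlaps allowed). $x$ is Borel normal in base $b$ if for every finite word $w$ over $\{0,\dots,b-1\}$, the number of occurrences of $w$ in $x\restriction n$ divided by $n$ tends to $b^{-|w|}$. For real $\lambda>0$, integers $j\ge0,k\ge1$, $Z^\lambda_{j,k}(x)=b^{-k}|\{w\in\{0,\dots,b-1\}^k: w\text{ occurs exactly } j\text{ times in } x\restriction(\lambda b^k+k)\}|$; $x$ is Poisson generic in base $b$ if for every real $\lambda>0$ and integer $j\ge0$, $Z^\lambda_{j,k}(x)\to e^{-\lambda}\lambda^j/j!$ as $k\to\infty$. $D_2\text{-}\boldsymbol{\Pi}^0_3$ is the class of sets of the form $A\setminus B$ with $A,B$ both $\boldsymbol\Pi^0_3$ (Borel hierarchy). A set is complete for a class if it belongs to the class and every set in the class (in a zero-dimensional Polish space such as $\omega^\omega$) is reducible to it via a continuous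 map. *)

theory Defs
  imports "HOL-Analysis.Analysis"
begin

section \<open>Expansions, normality and Poisson genericity\<close>

text \<open>
  A sequence of digits is a function \<open>d :: nat \<Rightarrow> nat\<close> with \<open>d j\<close> the digit \<open>x\<^sub>j\<close> for
  \<open>j \<ge> 1\<close>; the value \<open>d 0\<close> plays no role. Every \<open>x \<in> (0,1)\<close> has exactly one expansion with
  infinitely many nonzero digits. The point \<open>0\<close> has none, so it belongs to neither of the sets
  \<open>borel_normal\<close> and \<open>poisson_generic\<close> below; its all-zero expansion is neither normal
  nor Poisson generic, so admitting that expansion for \<open>0\<close> would give the same sets.
\<close>

definition is_expansion :: "nat \<Rightarrow> real \<Rightarrow> (nat \<Rightarrow> nat) \<Rightarrow> bool" where
  "is_expansion b x d \<longleftrightarrow>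
     (\<forall>j\<ge>1. d j < b) \<and>
     infinite {j. 1 \<le> j \<and> d j \<noteq> 0} \<and>
     (\<lambda>j. real (d (Suc j)) / real b ^ Suc j) sums x"

definition prefix_upto :: "(nat \<Rightarrow> nat) \<Rightarrow> real \<Rightarrow> nat list" where
  "prefix_upto d r = map d [1..<Suc (nat \<lfloor>r\<rfloor>)]"

definition occurrences :: "'a list \<Rightarrow> 'a list \<Rightarrow> nat" where
  "occurrences w u = card {i. i + length w \<le> length u \<and> take (length w) (drop i u) = w}"

definition borel_normal :: "nat \<Rightarrow> real set" where
  "borel_normal b = {x \<in> {0..<1}. \<exists>d. is_expansion b x d \<and>
     (\<forall>w. set w \<subseteq> {..<b} \<longrightarrow>
       (\<lambda>n. real (occurrences w (prefix_upto d (real n))) / real n)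
         \<longlonglongrightarrow> 1 / real b ^ length w)}"

definition Z_freq :: "nat \<Rightarrow> (nat \<Rightarrow> nat) \<Rightarrow> real \<Rightarrow> nat \<Rightarrow> nat \<Rightarrow> real" where
  "Z_freq b d L j k =
     real (card {w. length w = k \<and> set w \<subseteq> {..<b} \<and>
       occurrences w (prefix_upto d (L * real b ^ k + real k)) = j}) / real b ^ k"

definition poisson_generic :: "nat \<Rightarrow> real set" where
  "poisson_generic b = {x \<in> {0..<1}. \<exists>d. is_expansion b x d \<and>
     (\<forall>L>0. \<forall>j. (\<lambda>k. Z_freq b d L j k) \<longlonglongrightarrow> exp (- L) * L ^ j / fact j)}"

section \<open>The class of differences of \<open>\<Pi>\<^sup>0\<^sub>3\<close> sets, and completeness\<close>

text \<open>The restriction to \<open>topspace X\<close> only matters for the empty intersection.\<close>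

definition Pi03_in :: "'a topology \<Rightarrow> 'a set \<Rightarrow> bool" where
  "Pi03_in X = (countable intersection_of fsigma_in X) relative_to topspace X"

definition D2_Pi03_in :: "'a topology \<Rightarrow> 'a set \<Rightarrow> bool" where
  "D2_Pi03_in X S \<longleftrightarrow> (\<exists>A B. Pi03_in X A \<and> Pi03_in X B \<and> S = A - B)"

definition zero_dim_polish :: "'a topology \<Rightarrow> bool" where
  "zero_dim_polish X \<longleftrightarrow> completely_metrizable_space X \<and> separable_space X \<and> X dim_le 0"

definition continuously_reducible :: "'a topology \<Rightarrow> 'a set \<Rightarrow> 'b topology \<Rightarrow> 'b set \<Rightarrow> bool" where
  "continuously_reducible X C Y S \<longleftrightarrow>
     (\<exists>f. continuous_map X Y f \<and> (\<forall>x \<in> topspace X. x \<in> C \<longleftrightarrow> f x \<in> S))"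

text \<open>
  Completeness quantifies over all zero-dimensional Polish spaces. As HOL cannot quantify over
  types, the type of the points of these spaces is a parameter; a theorem for a free type variable
  \<open>'a\<close> covers all of them. (Already \<open>'a = nat \<Rightarrow> nat\<close> carries a homeomorphic copy of each.)
\<close>

definition D2_Pi03_complete :: "'a itself \<Rightarrow> 'b topology \<Rightarrow> 'b set \<Rightarrow> bool" where
  "D2_Pi03_complete (_ :: 'a itself) Y S \<longleftrightarrow>
     D2_Pi03_in Y S \<and>
     (\<forall>(X :: 'a topology) C. zero_dim_polish X \<and> D2_Pi03_in X C \<longrightarrow>
        continuously_reducible X C Y S)"

end

theory Submission
  imports Defs "HOL-Probability.Infinite_Product_Measure" "HOL-Real_Asymp.Real_Asymp"
    "HOL-Library.Discrete_Functions"
begin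

text \<open>
  Membership: off the countable set of \<open>b\<close>-adic rationals the digits are locally constant, so both
  normality and Poisson genericity are of the form ``for all \<open>i\<close>, for almost all \<open>n\<close>, a clopen
  condition''.

  Hardness: a \<open>\<Pi>\<^sup>0\<^sub>3\<close> subset of a zero-dimensional space is the set of points \<open>x\<close> at which a
  sequence \<open>z x i\<close> of locally constant functions tends to infinity. Code \<open>A\<close> and \<open>B\<close> in this way by
  \<open>p\<close> and \<open>q\<close>, and fix a sequence \<open>a\<close> that is both normal and Poisson generic. At the sparse positions
  \<open>N = b\<^bsup>i\<^sup>2\<^esup>\<close> overwrite a stretch of length about \<open>N / (p + 1)\<close> by zeros if \<open>i\<close> is even, and a
  stretch of length about \<open>N / (q + 1)\<close> by a copy of the beginning of \<open>a\<close> if \<open>i\<close> is odd. Stretches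
  of negligible proportion change nothing. Infinitely many stretches of zeros of a fixed proportion
  destroy normality. Copies never affect normality, but a copy of a fixed proportion \<open>\<theta>\<close> produces no
  new words, so the proportion of missing words of length \<open>i\<^sup>2\<close> in the prefix of length
  \<open>(1 + \<theta>) N\<close> stays near \<open>e\<^sup>-\<^sup>1\<close> instead of \<open>e\<^bsup>-1-\<theta>\<^esup>\<close>.

  The sequence \<open>a\<close> is obtained at random. For a uniform random word \<open>w\<close> of length \<open>k\<close> and \<open>\<beta> = b\<^sup>-\<^sup>k\<close>,
  the law of the number of occurrences of \<open>w\<close> among the first \<open>n\<close> windows satisfies the recursion
  of the binomial law with parameter \<open>\<beta>\<close> up to \<open>O(k \<beta>\<^sup>2)\<close>, because any two windows, overlapping or
  not, agree with probability \<open>\<beta>\<close>. This gives the mean of \<open>Z_freq\<close>; its variance is small as it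
  depends little on each single digit, and Borel--Cantelli concludes.
\<close>

section \<open>Locally constant codes for \<open>\<Pi>\<^sup>0\<^sub>3\<close> sets\<close>

text \<open>Normality concerns words of a fixed length, Poisson genericity words whose length is
  about the logarithm of the prefix. A repeated passage looks typical to the former and is wasted
  for the latter, so copying can spoil one property alone. The copy starts at the beginning of
  \<open>a\<close> because a prefix may stop inside the block: every initial segment of
  \<open>a\<close>, short or long, has the right frequencies up to a small multiple of its length
  plus a constant.

  The exponent \<open>i * i\<close> serves two ends. \<open>N\<close> is a power of
  \<open>b\<close>, so the prefix of length \<open>N\<close> belongs exactly to the parameter 1 for
  words of length \<open>i * i\<close>. And \<open>N (i - 1) / N i\<close> tends to 0, so at stage
  \<open>i\<close> all earlier blocks together are negligible and only block \<open>i\<close> has to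
  be controlled.

  The obstacle in the random part is that overlapping windows are dependent, and that a fixed word
  such as a run of zeros occurs in clumps. Drawing the word at random as well removes this: the
  average over all words sees self-overlaps only as an error of second order.\<close>

definition locally_constant :: "'a topology \<Rightarrow> ('a \<Rightarrow> 'b) \<Rightarrow> bool" where
  "locally_constant X h \<longleftrightarrow>
     (\<forall>x\<in>topspace X. \<exists>U. openin X U \<and> x \<in> U \<and> (\<forall>y\<in>U. h y = h x))"

lemma locally_constant_finite_family:
  assumes "finite I" "\<And>i. i \<in> I \<Longrightarrow> locally_constant X (h i)" "x \<in> topspace X"
  shows "\<exists>U. openin X U \<and> x \<in> U \<and> (\<forall>y\<in>U. \<forall>i\<in>I. h i y = h i x)"
  using assms
proof (induction I rule: finite_induct)
  case empty
  then show ?case by auto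
next
  case (insert i I)
  then obtain U where U: "openin X U" "x \<in> U" "\<forall>y\<in>U. \<forall>i\<in>I. h i y = h i x"
    by auto
  obtain V where V: "openin X V" "x \<in> V" "\<forall>y\<in>V. h i y = h i x"
    using insert.prems unfolding locally_constant_def by (meson insertI1)
  show ?case
  proof (intro exI conjI)
    show "openin X (U \<inter> V)" using U(1) V(1) by (rule openin_Int)
    show "x \<in> U \<inter> V" using U(2) V(2) by blast
    show "\<forall>y\<in>U \<inter> V. \<forall>j\<in>insert i I. h j y = h j x" using U(3) V(3) by blast
  qed
qed

lemma locally_constant_of_finite:
  assumes "finite I" "\<And>i. i \<in> I \<Longrightarrow> locally_constant X (h i)"
    and "\<And>x y. x \<in> topspace X \<Longrightarrow> y \<in> topspace X \<Longrightarrow> \<forall>i\<in>I. h i y = h i x \<Longrightarrow> g y = g x"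
  shows "locally_constant X g"
  unfolding locally_constant_def
proof
  fix x assume x: "x \<in> topspace X"
  obtain U where U: "openin X U" "x \<in> U" "\<forall>y\<in>U. \<forall>i\<in>I. h i y = h i x"
    using locally_constant_finite_family[of I X h x] assms(1,2) x by blast
  have "g y = g x" if "y \<in> U" for y
  proof (rule assms(3)[OF x])
    show "y \<in> topspace X" using that U(1) openin_subset by blast
    show "\<forall>i\<in>I. h i y = h i x" using U(3) that by blast
  qed
  then show "\<exists>U. openin X U \<and> x \<in> U \<and> (\<forall>y\<in>U. g y = g x)"
    using U(1,2) by (intro exI[of _ U] conjI ballI)
qed

lemma locally_constant_clopen:
  assumes "openin X K" "closedin X K"
  shows "locally_constant X (\<lambda>x. x \<in> K)"
  unfolding locally_constant_def
proof
  fix x assume x: "x \<in> topspace X"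
  have "openin X (topspace X - K)"
    using assms by blast
  with assms x show "\<exists>U. openin X U \<and> x \<in> U \<and> (\<forall>y\<in>U. (y \<in> K) = (x \<in> K))"
    by (cases "x \<in> K") (auto intro: exI[of _ K] exI[of _ "topspace X - K"])
qed

section \<open>Open sets as countable unions of clopen sets\<close>

lemma separable_metrizable_imp_second_countable:
  assumes "metrizable_space X" "separable_space X"
  shows "second_countable X"
proof -
  obtain M d where Md: "Metric_space M d" and X: "X = Metric_space.mtopology M d"
    using assms(1) unfolding metrizable_space_def by auto
  interpret Metric_space M d by (rule Md)
  obtain D where D: "countable D" "D \<subseteq> M" "mtopology closure_of D = M"
    using assms(2) X by (auto simp: separable_space_def)
  define \<B> where "\<B> = (\<lambda>(c, n). mball c (1 / real (Suc n))) ` (D \<times> (UNIV :: nat set))"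
  have "countable \<B>"
    unfolding \<B>_def using D(1) by auto
  moreover have "openin X V" if "V \<in> \<B>" for V
    using that unfolding \<B>_def X by auto
  moreover have "\<exists>V\<in>\<B>. x \<in> V \<and> V \<subseteq> U" if U: "openin X U" "x \<in> U" for U x
  proof -
    have xM: "x \<in> M" using U X openin_subset by fastforce
    obtain r where r: "r > 0" "mball x r \<subseteq> U"
      using U unfolding X openin_mtopology by blast
    obtain n where n: "1 / real (Suc n) < r / 2"
      using r(1) by (metis half_gt_zero nat_approx_posE)
    have "x \<in> mtopology closure_of D" using D xM by simp
    then obtain c where c: "c \<in> D" "c \<in> mball x (1 / real (Suc n))"
      unfolding metric_closure_of by (auto, smt (verit) in_mball of_nat_Suc of_nat_0_le_iff zero_less_divide_1_iff)
    have "mball c (1 / real (Suc n)) \<subseteq> mball x r"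
    proof
      fix y assume y: "y \<in> mball c (1 / real (Suc n))"
      then have "d x y \<le> d x c + d c y"
        using c xM by (intro triangle) auto
      also have "\<dots> < 1 / real (Suc n) + 1 / real (Suc n)"
        using c(2) y by (intro add_strict_mono) auto
      finally show "y \<in> mball x r" using y xM n by auto
    qed
    moreover have "x \<in> mball c (1 / real (Suc n))"
      using c xM by (auto simp: commute)
    moreover have "mball c (1 / real (Suc n)) \<in> \<B>"
      unfolding \<B>_def using c by (intro rev_image_eqI[of "(c, n)"]) auto
    ultimately show ?thesis using r by blast
  qed
  ultimately show ?thesis
    unfolding second_countable_def by (intro exI[of _ \<B>]) simp
qed

text \<open>Zero-dimensionality covers \<open>U\<close> by clopen subsets; the countable base thins
  the cover out. One clopen set is chosen for each base set that fits into a clopen subset of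
  \<open>U\<close>.\<close>

lemma zero_dim_polish_open_Union_clopen:
  assumes "zero_dim_polish X" "openin X U"
  shows "\<exists>V :: nat \<Rightarrow> 'a set. (\<forall>s. openin X (V s) \<and> closedin X (V s)) \<and> U = (\<Union>s. V s)"
proof -
  have "second_countable X"
    using assms completely_metrizable_imp_metrizable_space separable_metrizable_imp_second_countable
    unfolding zero_dim_polish_def by blast
  then obtain \<B> where \<B>: "countable \<B>" "\<And>V. V \<in> \<B> \<Longrightarrow> openin X V"
    and base: "\<And>U x. openin X U \<Longrightarrow> x \<in> U \<Longrightarrow> \<exists>V\<in>\<B>. x \<in> V \<and> V \<subseteq> U"
    unfolding second_countable_def by metis
  have clopen: "\<exists>K. openin X K \<and> closedin X K \<and> x \<in> K \<and> K \<subseteq> U" if "x \<in> U" for x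
  proof -
    have "neighbourhood_base_of (\<lambda>U. closedin X U \<and> openin X U) X"
      using assms(1) by (simp add: zero_dim_polish_def dimension_le_0_neighbourhood_base_of_clopen)
    then show ?thesis
      using that assms(2) unfolding neighbourhood_base_of by blast
  qed
  define \<B>' where "\<B>' = {B \<in> \<B>. \<exists>K. openin X K \<and> closedin X K \<and> B \<subseteq> K \<and> K \<subseteq> U}"
  have "\<forall>B\<in>\<B>'. \<exists>K. openin X K \<and> closedin X K \<and> B \<subseteq> K \<and> K \<subseteq> U"
    by (auto simp: \<B>'_def)
  then obtain G where G: "\<And>B. B \<in> \<B>' \<Longrightarrow> openin X (G B) \<and> closedin X (G B) \<and> B \<subseteq> G B \<and> G B \<subseteq> U"
    by metis
  have "U \<subseteq> \<Union>(G ` \<B>')"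
  proof
    fix x assume x: "x \<in> U"
    obtain K where K: "openin X K" "closedin X K" "x \<in> K" "K \<subseteq> U" using clopen[OF x] by auto
    then obtain B where "B \<in> \<B>" "x \<in> B" "B \<subseteq> K" using base by blast
    then have "B \<in> \<B>'" using K by (auto simp: \<B>'_def)
    then show "x \<in> \<Union>(G ` \<B>')" using G \<open>x \<in> B\<close> by blast
  qed
  \<comment> \<open>The empty set is added so that the family can be enumerated by the naturals even
    when \<open>U\<close> is empty.\<close>
  then have U: "U = \<Union>(insert {} (G ` \<B>'))" using G by auto
  have "countable (insert {} (G ` \<B>'))" using \<B>(1) by (auto simp: \<B>'_def)
  then obtain V :: "nat \<Rightarrow> 'a set" where V: "range V = insert {} (G ` \<B>')"
    by (metis insert_not_empty uncountable_def)
  have "openin X (V s) \<and> closedin X (V s)" for s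
    using V G rangeI[of V s] by auto
  then show ?thesis using U V by metis
qed

text \<open>A search for a closed piece that contains \<open>x\<close>. \<open>K m s x\<close> says
  that by stage \<open>s\<close> nothing has shown \<open>x\<close> to be outside
  \<open>C m\<close>, and \<open>g x s\<close> is the first piece not yet refuted. This guess only
  increases with \<open>s\<close>; it settles iff \<open>x\<close> lies in some piece. The code
  marks the stages at which the guess changes.\<close>

lemma fsigma_locally_constant_code:
  assumes X: "zero_dim_polish X" and "fsigma_in X F"
  shows "\<exists>h :: 'a \<Rightarrow> nat \<Rightarrow> bool. (\<forall>s. locally_constant X (\<lambda>x. h x s)) \<and>
           (\<forall>x\<in>topspace X. x \<in> F \<longleftrightarrow> finite {s. h x s})"
proof -
  obtain C :: "nat \<Rightarrow> 'a set" where C: "\<And>m. closedin X (C m)" "\<Union>(range C) = F"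
    using assms(2) unfolding fsigma_in_ascending by blast
  have "\<exists>V :: nat \<Rightarrow> 'a set. (\<forall>s. openin X (V s) \<and> closedin X (V s)) \<and> topspace X - C m = (\<Union>s. V s)" for m
    by (rule zero_dim_polish_open_Union_clopen[OF X]) (use C in auto)
  then obtain V :: "nat \<Rightarrow> nat \<Rightarrow> 'a set" where
    V: "\<And>m s. openin X (V m s)" "\<And>m s. closedin X (V m s)" "\<And>m. topspace X - C m = (\<Union>s. V m s)"
    by metis
  define K where "K m s x \<longleftrightarrow> (\<forall>t\<le>s. x \<notin> V m t)" for m s :: nat and x
  have K_mono: "K m s' x \<Longrightarrow> s \<le> s' \<Longrightarrow> K m s x" for m s s' x
    by (auto simp: K_def)
  have lcK: "locally_constant X (K m s)" for m s
    by (rule locally_constant_of_finite[of "{..s}" X "\<lambda>t x. x \<in> V m t"])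
      (auto simp: K_def intro: locally_constant_clopen V)
  \<comment> \<open>The cap at \<open>s\<close> makes the minimum exist and lets it depend on the
    finitely many \<open>K m s\<close> with \<open>m < s\<close> only.\<close>
  define g where "g x s = (LEAST m. s \<le> m \<or> K m s x)" for x and s :: nat
  have g1: "s \<le> g x s \<or> K (g x s) s x" for x s
    unfolding g_def by (rule LeastI[of "\<lambda>m. s \<le> m \<or> K m s x" s]) simp
  have g2: "g x s \<le> m" if "s \<le> m \<or> K m s x" for x s m
    unfolding g_def using that by (rule Least_le)
  have g_mono: "mono (g x)" for x
    by (rule monoI, rule g2) (use g1 K_mono order_trans in blast)
  have lcg: "locally_constant X (\<lambda>x. g x s)" for s
  proof (rule locally_constant_of_finite[of "{..<s}" X "\<lambda>m. K m s"])
    fix x y assume "\<forall>i\<in>{..<s}. K i s y = K i s x"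
    then have "(s \<le> m \<or> K m s y) = (s \<le> m \<or> K m s x)" for m
      by (cases "s \<le> m") auto
    then show "g y s = g x s" by (simp add: g_def)
  qed (auto intro: lcK)
  have lc: "locally_constant X (\<lambda>x. g x s \<noteq> g x (Suc s))" for s
    by (rule locally_constant_of_finite[of "{s, Suc s}" X "\<lambda>s x. g x s"]) (auto simp: lcg)
  have "x \<in> F \<longleftrightarrow> finite {s. g x s \<noteq> g x (Suc s)}" if x: "x \<in> topspace X" for x
  proof
    assume "x \<in> F"
    then obtain m where m: "x \<in> C m" using C by auto
    have "K m s x" for s
      using m x V(3)[of m] by (auto simp: K_def)
    then have "g x s \<le> m" for s by (simp add: g2)
    have "inj_on (g x) {s. g x s \<noteq> g x (Suc s)}"
    proof (rule linorder_inj_onI')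
      fix s t assume "s \<in> {s. g x s \<noteq> g x (Suc s)}" "s < t"
      then have "g x s < g x (Suc s)" "g x (Suc s) \<le> g x t"
        using monoD[OF g_mono, of s "Suc s" x] monoD[OF g_mono, of "Suc s" t x] by auto
      then show "g x s \<noteq> g x t" by simp
    qed
    moreover have "finite (g x ` {s. g x s \<noteq> g x (Suc s)})"
      by (rule finite_subset[of _ "{..m}"]) (use \<open>\<And>s. g x s \<le> m\<close> in auto)
    ultimately show "finite {s. g x s \<noteq> g x (Suc s)}"
      by (rule finite_imageD[rotated])
  next
    assume "finite {s. g x s \<noteq> g x (Suc s)}"
    then obtain S where S: "\<And>s. s \<ge> S \<Longrightarrow> g x (Suc s) = g x s"
      unfolding finite_nat_set_iff_bounded by (metis (mono_tags) mem_Collect_eq not_le)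
    have const: "g x s = g x S" if "s \<ge> S" for s
      using that by (induction s rule: dec_induct) (auto simp: S)
    have "K (g x S) s x" for s
    proof -
      \<comment> \<open>This stage exceeds the final guess, so the cap is inactive and the guess is
        a piece that is really unrefuted.\<close>
      have "K (g x S) (Suc (s + S + g x S)) x"
        using g1[of "Suc (s + S + g x S)" x] const[of "Suc (s + S + g x S)"] by simp
      then show ?thesis by (rule K_mono) simp
    qed
    then have "x \<notin> (\<Union>s. V (g x S) s)" by (auto simp: K_def)
    then have "x \<in> C (g x S)" using x V(3)[of "g x S"] by blast
    then show "x \<in> F" using C by auto
  qed
  then show ?thesis using lc by (intro exI[of _ "\<lambda>x s. g x s \<noteq> g x (Suc s)"]) simp
qed

lemma Pi03_in_iff:
  "Pi03_in X S \<longleftrightarrow> (\<exists>F :: nat \<Rightarrow> 'a set. (\<forall>n. fsigma_in X (F n)) \<and> S = topspace X \<inter> (\<Inter>n. F n))"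
proof
  assume "Pi03_in X S"
  then obtain \<U> where \<U>: "countable \<U>" "\<U> \<subseteq> Collect (fsigma_in X)" "S = topspace X \<inter> \<Inter>\<U>"
    unfolding Pi03_in_def relative_to_def intersection_of_def by auto
  \<comment> \<open>Adding the whole space makes the family nonempty, hence the range of a
    sequence.\<close>
  have "countable (insert (topspace X) \<U>)" using \<U> by auto
  then obtain F :: "nat \<Rightarrow> 'a set" where F: "range F = insert (topspace X) \<U>"
    by (metis insert_not_empty uncountable_def)
  have "fsigma_in X (F n)" for n
    using F \<U> rangeI[of F n] by auto
  moreover have "S = topspace X \<inter> (\<Inter>n. F n)"
    unfolding F \<U>(3) by auto
  ultimately show "\<exists>F :: nat \<Rightarrow> 'a set. (\<forall>n. fsigma_in X (F n)) \<and> S = topspace X \<inter> (\<Inter>n. F n)"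
    by blast
next
  assume "\<exists>F :: nat \<Rightarrow> 'a set. (\<forall>n. fsigma_in X (F n)) \<and> S = topspace X \<inter> (\<Inter>n. F n)"
  then obtain F :: "nat \<Rightarrow> 'a set" where "\<And>n. fsigma_in X (F n)" "S = topspace X \<inter> (\<Inter>n. F n)"
    by blast
  then show "Pi03_in X S"
    unfolding Pi03_in_def relative_to_def intersection_of_def
    by (intro exI[of _ "\<Inter>n. F n"] conjI exI[of _ "range F"]) auto
qed

text \<open>Index \<open>i\<close> codes a pair \<open>(n, s)\<close>, and row \<open>n\<close> is
  the code of the n-th F-sigma set. Each event in row \<open>n\<close> produces the value
  \<open>n\<close>, so infinitely many of them keep \<open>z\<close> from tending to infinity.
  Conversely a value below \<open>m\<close> needs \<open>n < m\<close> and either an event or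
  \<open>s < m\<close>, which leaves finitely many indices if each row has finitely many
  events.\<close>

lemma Pi03_locally_constant_code:
  assumes X: "zero_dim_polish X" and A: "Pi03_in X A"
  obtains z :: "'a \<Rightarrow> nat \<Rightarrow> nat" where "\<And>i. locally_constant X (\<lambda>x. z x i)"
    and "\<And>x. x \<in> topspace X \<Longrightarrow> x \<in> A \<longleftrightarrow> filterlim (z x) at_top sequentially"
proof -
  obtain F :: "nat \<Rightarrow> 'a set" where F: "\<And>n. fsigma_in X (F n)" "A = topspace X \<inter> (\<Inter>n. F n)"
    using A unfolding Pi03_in_iff by blast
  have "\<exists>h :: 'a \<Rightarrow> nat \<Rightarrow> bool. (\<forall>s. locally_constant X (\<lambda>x. h x s)) \<and>
           (\<forall>x\<in>topspace X. x \<in> F n \<longleftrightarrow> finite {s. h x s})" for n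
    by (rule fsigma_locally_constant_code[OF X F(1)])
  then obtain h :: "nat \<Rightarrow> 'a \<Rightarrow> nat \<Rightarrow> bool" where
    lc: "\<And>n s. locally_constant X (\<lambda>x. h n x s)" and
    h: "\<And>n x. x \<in> topspace X \<Longrightarrow> x \<in> F n \<longleftrightarrow> finite {s. h n x s}"
    by metis
  define z where "z x i = (case prod_decode i of (n, s) \<Rightarrow> if h n x s then n else n + s)" for x i
  show ?thesis
  proof
    fix i
    show "locally_constant X (\<lambda>x. z x i)"
      by (rule locally_constant_of_finite[of "{prod_decode i}" X "\<lambda>(n, s) x. h n x s"])
        (auto simp: z_def lc split: prod.splits)
  next
    fix x assume x: "x \<in> topspace X"
    have "filterlim (z x) at_top sequentially \<longleftrightarrow> (\<forall>m. eventually (\<lambda>i. m \<le> z x i) cofinite)"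
      unfolding filterlim_at_top cofinite_eq_sequentially ..
    also have "\<dots> \<longleftrightarrow> (\<forall>m. finite {i. z x i < m})"
      by (simp add: eventually_cofinite not_le)
    also have "\<dots> \<longleftrightarrow> (\<forall>n. finite {s. h n x s})"
    proof safe
      fix n assume "\<forall>m. finite {i. z x i < m}"
      then have "finite {i. z x i < Suc n}" by blast
      moreover have "(\<lambda>s. prod_encode (n, s)) ` {s. h n x s} \<subseteq> {i. z x i < Suc n}"
        by (auto simp: z_def)
      ultimately have "finite ((\<lambda>s. prod_encode (n, s)) ` {s. h n x s})"
        by (rule rev_finite_subset)
      then show "finite {s. h n x s}"
        by (rule finite_imageD) (auto simp: inj_on_def)
    next
      fix m assume *: "\<forall>n. finite {s. h n x s}"
      have "{i. z x i < m} \<subseteq> prod_encode ` (SIGMA n:{..<m}. {s. h n x s} \<union> {..<m})"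
      proof
        fix i assume "i \<in> {i. z x i < m}"
        then show "i \<in> prod_encode ` (SIGMA n:{..<m}. {s. h n x s} \<union> {..<m})"
          by (intro rev_image_eqI[of "prod_decode i"]) (auto simp: z_def split: prod.splits if_splits)
      qed
      then show "finite {i. z x i < m}"
        by (rule finite_subset) (use * in auto)
    qed
    also have "\<dots> \<longleftrightarrow> x \<in> A" using h x F(2) by auto
    finally show "x \<in> A \<longleftrightarrow> filterlim (z x) at_top sequentially" by simp
  qed
qed

section \<open>Windows of a sequence\<close>

definition window :: "(nat \<Rightarrow> 'a) \<Rightarrow> nat \<Rightarrow> nat \<Rightarrow> 'a list" where
  "window d i k = map d [Suc i..<Suc (i + k)]"

text \<open>Starting positions are counted, and a window may end beyond digit \<open>n\<close>. The
  range of positions is thus independent of the length of \<open>w\<close>, and counts over adjacent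
  ranges add up.\<close>

definition hits :: "(nat \<Rightarrow> 'a) \<Rightarrow> 'a list \<Rightarrow> nat \<Rightarrow> nat" where
  "hits d w n = card {i. i < n \<and> window d i (length w) = w}"

definition normal_seq :: "nat \<Rightarrow> (nat \<Rightarrow> nat) \<Rightarrow> bool" where
  "normal_seq b d \<longleftrightarrow> (\<forall>w. set w \<subseteq> {..<b} \<longrightarrow>
       (\<lambda>n. real (occurrences w (prefix_upto d (real n))) / real n)
         \<longlonglongrightarrow> 1 / real b ^ length w)"

definition poisson_seq :: "nat \<Rightarrow> (nat \<Rightarrow> nat) \<Rightarrow> bool" where
  "poisson_seq b d \<longleftrightarrow>
     (\<forall>L>0. \<forall>j. (\<lambda>k. Z_freq b d L j k) \<longlonglongrightarrow> exp (- L) * L ^ j / fact j)"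

lemma length_window [simp]: "length (window d i k) = k"
  by (simp add: window_def)

lemma window_nth [simp]: "t < k \<Longrightarrow> window d i k ! t = d (Suc (i + t))"
  by (simp add: window_def del: upt_Suc)

lemma window_eq_iff: "window d i k = window e l k \<longleftrightarrow> (\<forall>t<k. d (Suc (i + t)) = e (Suc (l + t)))"
  by (auto simp: list_eq_iff_nth_eq)

lemma length_prefix_upto [simp]: "length (prefix_upto d r) = nat \<lfloor>r\<rfloor>"
  by (simp add: prefix_upto_def del: upt_Suc)

lemma prefix_upto_cong:
  "(\<And>j. 1 \<le> j \<Longrightarrow> j \<le> nat \<lfloor>r\<rfloor> \<Longrightarrow> d j = e j) \<Longrightarrow> prefix_upto d r = prefix_upto e r"
  unfolding prefix_upto_def by (intro map_cong) auto

lemma take_drop_prefix_upto: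
  "i + k \<le> nat \<lfloor>r\<rfloor> \<Longrightarrow> take k (drop i (prefix_upto d r)) = window d i k"
  by (rule nth_equalityI) (auto simp: prefix_upto_def simp del: upt_Suc)

lemma occurrences_prefix_upto:
  "occurrences w (prefix_upto d r) = hits d w (Suc (nat \<lfloor>r\<rfloor>) - length w)"
  unfolding occurrences_def hits_def
  by (rule arg_cong[where f = card]) (auto simp: take_drop_prefix_upto)

lemma hits_mono: "m \<le> n \<Longrightarrow> hits d w m \<le> hits d w n"
  unfolding hits_def by (rule card_mono) auto

text \<open>The summand \<open>k\<close> in the prefix length cancels against the word length,
  leaving the starting positions from 0 to the floor of \<open>L * b ^ k\<close>.\<close>

lemma Z_freq_hits:
  assumes "L > 0"
  shows "Z_freq b d L j k =
    real (card {w. length w = k \<and> set w \<subseteq> {..<b} \<and> hits d w (Suc (nat \<lfloor>L * real b ^ k\<rfloor>)) = j}) / real b ^ k"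
proof -
  have "Suc (nat \<lfloor>L * real b ^ k + real k\<rfloor>) - k = Suc (nat \<lfloor>L * real b ^ k\<rfloor>)"
  proof -
    have "\<lfloor>L * real b ^ k + real k\<rfloor> = \<lfloor>L * real b ^ k\<rfloor> + int k"
      by linarith
    moreover have "\<lfloor>L * real b ^ k\<rfloor> \<ge> 0" using assms by simp
    ultimately show ?thesis by (simp add: nat_add_distrib)
  qed
  then have "{w. length w = k \<and> set w \<subseteq> {..<b} \<and> occurrences w (prefix_upto d (L * real b ^ k + real k)) = j}
    = {w. length w = k \<and> set w \<subseteq> {..<b} \<and> hits d w (Suc (nat \<lfloor>L * real b ^ k\<rfloor>)) = j}"
    by (auto simp: occurrences_prefix_upto)
  then show ?thesis unfolding Z_freq_def by simp
qed

lemma normal_seq_cong: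
  assumes "\<And>j. j \<ge> 1 \<Longrightarrow> d j = e j"
  shows "normal_seq b d \<longleftrightarrow> normal_seq b e"
proof -
  have "prefix_upto d r = prefix_upto e r" for r
    by (rule prefix_upto_cong) (rule assms)
  then show ?thesis by (simp add: normal_seq_def)
qed

lemma poisson_seq_cong:
  assumes "\<And>j. j \<ge> 1 \<Longrightarrow> d j = e j"
  shows "poisson_seq b d \<longleftrightarrow> poisson_seq b e"
proof -
  have "prefix_upto d r = prefix_upto e r" for r
    by (rule prefix_upto_cong) (rule assms)
  then show ?thesis by (simp add: poisson_seq_def Z_freq_def)
qed

section \<open>Expansions\<close>

text \<open>Ceiling minus one instead of the floor: at a point where \<open>b ^ j * x\<close> is an
  integer this selects the expansion ending in digits \<open>b - 1\<close>, not the one ending in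
  zeros.\<close>

definition cdigit :: "nat \<Rightarrow> real \<Rightarrow> nat \<Rightarrow> nat" where
  "cdigit b x j = nat ((\<lceil>real b ^ j * x\<rceil> - 1) mod int b)"

text \<open>Infinitely many nonzero digits make the tail strictly positive, while its upper bound is
  attained by digits \<open>b - 1\<close> throughout. The resulting interval, open below and closed
  above, is the kind on which a ceiling is constant.\<close>

lemma expansion_remainder:
  assumes b: "b \<ge> 2" and x: "is_expansion b x d"
  defines "R \<equiv> \<lambda>n. x - (\<Sum>j<n. real (d (Suc j)) / real b ^ Suc j)"
  shows "0 < R n" "R n \<le> 1 / real b ^ n"
proof -
  let ?t = "\<lambda>j. real (d (Suc j)) / real b ^ Suc j"
  have dig: "d (Suc j) \<le> b - 1" for j
    using x b unfolding is_expansion_def by (metis One_nat_def Suc_le_mono Suc_pred' less_Suc_eq_le less_le_trans pos2 zero_le)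
  have "?t sums x" using x by (simp add: is_expansion_def)
  then have R: "(\<lambda>j. ?t (j + n)) sums R n"
    unfolding R_def by (rule sums_split_initial_segment)
  have "infinite {j. 1 \<le> j \<and> d j \<noteq> 0}" using x by (simp add: is_expansion_def)
  then obtain j where j: "j > n" "d j \<noteq> 0"
    unfolding infinite_nat_iff_unbounded by auto
  have "?t (j - 1 - n + n) = real (d j) / real b ^ j"
    using j by auto
  then have "0 < ?t (j - 1 - n + n)" using j b by simp
  also have "?t (j - 1 - n + n) \<le> R n"
  proof (rule sums_le[OF _ sums_single[of "j - 1 - n" "\<lambda>i. ?t (i + n)"] R])
    fix i show "(if i = j - 1 - n then ?t (i + n) else 0) \<le> ?t (i + n)" by auto
  qed
  finally show "0 < R n" .
  have bpos: "real b > 1" using b by simp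
  have "(\<lambda>j. (1 / real b) ^ j) sums (1 / (1 - 1 / real b))"
    by (rule geometric_sums) (use bpos in auto)
  then have "(\<lambda>j. (real b - 1) / real b ^ Suc n * (1 / real b) ^ j) sums
      ((real b - 1) / real b ^ Suc n * (1 / (1 - 1 / real b)))"
    by (rule sums_mult)
  moreover have "(real b - 1) / real b ^ Suc n * (1 / (1 - 1 / real b)) = 1 / real b ^ n"
    using bpos by (simp add: field_simps)
  ultimately have G: "(\<lambda>j. (real b - 1) / real b ^ Suc n * (1 / real b) ^ j) sums (1 / real b ^ n)"
    by simp
  show "R n \<le> 1 / real b ^ n"
  proof (rule sums_le[OF _ R G])
    fix j
    have "real (d (Suc (j + n))) \<le> real b - 1"
      using dig[of "j + n"] b by linarith
    then have "?t (j + n) \<le> (real b - 1) / real b ^ Suc (j + n)"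
      using bpos by (intro divide_right_mono) auto
    also have "\<dots> = (real b - 1) / real b ^ Suc n * (1 / real b) ^ j"
      by (simp add: power_add power_one_over field_simps)
    finally show "?t (j + n) \<le> (real b - 1) / real b ^ Suc n * (1 / real b) ^ j" .
  qed
qed

lemma expansion_eq_cdigit:
  assumes b: "b \<ge> 2" and x: "is_expansion b x d" and j: "j \<ge> 1"
  shows "d j = cdigit b x j"
proof -
  obtain n where n: "j = Suc n" using j by (cases j) auto
  \<comment> \<open>The integer whose base-\<open>b\<close> numeral consists of the first
    \<open>m\<close> digits.\<close>
  define A where "A m = (\<Sum>i<m. int (d (Suc i)) * int b ^ (m - Suc i))" for m
  have A: "real_of_int (A m) = real b ^ m * (\<Sum>i<m. real (d (Suc i)) / real b ^ Suc i)" for m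
    unfolding A_def of_int_sum sum_distrib_left
  proof (rule sum.cong[OF refl])
    fix i assume "i \<in> {..<m}"
    then have "real b ^ m = real b ^ (m - Suc i) * real b ^ Suc i"
      by (metis Suc_leI lessThan_iff le_add_diff_inverse2 power_add)
    then show "real_of_int (int (d (Suc i)) * int b ^ (m - Suc i)) = real b ^ m * (real (d (Suc i)) / real b ^ Suc i)"
      using b by simp
  qed
  have "\<lceil>real b ^ m * x\<rceil> = A m + 1" for m
  proof (rule ceiling_unique)
    have bp: "real b ^ m > 0" using b by simp
    show "real_of_int (A m + 1) - 1 < real b ^ m * x"
      using expansion_remainder(1)[OF b x, of m] A[of m] bp by simp
    have "real b ^ m * (x - (\<Sum>i<m. real (d (Suc i)) / real b ^ Suc i)) \<le> real b ^ m * (1 / real b ^ m)"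
      using expansion_remainder(2)[OF b x, of m] bp by (intro mult_left_mono) auto
    then show "real b ^ m * x \<le> real_of_int (A m + 1)"
      using A[of m] b by (simp add: right_diff_distrib)
  qed
  then have "cdigit b x j = nat (A j mod int b)"
    by (simp add: cdigit_def)
  also have "A j = int b * A n + int (d j)"
  proof -
    have "(\<Sum>i<n. int (d (Suc i)) * int b ^ (Suc n - Suc i)) = int b * A n"
      unfolding A_def sum_distrib_left
    proof (rule sum.cong[OF refl])
      fix i assume "i \<in> {..<n}"
      then have "Suc n - Suc i = Suc (n - Suc i)" by auto
      then show "int (d (Suc i)) * int b ^ (Suc n - Suc i) = int b * (int (d (Suc i)) * int b ^ (n - Suc i))"
        by (simp only: power_Suc ac_simps)
    qed
    then show ?thesis by (simp add: A_def n)
  qed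
  also have "nat ((int b * A n + int (d j)) mod int b) = d j"
    using x j by (simp add: is_expansion_def)
  finally show ?thesis by simp
qed

lemma is_expansion_cdigit:
  assumes b: "b \<ge> 2" and x: "0 < x" "x \<le> 1"
  shows "is_expansion b x (cdigit b x)"
proof -
  define M where "M n = \<lceil>real b ^ n * x\<rceil> - 1" for n
  have M: "real_of_int (M n) < real b ^ n * x" "real b ^ n * x \<le> real_of_int (M n) + 1" for n
    unfolding M_def by linarith+
  have Mdiv: "M (Suc n) div int b = M n" for n
  proof -
    define q where "q = M (Suc n) div int b"
    have bp: "int b > 0" "real b > 0" using b by auto
    have q: "int b * q \<le> M (Suc n)" "M (Suc n) + 1 \<le> int b * q + int b"
      using bp pos_mod_bound[of "int b" "M (Suc n)"] pos_mod_sign[of "int b" "M (Suc n)"]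
        mult_div_mod_eq[of "int b" "M (Suc n)"] unfolding q_def by linarith+
    have "real b * real_of_int q \<le> real_of_int (M (Suc n))"
      using q(1) by (metis of_int_le_iff of_int_mult of_int_of_nat_eq)
    also have "\<dots> < real b * (real b ^ n * x)" using M(1)[of "Suc n"] by (simp add: mult.assoc)
    finally have 1: "real_of_int q < real b ^ n * x" using bp by simp
    have "real b * (real b ^ n * x) \<le> real_of_int (M (Suc n)) + 1"
      using M(2)[of "Suc n"] by (simp add: mult.assoc)
    also have "\<dots> \<le> real b * (real_of_int q + 1)"
    proof -
      have "real_of_int (M (Suc n) + 1) \<le> real_of_int (int b * q + int b)" using q(2) by linarith
      then show ?thesis by (simp add: distrib_left)
    qed
    finally have 2: "real b ^ n * x \<le> real_of_int q + 1" using bp by simp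
    have "\<lceil>real b ^ n * x\<rceil> = q + 1"
      by (rule ceiling_unique) (use 1 2 in auto)
    then show ?thesis by (simp add: q_def M_def)
  qed
  have Mrec: "M (Suc n) = int b * M n + int (cdigit b x (Suc n))" for n
  proof -
    have "int (cdigit b x (Suc n)) = M (Suc n) mod int b"
      using b unfolding cdigit_def M_def by simp
    then show ?thesis using Mdiv[of n] by (metis mult_div_mod_eq)
  qed
  have M0: "M 0 = 0" using x by (simp add: M_def) linarith
  have psum: "(\<Sum>j<n. real (cdigit b x (Suc j)) / real b ^ Suc j) = real_of_int (M n) / real b ^ n" for n
  proof (induction n)
    case (Suc n)
    then show ?case using b by (simp add: Mrec field_simps)
  qed (simp add: M0)
  have lim: "(\<lambda>n. real_of_int (M n) / real b ^ n) \<longlonglongrightarrow> x"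
  proof (rule tendsto_sandwich)
    have "(\<lambda>n. (1 / real b) ^ n) \<longlonglongrightarrow> 0"
      by (rule LIMSEQ_power_zero) (use b in auto)
    then show "(\<lambda>n. x - (1 / real b) ^ n) \<longlonglongrightarrow> x"
      using tendsto_diff[OF tendsto_const] by fastforce
    have bp: "real b ^ n > 0" for n using b by simp
    show "\<forall>\<^sub>F n in sequentially. x - (1 / real b) ^ n \<le> real_of_int (M n) / real b ^ n"
    proof (intro always_eventually allI)
      fix n
      have "x \<le> (real_of_int (M n) + 1) / real b ^ n"
        using M(2)[of n] bp[of n] by (simp add: pos_le_divide_eq mult.commute)
      then show "x - (1 / real b) ^ n \<le> real_of_int (M n) / real b ^ n"
        by (simp add: add_divide_distrib power_one_over)
    qed
    show "\<forall>\<^sub>F n in sequentially. real_of_int (M n) / real b ^ n \<le> x"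
      using M(1) bp by (intro always_eventually allI) (simp add: pos_divide_le_eq mult.commute less_imp_le)
  qed simp
  \<comment> \<open>If the digits vanished from some point on, the partial sums would be constant
    from there and equal to their limit \<open>x\<close>; but each of them is strictly below
    \<open>x\<close>.\<close>
  have "infinite {j. 1 \<le> j \<and> cdigit b x j \<noteq> 0}"
  proof
    assume "finite {j. 1 \<le> j \<and> cdigit b x j \<noteq> 0}"
    then obtain n where n: "\<And>j. 1 \<le> j \<Longrightarrow> cdigit b x j \<noteq> 0 \<Longrightarrow> j \<le> n"
      unfolding finite_nat_set_iff_bounded_le by auto
    have const: "real_of_int (M m) / real b ^ m = real_of_int (M n) / real b ^ n" if "m \<ge> n" for m
      using that
    proof (induction m rule: dec_induct)
      case (step m)
      have "cdigit b x (Suc m) = 0" using n[of "Suc m"] step by auto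
      then show ?case using step Mrec[of m] b by (simp add: field_simps)
    qed simp
    have "(\<lambda>m. real_of_int (M m) / real b ^ m) \<longlonglongrightarrow> real_of_int (M n) / real b ^ n"
      by (rule tendsto_eventually, rule eventually_sequentiallyI[of n], rule const)
    then have "x = real_of_int (M n) / real b ^ n"
      using lim LIMSEQ_unique by blast
    then show False using M(1)[of n] b by simp
  qed
  moreover have "cdigit b x j < b" for j
    using b by (simp add: cdigit_def nat_less_iff)
  ultimately show ?thesis
    unfolding is_expansion_def sums_def psum using lim by auto
qed

text \<open>The digits from index 1 on are unique, so any one expansion decides the existential
  statement in the definition.\<close>

lemma borel_normal_iff:
  assumes "b \<ge> 2" "is_expansion b x d" "x \<in> {0..<1}"
  shows "x \<in> borel_normal b \<longleftrightarrow> normal_seq b d"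
proof -
  have "normal_seq b e \<longleftrightarrow> normal_seq b d" if "is_expansion b x e" for e
    by (rule normal_seq_cong)
      (metis expansion_eq_cdigit assms(1,2) that)
  then show ?thesis
    using assms unfolding borel_normal_def normal_seq_def[symmetric] by blast
qed

lemma poisson_generic_iff:
  assumes "b \<ge> 2" "is_expansion b x d" "x \<in> {0..<1}"
  shows "x \<in> poisson_generic b \<longleftrightarrow> poisson_seq b d"
proof -
  have "poisson_seq b e \<longleftrightarrow> poisson_seq b d" if "is_expansion b x e" for e
    by (rule poisson_seq_cong)
      (metis expansion_eq_cdigit assms(1,2) that)
  then show ?thesis
    using assms unfolding poisson_generic_def poisson_seq_def[symmetric] by blast
qed

section \<open>Normal and Poisson generic numbers form \<open>\<Pi>\<^sup>0\<^sub>3\<close> sets\<close>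

definition badic :: "nat \<Rightarrow> real set" where
  "badic b = {x. \<exists>n. real b ^ n * x \<in> \<int>}"

lemma countable_badic:
  assumes "b \<ge> 2"
  shows "countable (badic b)"
proof (rule countable_subset)
  show "badic b \<subseteq> range (\<lambda>(m :: int, n :: nat). real_of_int m / real b ^ n)"
  proof
    fix x assume "x \<in> badic b"
    then obtain n m where "real b ^ n * x = real_of_int m"
      by (auto simp: badic_def elim!: Ints_cases)
    then have "x = real_of_int m / real b ^ n" using assms by (simp add: field_simps)
    then show "x \<in> range (\<lambda>(m :: int, n :: nat). real_of_int m / real b ^ n)"
      by (auto intro: range_eqI[of _ _ "(m, n)"])
  qed
qed simp

lemma eventually_ceiling_eq:
  fixes y :: real
  assumes "y \<notin> \<int>"
  shows "\<forall>\<^sub>F x in nhds y. \<lceil>x\<rceil> = \<lceil>y\<rceil>"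
proof -
  have "real_of_int \<lceil>y\<rceil> \<noteq> y" using assms by (metis Ints_of_int)
  then have "y \<in> {real_of_int \<lceil>y\<rceil> - 1<..<real_of_int \<lceil>y\<rceil>}"
    unfolding greaterThanLessThan_iff by (intro conjI; linarith)
  then have "\<forall>\<^sub>F x in nhds y. x \<in> {real_of_int \<lceil>y\<rceil> - 1<..<real_of_int \<lceil>y\<rceil>}"
    by (intro eventually_nhds_in_open) auto
  then show ?thesis
    by eventually_elim (intro ceiling_unique, auto)
qed

text \<open>Digit \<open>j\<close> can only jump where \<open>b ^ j * x\<close> is an integer, and
  these points have been removed.\<close>

lemma locally_constant_cdigit:
  "locally_constant (top_of_set ({0..<1} - badic b)) (\<lambda>x. cdigit b x j)"
  unfolding locally_constant_def
proof
  fix x assume "x \<in> topspace (top_of_set ({0..<1} - badic b))"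
  then have x: "x \<in> {0..<1} - badic b" by simp
  then have "real b ^ j * x \<notin> \<int>" by (auto simp: badic_def)
  then have ev: "\<forall>\<^sub>F z in nhds (real b ^ j * x). \<lceil>z\<rceil> = \<lceil>real b ^ j * x\<rceil>"
    by (rule eventually_ceiling_eq)
  have "\<forall>\<^sub>F y in nhds x. \<lceil>real b ^ j * y\<rceil> = \<lceil>real b ^ j * x\<rceil>"
    by (rule eventually_compose_filterlim[OF ev]) (intro tendsto_intros filterlim_ident)
  then obtain U where U: "open U" "x \<in> U" "\<And>y. y \<in> U \<Longrightarrow> \<lceil>real b ^ j * y\<rceil> = \<lceil>real b ^ j * x\<rceil>"
    unfolding eventually_nhds by blast
  show "\<exists>V. openin (top_of_set ({0..<1} - badic b)) V \<and> x \<in> V \<and> (\<forall>y\<in>V. cdigit b y j = cdigit b x j)"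
  proof (intro exI conjI ballI)
    show "openin (top_of_set ({0..<1} - badic b)) (({0..<1} - badic b) \<inter> U)"
      using U(1) by (rule openin_open_Int)
    show "x \<in> ({0..<1} - badic b) \<inter> U" using x U(2) by simp
    fix y assume "y \<in> ({0..<1} - badic b) \<inter> U"
    then have "\<lceil>real b ^ j * y\<rceil> = \<lceil>real b ^ j * x\<rceil>" by (intro U(3)) simp
    then show "cdigit b y j = cdigit b x j" unfolding cdigit_def by (rule arg_cong)
  qed
qed

lemma locally_constant_closedin:
  assumes "locally_constant X P"
  shows "closedin X {x \<in> topspace X. P x}"
proof -
  have "openin X {x \<in> topspace X. \<not> P x}"
  proof (subst openin_subopen, intro ballI)
    fix x assume x: "x \<in> {x \<in> topspace X. \<not> P x}"
    then obtain U where U: "openin X U" "x \<in> U" "\<forall>y\<in>U. P y = P x"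
      using assms unfolding locally_constant_def by blast
    have "U \<subseteq> {x \<in> topspace X. \<not> P x}"
      using U(1,3) x openin_subset by blast
    then show "\<exists>T. openin X T \<and> x \<in> T \<and> T \<subseteq> {x \<in> topspace X. \<not> P x}"
      using U(1,2) by blast
  qed
  moreover have "topspace X - {x \<in> topspace X. P x} = {x \<in> topspace X. \<not> P x}" by blast
  ultimately show ?thesis by (simp add: closedin_def)
qed

lemma Pi03_in_Un_fsigma:
  assumes "Pi03_in X A" "fsigma_in X F"
  shows "Pi03_in X (A \<union> F)"
proof -
  obtain G :: "nat \<Rightarrow> 'a set" where G: "\<And>n. fsigma_in X (G n)" "A = topspace X \<inter> (\<Inter>n. G n)"
    using assms(1) unfolding Pi03_in_iff by blast
  have "A \<union> F = topspace X \<inter> (\<Inter>n. G n \<union> F)"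
    using G(2) fsigma_in_subset[OF assms(2)] by auto
  moreover have "fsigma_in X (G n \<union> F)" for n
    using G(1) assms(2) by (rule fsigma_in_Un)
  ultimately show ?thesis
    unfolding Pi03_in_iff by (intro exI[of _ "\<lambda>n. G n \<union> F"] conjI allI)
qed

text \<open>The cylinders of nonterminating expansions are half-open intervals, so that conditions on
  finitely many digits need not define closed sets; they do off the countable set of \<open>b\<close>-adic
  rationals, and a countable set may be added to a \<open>\<Pi>\<^sup>0\<^sub>3\<close> set.\<close>

lemma Pi03_digit_condition:
  fixes R :: "'i::countable \<Rightarrow> nat \<Rightarrow> (nat \<Rightarrow> nat) \<Rightarrow> bool"
  assumes b: "b \<ge> 2"
    and fin: "\<And>i n. \<exists>m. \<forall>d e. (\<forall>j\<in>{1..m}. d j = e j) \<longrightarrow> R i n d = R i n e"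
    and S: "S \<subseteq> {0..<1}"
    and R: "\<And>x. x \<in> {0..<1} - badic b \<Longrightarrow> x \<in> S \<longleftrightarrow> (\<forall>i. \<exists>N. \<forall>n\<ge>N. R i n (cdigit b x))"
  shows "Pi03_in (top_of_set {0..<1}) S"
proof -
  let ?Y = "top_of_set {0..<1::real}"
  define G where "G = {0..<1} - badic b"
  have subG: "subtopology ?Y G = top_of_set G"
    unfolding G_def by (simp add: subtopology_subtopology Int_absorb1 Diff_subset)
  define E where "E i N = {x \<in> G. \<forall>n\<ge>N. R i n (cdigit b x)}" for i N
  have "closedin (top_of_set G) (E i N)" for i N
  proof -
    have "closedin (top_of_set G) {x \<in> G. R i n (cdigit b x)}" for n
    proof -
      obtain m where m: "\<And>d e. (\<forall>j\<in>{1..m}. d j = e j) \<Longrightarrow> R i n d = R i n e" using fin by blast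
      have "locally_constant (top_of_set G) (\<lambda>x. R i n (cdigit b x))"
        unfolding G_def
      proof (rule locally_constant_of_finite[of "{1..m}" _ "\<lambda>j x. cdigit b x j"])
        show "\<And>x y. \<forall>i\<in>{1..m}. cdigit b y i = cdigit b x i \<Longrightarrow> R i n (cdigit b y) = R i n (cdigit b x)"
          by (rule m)
      qed (simp_all add: locally_constant_cdigit)
      from locally_constant_closedin[OF this] show ?thesis by simp
    qed
    then have "closedin (top_of_set G) (\<Inter>n\<in>{N..}. {x \<in> G. R i n (cdigit b x)})"
      by (intro closedin_INT) auto
    moreover have "(\<Inter>n\<in>{N..}. {x \<in> G. R i n (cdigit b x)}) = E i N"
      by (auto simp: E_def)
    ultimately show ?thesis by simp
  qed
  then have "\<exists>C. closedin ?Y C \<and> E i N = C \<inter> G" for i N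
    unfolding subG[symmetric] closedin_subtopology by blast
  then obtain C where C: "\<And>i N. closedin ?Y (C i N)"
      "\<And>i N. E i N = C i N \<inter> G"
    by metis
  \<comment> \<open>The sets \<open>E i N\<close> are closed only relative to \<open>G\<close>, so
    closed sets \<open>C i N\<close> of the whole interval with these traces replace them.
    \<open>G\<close> itself is then enforced by the complements of single points, which are open and
    therefore F-sigma.\<close>
  define \<U> where "\<U> = range (\<lambda>i. \<Union>N. C i N) \<union> (\<lambda>q. {0..<1} - {q}) ` badic b"
  have "countable \<U>"
    unfolding \<U>_def using countable_badic[OF b] by simp
  moreover have "\<U> \<subseteq> Collect (fsigma_in ?Y)"
  proof -
    have "fsigma_in ?Y (\<Union>N. C i N)" for i
      by (rule fsigma_in_Union) (auto intro: closed_imp_fsigma_in C(1))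
    moreover have "fsigma_in ?Y ({0..<1} - {q})" for q
    proof (rule open_imp_fsigma_in)
      show "metrizable_space ?Y"
        by (simp add: metrizable_space_subtopology metrizable_space_euclidean)
      have "openin ?Y ({0..<1} \<inter> - {q})" by (rule openin_open_Int) auto
      then show "openin ?Y ({0..<1} - {q})" by (simp add: Diff_eq)
    qed
    ultimately show ?thesis unfolding \<U>_def by auto
  qed
  moreover have "S \<inter> G = {0..<1} \<inter> \<Inter>\<U>"
  proof -
    have "x \<in> S \<inter> G \<longleftrightarrow> x \<in> G \<and> (\<forall>i. \<exists>N. x \<in> C i N)" for x
    proof -
      have "x \<in> C i N \<longleftrightarrow> (\<forall>n\<ge>N. R i n (cdigit b x))" if "x \<in> G" for i N
        using C(2)[of i N] that unfolding E_def by blast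
      then show ?thesis using R[of x] unfolding G_def by auto
    qed
    moreover have "x \<in> {0..<1} \<inter> \<Inter>\<U> \<longleftrightarrow> x \<in> G \<and> (\<forall>i. \<exists>N. x \<in> C i N)" for x
      unfolding \<U>_def G_def by (simp only: Inter_Un_distrib) auto
    ultimately show ?thesis by blast
  qed
  ultimately have "Pi03_in ?Y (S \<inter> G)"
    unfolding Pi03_in_def relative_to_def intersection_of_def topspace_euclidean_subtopology by blast
  moreover have "fsigma_in ?Y (S \<inter> badic b)"
  proof -
    have "fsigma_in ?Y (\<Union>x\<in>S \<inter> badic b. {x})"
    proof (rule fsigma_in_Union)
      show "countable ((\<lambda>x. {x}) ` (S \<inter> badic b))" using countable_badic[OF b] by (simp add: countable_Int2)
    next
      fix T assume "T \<in> (\<lambda>x. {x}) ` (S \<inter> badic b)"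
      then show "fsigma_in ?Y T"
        using S by (auto intro!: closed_imp_fsigma_in closed_subset)
    qed
    then show ?thesis by simp
  qed
  ultimately have "Pi03_in ?Y ((S \<inter> G) \<union> (S \<inter> badic b))" by (rule Pi03_in_Un_fsigma)
  moreover have "(S \<inter> G) \<union> (S \<inter> badic b) = S" using S by (auto simp: G_def)
  ultimately show ?thesis by simp
qed

text \<open>A countable range of tolerances, as the countable index type in
  \<open>Pi03_digit_condition\<close> demands.\<close>

lemma LIMSEQ_iff_Suc:
  fixes X :: "nat \<Rightarrow> real"
  shows "X \<longlonglongrightarrow> c \<longleftrightarrow> (\<forall>m. \<exists>N. \<forall>n\<ge>N. \<bar>X n - c\<bar> < 1 / real (Suc m))"
proof
  assume "X \<longlonglongrightarrow> c"
  then show "\<forall>m. \<exists>N. \<forall>n\<ge>N. \<bar>X n - c\<bar> < 1 / real (Suc m)"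
    unfolding lim_sequentially dist_real_def by simp
next
  assume *: "\<forall>m. \<exists>N. \<forall>n\<ge>N. \<bar>X n - c\<bar> < 1 / real (Suc m)"
  show "X \<longlonglongrightarrow> c"
    unfolding lim_sequentially dist_real_def
  proof (intro allI impI)
    fix r :: real assume "r > 0"
    then obtain m where m: "1 / real (Suc m) < r" by (metis nat_approx_posE)
    from * obtain N where "\<forall>n\<ge>N. \<bar>X n - c\<bar> < 1 / real (Suc m)" by blast
    then show "\<exists>N. \<forall>n\<ge>N. \<bar>X n - c\<bar> < r" using m by (meson less_trans)
  qed
qed

lemma badic_expansion:
  assumes "b \<ge> 2" "x \<in> {0..<1} - badic b"
  shows "is_expansion b x (cdigit b x)"
proof (rule is_expansion_cdigit[OF assms(1)])
  have "0 \<in> badic b" by (simp add: badic_def)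
  then show "0 < x" using assms(2) by (metis DiffE atLeastLessThan_iff order_le_less)
  show "x \<le> 1" using assms(2) by simp
qed

lemma Pi03_borel_normal:
  assumes b: "b \<ge> 2"
  shows "Pi03_in (top_of_set {0..<1}) (borel_normal b)"
proof (rule Pi03_digit_condition[OF b, where
    R = "\<lambda>(w, m) n d. set w \<subseteq> {..<b} \<longrightarrow>
      \<bar>real (occurrences w (prefix_upto d (real n))) / real n - 1 / real b ^ length w\<bar> < 1 / real (Suc m)"])
  fix i :: "nat list \<times> nat" and n
  show "\<exists>m. \<forall>d e. (\<forall>j\<in>{1..m}. d j = e j) \<longrightarrow>
    (case i of (w, m) \<Rightarrow> \<lambda>n d. set w \<subseteq> {..<b} \<longrightarrow>
      \<bar>real (occurrences w (prefix_upto d (real n))) / real n - 1 / real b ^ length w\<bar> < 1 / real (Suc m)) n d =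
    (case i of (w, m) \<Rightarrow> \<lambda>n d. set w \<subseteq> {..<b} \<longrightarrow>
      \<bar>real (occurrences w (prefix_upto d (real n))) / real n - 1 / real b ^ length w\<bar> < 1 / real (Suc m)) n e"
  proof (intro exI allI impI)
    fix d e :: "nat \<Rightarrow> nat" assume "\<forall>j\<in>{1..n}. d j = e j"
    then have "prefix_upto d (real n) = prefix_upto e (real n)" by (intro prefix_upto_cong) auto
    then show "(case i of (w, m) \<Rightarrow> \<lambda>n d. set w \<subseteq> {..<b} \<longrightarrow>
      \<bar>real (occurrences w (prefix_upto d (real n))) / real n - 1 / real b ^ length w\<bar> < 1 / real (Suc m)) n d =
    (case i of (w, m) \<Rightarrow> \<lambda>n d. set w \<subseteq> {..<b} \<longrightarrow>
      \<bar>real (occurrences w (prefix_upto d (real n))) / real n - 1 / real b ^ length w\<bar> < 1 / real (Suc m)) n e"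
      by (simp split: prod.split)
  qed
next
  show "borel_normal b \<subseteq> {0..<1}" by (auto simp: borel_normal_def)
next
  fix x assume x: "x \<in> {0..<1} - badic b"
  have "x \<in> borel_normal b \<longleftrightarrow> normal_seq b (cdigit b x)"
    using borel_normal_iff[OF b badic_expansion[OF b x]] x by simp
  also have "\<dots> \<longleftrightarrow> (\<forall>w m. set w \<subseteq> {..<b} \<longrightarrow> (\<exists>N. \<forall>n\<ge>N.
      \<bar>real (occurrences w (prefix_upto (cdigit b x) (real n))) / real n - 1 / real b ^ length w\<bar> < 1 / real (Suc m)))"
    unfolding normal_seq_def LIMSEQ_iff_Suc by blast
  finally show "x \<in> borel_normal b \<longleftrightarrow> (\<forall>i. \<exists>N. \<forall>n\<ge>N. (case i of (w, m) \<Rightarrow> \<lambda>n d. set w \<subseteq> {..<b} \<longrightarrow>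
      \<bar>real (occurrences w (prefix_upto d (real n))) / real n - 1 / real b ^ length w\<bar> < 1 / real (Suc m)) n (cdigit b x))"
    by (simp only: split_paired_All prod.case) blast
qed

lemma finite_word_set: "finite {w. length w = k \<and> set w \<subseteq> {..<b::nat} \<and> P w}"
  by (rule finite_subset[OF _ finite_lists_length_eq[of "{..<b}" k]]) auto

lemma sum_Z_freq:
  assumes "L > 0"
  shows "(\<Sum>i\<le>j. Z_freq b d L i k) =
    real (card {w. length w = k \<and> set w \<subseteq> {..<b} \<and> hits d w (Suc (nat \<lfloor>L * real b ^ k\<rfloor>)) \<le> j}) / real b ^ k"
proof -
  let ?h = "\<lambda>w. hits d w (Suc (nat \<lfloor>L * real b ^ k\<rfloor>))"
  have "{w. length w = k \<and> set w \<subseteq> {..<b} \<and> ?h w \<le> j} = (\<Union>i\<in>{..j}. {w. length w = k \<and> set w \<subseteq> {..<b} \<and> ?h w = i})"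
    by auto
  then have "card {w. length w = k \<and> set w \<subseteq> {..<b} \<and> ?h w \<le> j} =
      (\<Sum>i\<le>j. card {w. length w = k \<and> set w \<subseteq> {..<b} \<and> ?h w = i})"
    by (simp only:, subst card_UN_disjoint) (auto simp: finite_word_set)
  then show ?thesis by (simp add: Z_freq_hits[OF assms] sum_divide_distrib)
qed

text \<open>The sums over \<open>i \<le> j\<close> are antitone in \<open>L\<close>, which lets one pass from rational to real \<open>L\<close>.\<close>

lemma poisson_seq_rat:
  "poisson_seq b d \<longleftrightarrow>
     (\<forall>(q :: rat) j. q > 0 \<longrightarrow>
        (\<lambda>k. Z_freq b d (of_rat q) j k) \<longlonglongrightarrow> exp (- of_rat q) * of_rat q ^ j / fact j)"
proof
  assume *: "\<forall>(q :: rat) j. q > 0 \<longrightarrow>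
        (\<lambda>k. Z_freq b d (of_rat q) j k) \<longlonglongrightarrow> exp (- of_rat q) * of_rat q ^ j / fact j"
  define P where "P L j = (\<Sum>i\<le>j. exp (- L) * L ^ i / fact i)" for L :: real and j
  define Q where "Q L j k = (\<Sum>i\<le>j. Z_freq b d L i k)" for L j k
  have lim_rat: "(\<lambda>k. Q (of_rat q) j k) \<longlonglongrightarrow> P (of_rat q) j" if "q > 0" for q :: rat and j
    unfolding P_def Q_def by (intro tendsto_sum) (use * that in blast)
  have anti: "Q L' j k \<le> Q L j k" if "0 < L" "L \<le> L'" for L L' j k
  proof -
    have "nat \<lfloor>L * real b ^ k\<rfloor> \<le> nat \<lfloor>L' * real b ^ k\<rfloor>"
      by (intro nat_mono floor_mono mult_right_mono that) simp
    then have "hits d w (Suc (nat \<lfloor>L * real b ^ k\<rfloor>)) \<le> hits d w (Suc (nat \<lfloor>L' * real b ^ k\<rfloor>))" for w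
      by (intro hits_mono) simp
    then have "card {w. length w = k \<and> set w \<subseteq> {..<b} \<and> hits d w (Suc (nat \<lfloor>L' * real b ^ k\<rfloor>)) \<le> j}
        \<le> card {w. length w = k \<and> set w \<subseteq> {..<b} \<and> hits d w (Suc (nat \<lfloor>L * real b ^ k\<rfloor>)) \<le> j}"
      by (intro card_mono finite_word_set) (auto intro: order_trans)
    then show ?thesis
      using that unfolding Q_def by (simp add: sum_Z_freq divide_right_mono)
  qed
  have lim: "(\<lambda>k. Q L j k) \<longlonglongrightarrow> P L j" if L: "L > 0" for L j
  proof (rule order_tendstoI)
    have cont: "(\<lambda>L. P L j) \<midarrow>L\<rightarrow> P L j"
      unfolding P_def by (intro tendsto_intros) simp_all
    fix a assume "a < P L j"
    then have "\<forall>\<^sub>F M in at L. a < P M j" by (rule order_tendstoD(1)[OF cont])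
    then obtain e where e: "e > 0" "\<And>M. M \<noteq> L \<Longrightarrow> \<bar>M - L\<bar> < e \<Longrightarrow> a < P M j"
      unfolding eventually_at dist_real_def by blast
    \<comment> \<open>\<open>Q\<close> is antitone in its first argument: a lower bound at
      \<open>L\<close> comes from a rational just above \<open>L\<close>, an upper bound from one
      just below.\<close>
    obtain q where q: "L < of_rat q" "of_rat q < L + e" using of_rat_dense[of L "L + e"] e(1) by auto
    then have "q > 0" using L by (metis less_trans zero_less_of_rat_iff)
    have "a < P (of_rat q) j" by (rule e(2)) (use q in auto)
    with lim_rat[OF \<open>q > 0\<close>] have "\<forall>\<^sub>F k in sequentially. a < Q (of_rat q) j k"
      by (rule order_tendstoD(1))
    then show "\<forall>\<^sub>F k in sequentially. a < Q L j k"
      by eventually_elim (use anti[of L "of_rat q"] L q in \<open>auto intro: less_le_trans\<close>)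
  next
    have cont: "(\<lambda>L. P L j) \<midarrow>L\<rightarrow> P L j"
      unfolding P_def by (intro tendsto_intros) simp_all
    fix a assume "P L j < a"
    then have "\<forall>\<^sub>F M in at L. P M j < a" by (rule order_tendstoD(2)[OF cont])
    then obtain e where e: "e > 0" "\<And>M. M \<noteq> L \<Longrightarrow> \<bar>M - L\<bar> < e \<Longrightarrow> P M j < a"
      unfolding eventually_at dist_real_def by blast
    obtain q where q: "max 0 (L - e) < of_rat q" "of_rat q < L"
      using of_rat_dense[of "max 0 (L - e)" L] e(1) L by auto
    then have "q > 0" by simp
    have "P (of_rat q) j < a" by (rule e(2)) (use q in auto)
    with lim_rat[OF \<open>q > 0\<close>] have "\<forall>\<^sub>F k in sequentially. Q (of_rat q) j k < a"
      by (rule order_tendstoD(2))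
    then show "\<forall>\<^sub>F k in sequentially. Q L j k < a"
      by eventually_elim (use anti[of "of_rat q" L] L q in \<open>auto intro: le_less_trans\<close>)
  qed
  show "poisson_seq b d"
    unfolding poisson_seq_def
  proof (intro allI impI)
    fix L :: real and j assume L: "L > 0"
    show "(\<lambda>k. Z_freq b d L j k) \<longlonglongrightarrow> exp (- L) * L ^ j / fact j"
    proof (cases j)
      case 0
      then show ?thesis using lim[OF L, of 0] by (simp add: P_def Q_def)
    next
      case (Suc i)
      \<comment> \<open>A single frequency is the difference of two consecutive cumulative
        ones.\<close>
      have "(\<lambda>k. Q L j k - Q L i k) \<longlonglongrightarrow> P L j - P L i"
        by (intro tendsto_diff lim L)
      then show ?thesis by (simp add: P_def Q_def Suc)
    qed
  qed
qed (simp add: poisson_seq_def)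

lemma Pi03_poisson_generic:
  assumes b: "b \<ge> 2"
  shows "Pi03_in (top_of_set {0..<1}) (poisson_generic b)"
proof (rule Pi03_digit_condition[OF b, where
    R = "\<lambda>(q :: rat, j, m) k d. q > 0 \<longrightarrow>
      \<bar>Z_freq b d (of_rat q) j k - exp (- of_rat q) * of_rat q ^ j / fact j\<bar> < 1 / real (Suc m)"])
  fix i :: "rat \<times> nat \<times> nat" and n
  obtain q j l where i: "i = (q, j, l)" by (cases i)
  show "\<exists>m. \<forall>d e. (\<forall>j\<in>{1..m}. d j = e j) \<longrightarrow>
    (case i of (q :: rat, j, m) \<Rightarrow> \<lambda>k d. q > 0 \<longrightarrow>
      \<bar>Z_freq b d (of_rat q) j k - exp (- of_rat q) * of_rat q ^ j / fact j\<bar> < 1 / real (Suc m)) n d =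
    (case i of (q :: rat, j, m) \<Rightarrow> \<lambda>k d. q > 0 \<longrightarrow>
      \<bar>Z_freq b d (of_rat q) j k - exp (- of_rat q) * of_rat q ^ j / fact j\<bar> < 1 / real (Suc m)) n e"
  proof (intro exI[of _ "nat \<lfloor>of_rat q * real b ^ n + real n\<rfloor>"] allI impI)
    fix d e :: "nat \<Rightarrow> nat" assume "\<forall>j\<in>{1..nat \<lfloor>of_rat q * real b ^ n + real n\<rfloor>}. d j = e j"
    then have "prefix_upto d (of_rat q * real b ^ n + real n) = prefix_upto e (of_rat q * real b ^ n + real n)"
      by (intro prefix_upto_cong) auto
    then show "(case i of (q :: rat, j, m) \<Rightarrow> \<lambda>k d. q > 0 \<longrightarrow>
      \<bar>Z_freq b d (of_rat q) j k - exp (- of_rat q) * of_rat q ^ j / fact j\<bar> < 1 / real (Suc m)) n d =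
    (case i of (q :: rat, j, m) \<Rightarrow> \<lambda>k d. q > 0 \<longrightarrow>
      \<bar>Z_freq b d (of_rat q) j k - exp (- of_rat q) * of_rat q ^ j / fact j\<bar> < 1 / real (Suc m)) n e"
      by (simp add: i Z_freq_def)
  qed
next
  show "poisson_generic b \<subseteq> {0..<1}" by (auto simp: poisson_generic_def)
next
  fix x assume x: "x \<in> {0..<1} - badic b"
  have "x \<in> poisson_generic b \<longleftrightarrow> poisson_seq b (cdigit b x)"
    using poisson_generic_iff[OF b badic_expansion[OF b x]] x by simp
  also have "\<dots> \<longleftrightarrow> (\<forall>(q :: rat) j m. q > 0 \<longrightarrow> (\<exists>N. \<forall>k\<ge>N.
      \<bar>Z_freq b (cdigit b x) (of_rat q) j k - exp (- of_rat q) * of_rat q ^ j / fact j\<bar> < 1 / real (Suc m)))"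
    unfolding poisson_seq_rat LIMSEQ_iff_Suc by blast
  finally show "x \<in> poisson_generic b \<longleftrightarrow> (\<forall>i. \<exists>N. \<forall>n\<ge>N. (case i of (q :: rat, j, m) \<Rightarrow> \<lambda>k d. q > 0 \<longrightarrow>
      \<bar>Z_freq b d (of_rat q) j k - exp (- of_rat q) * of_rat q ^ j / fact j\<bar> < 1 / real (Suc m)) n (cdigit b x))"
    by (simp only: split_paired_All prod.case) blast
qed

section \<open>Uniformly random words\<close>

definition words :: "nat \<Rightarrow> nat \<Rightarrow> nat list set" where
  "words b m = {u. length u = m \<and> set u \<subseteq> {..<b}}"

lemma words_alt: "words b m = {u. set u \<subseteq> {..<b} \<and> length u = m}"
  by (auto simp: words_def)

lemma finite_words [simp]: "finite (words b m)"
  unfolding words_alt by (rule finite_lists_length_eq) simp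

lemma card_words [simp]: "card (words b m) = b ^ m"
  unfolding words_alt by (simp add: card_lists_length_eq)

lemma length_words: "u \<in> words b m \<Longrightarrow> length u = m"
  by (simp add: words_def)

lemma words_0 [simp]: "words b 0 = {[]}"
  by (auto simp: words_def)

lemma sum_words_Suc:
  "(\<Sum>u\<in>words b (Suc m). f u) = (\<Sum>c<b. \<Sum>v\<in>words b m. f (c # v))"
proof -
  have "words b (Suc m) = (\<lambda>(c, v). c # v) ` ({..<b} \<times> words b m)"
    by (auto simp: words_def length_Suc_conv image_iff)
  moreover have "inj_on (\<lambda>(c, v). c # v) ({..<b} \<times> words b m)"
    by (auto simp: inj_on_def)
  ultimately have "(\<Sum>u\<in>words b (Suc m). f u) = (\<Sum>(c, v)\<in>{..<b} \<times> words b m. f (c # v))"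
    by (simp add: sum.reindex case_prod_unfold)
  then show ?thesis by (simp add: sum.cartesian_product)
qed

lemma sum_words_append:
  "(\<Sum>u\<in>words b (m + n). f u) = (\<Sum>x\<in>words b m. \<Sum>y\<in>words b n. f (x @ y))"
  by (induction m arbitrary: f) (simp_all add: sum_words_Suc)

definition mean :: "nat \<Rightarrow> nat \<Rightarrow> (nat list \<Rightarrow> real) \<Rightarrow> real" where
  "mean b m f = (\<Sum>u\<in>words b m. f u) / real b ^ m"

definition bounded_differences :: "nat \<Rightarrow> nat \<Rightarrow> real \<Rightarrow> (nat list \<Rightarrow> real) \<Rightarrow> bool" where
  "bounded_differences b m c f \<longleftrightarrow>
     (\<forall>u\<in>words b m. \<forall>t<m. \<forall>a<b. \<bar>f (u[t := a]) - f u\<bar> \<le> c)"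

lemma mean_Suc: "mean b (Suc m) f = (\<Sum>a<b. mean b m (\<lambda>v. f (a # v))) / real b"
  by (simp add: mean_def sum_words_Suc sum_divide_distrib field_simps)

lemma mean_add: "mean b m (\<lambda>u. f u + g u) = mean b m f + mean b m g"
  by (simp add: mean_def sum.distrib add_divide_distrib)

lemma mean_diff: "mean b m (\<lambda>u. f u - g u) = mean b m f - mean b m g"
  by (simp add: mean_def sum_subtractf diff_divide_distrib)

lemma mean_cmult: "mean b m (\<lambda>u. c * f u) = c * mean b m f"
  by (simp add: mean_def sum_distrib_left)

lemma mean_const: "b > 0 \<Longrightarrow> mean b m (\<lambda>u. c) = c"
  by (simp add: mean_def)

lemma mean_mono:
  assumes "\<And>u. u \<in> words b m \<Longrightarrow> f u \<le> g u"
  shows "mean b m f \<le> mean b m g"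
  unfolding mean_def by (intro divide_right_mono sum_mono assms) simp_all

text \<open>A crude form of the Efron--Stein inequality.\<close>

lemma variance_bounded_differences:
  assumes "b > 0" "c \<ge> 0" "bounded_differences b m c f"
  shows "mean b m (\<lambda>u. (f u - mean b m f)\<^sup>2) \<le> real m * c\<^sup>2"
  using assms(3)
proof (induction m arbitrary: f)
  case 0
  then show ?case by (simp add: mean_def)
next
  case (Suc m)
  define \<mu> where "\<mu> = mean b (Suc m) f"
  define \<nu> where "\<nu> a = mean b m (\<lambda>v. f (a # v))" for a
  have \<mu>: "\<mu> = (\<Sum>a<b. \<nu> a) / real b"
    by (simp add: \<mu>_def \<nu>_def mean_Suc)
  have bd: "bounded_differences b m c (\<lambda>v. f (a # v))" if "a < b" for a
    unfolding bounded_differences_def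
  proof (intro ballI allI impI)
    fix u t x assume *: "u \<in> words b m" "t < m" "x < b"
    have "\<bar>f ((a # u)[Suc t := x]) - f (a # u)\<bar> \<le> c"
      by (rule Suc.prems[unfolded bounded_differences_def, rule_format])
        (use * that in \<open>auto simp: words_def\<close>)
    then show "\<bar>f (a # u[t := x]) - f (a # u)\<bar> \<le> c" by simp
  qed
  have diff: "\<bar>\<nu> a - \<nu> a'\<bar> \<le> c" if "a < b" "a' < b" for a a'
  proof -
    have "f (a # v) - f (a' # v) \<le> c \<and> f (a' # v) - f (a # v) \<le> c" if "v \<in> words b m" for v
    proof -
      have "\<bar>f ((a # v)[0 := a']) - f (a # v)\<bar> \<le> c"
        by (rule Suc.prems[unfolded bounded_differences_def, rule_format])
          (use that \<open>a < b\<close> \<open>a' < b\<close> in \<open>auto simp: words_def\<close>)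
      then show ?thesis by auto
    qed
    then have "mean b m (\<lambda>v. f (a # v) - f (a' # v)) \<le> mean b m (\<lambda>_. c)"
        "mean b m (\<lambda>v. f (a' # v) - f (a # v)) \<le> mean b m (\<lambda>_. c)"
      by (intro mean_mono; blast)+
    then show ?thesis
      using assms(1) by (simp add: mean_diff mean_const \<nu>_def)
  qed
  \<comment> \<open>The conditional means given the first digit differ pairwise by at most
    \<open>c\<close>, hence also from their average.\<close>
  have "(\<nu> a - \<mu>)\<^sup>2 \<le> c\<^sup>2" if "a < b" for a
  proof -
    have "\<nu> a - \<mu> = (\<Sum>a'<b. \<nu> a - \<nu> a') / real b"
      using assms(1) by (simp add: \<mu> sum_subtractf field_simps)
    also have "\<bar>\<dots>\<bar> \<le> (\<Sum>a'<b. c) / real b"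
      unfolding abs_divide abs_of_nat
      by (intro divide_right_mono order_trans[OF sum_abs] sum_mono) (use diff that in auto)
    finally have "\<bar>\<nu> a - \<mu>\<bar> \<le> c" using assms(1) by simp
    then show ?thesis by (metis abs_ge_zero power2_abs power_mono)
  qed
  \<comment> \<open>Conditioning on the first digit: the cross term has mean 0, so the variance is
    the conditional variance plus that of the conditional mean, and each digit contributes at most
    the square of \<open>c\<close>.\<close>
  moreover have "mean b m (\<lambda>v. (f (a # v) - \<mu>)\<^sup>2) = mean b m (\<lambda>v. (f (a # v) - \<nu> a)\<^sup>2) + (\<nu> a - \<mu>)\<^sup>2" for a
  proof -
    have "(f (a # v) - \<mu>)\<^sup>2 = ((f (a # v) - \<nu> a)\<^sup>2 + (\<nu> a - \<mu>)\<^sup>2) + (2 * (\<nu> a - \<mu>)) * (f (a # v) - \<nu> a)" for v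
      by (simp add: power2_eq_square algebra_simps)
    then show ?thesis
      using assms(1) by (simp add: mean_add mean_cmult mean_diff mean_const \<nu>_def[symmetric])
  qed
  moreover have "mean b m (\<lambda>v. (f (a # v) - \<nu> a)\<^sup>2) \<le> real m * c\<^sup>2" if "a < b" for a
    unfolding \<nu>_def by (rule Suc.IH[OF bd[OF that]])
  ultimately have "mean b m (\<lambda>v. (f (a # v) - \<mu>)\<^sup>2) \<le> real m * c\<^sup>2 + c\<^sup>2" if "a < b" for a
    using that by (simp add: add_mono)
  then have "(\<Sum>a<b. mean b m (\<lambda>v. (f (a # v) - \<mu>)\<^sup>2)) / real b \<le> (\<Sum>a<b. real m * c\<^sup>2 + c\<^sup>2) / real b"
    by (intro divide_right_mono sum_mono) auto
  also have "\<dots> = real (Suc m) * c\<^sup>2"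
    using assms(1) by (simp add: field_simps)
  finally show ?case
    by (simp add: mean_Suc[of b m "\<lambda>u. (f u - mean b (Suc m) f)\<^sup>2"] \<mu>_def)
qed

lemma chebyshev_bounded_differences:
  assumes "b > 0" "c \<ge> 0" "bounded_differences b m c f" "\<epsilon> > 0"
  shows "real (card {u \<in> words b m. \<epsilon> \<le> \<bar>f u - mean b m f\<bar>}) / real b ^ m \<le> real m * c\<^sup>2 / \<epsilon>\<^sup>2"
proof -
  let ?A = "{u \<in> words b m. \<epsilon> \<le> \<bar>f u - mean b m f\<bar>}"
  have "real (card ?A) * \<epsilon>\<^sup>2 = (\<Sum>u\<in>?A. \<epsilon>\<^sup>2)" by simp
  also have "\<dots> \<le> (\<Sum>u\<in>?A. (f u - mean b m f)\<^sup>2)"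
    by (intro sum_mono) (use assms(4) in \<open>auto simp: abs_le_square_iff[symmetric]\<close>)
  also have "\<dots> \<le> (\<Sum>u\<in>words b m. (f u - mean b m f)\<^sup>2)"
    by (intro sum_mono2) auto
  finally have "real (card ?A) * \<epsilon>\<^sup>2 / real b ^ m \<le> mean b m (\<lambda>u. (f u - mean b m f)\<^sup>2)"
    unfolding mean_def by (intro divide_right_mono) simp_all
  also have "\<dots> \<le> real m * c\<^sup>2"
    by (rule variance_bounded_differences[OF assms(1-3)])
  finally show ?thesis using assms(4) by (simp add: pos_le_divide_eq)
qed

section \<open>The mean number of words occurring a given number of times\<close>

text \<open>Unlike in \<open>occurrences\<close>, the number \<open>n\<close> of windows is free, so
  that the law of the count can be followed as \<open>n\<close> grows inside one fixed random
  text.\<close>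

definition occ :: "nat \<Rightarrow> nat list \<Rightarrow> nat list \<Rightarrow> nat" where
  "occ n w u = card {i. i < n \<and> take (length w) (drop i u) = w}"

lemma take_drop_words: "u \<in> words b m \<Longrightarrow> i + k \<le> m \<Longrightarrow> take k (drop i u) \<in> words b k"
  by (auto simp: words_def dest!: in_set_takeD in_set_dropD)

lemma occ_0 [simp]: "occ 0 w u = 0"
  by (simp add: occ_def)

lemma occ_Suc: "occ (Suc n) w u = occ n w u + of_bool (take (length w) (drop n u) = w)"
proof -
  have "{i. i < Suc n \<and> take (length w) (drop i u) = w} =
    (if take (length w) (drop n u) = w then insert n {i. i < n \<and> take (length w) (drop i u) = w}
     else {i. i < n \<and> take (length w) (drop i u) = w})"
    by (auto simp: less_Suc_eq)
  then show ?thesis by (simp add: occ_def)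
qed

lemma occ_eq_if_no_match:
  assumes "m \<le> n" "\<And>i. m \<le> i \<Longrightarrow> i < n \<Longrightarrow> take (length w) (drop i u) \<noteq> w"
  shows "occ n w u = occ m w u"
  unfolding occ_def by (rule arg_cong[where f = card]) (use assms in \<open>auto simp: not_le[symmetric]\<close>)

text \<open>The first \<open>n - k\<close> windows lie inside the first \<open>n\<close> letters;
  this is what makes their count independent of the window at \<open>n\<close>.\<close>

lemma occ_take: "length w = k \<Longrightarrow> occ (n - k) w (take n u) = occ (n - k) w u"
  unfolding occ_def by (rule arg_cong[where f = card]) (auto simp: drop_take min_def)

lemma occurrences_eq_occ:
  assumes "length u + 1 = n + length w"
  shows "occurrences w u = occ n w u"
  unfolding occurrences_def occ_def by (rule arg_cong[where f = card]) (use assms in auto)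

lemma sum_words_split3:
  assumes "n \<le> N"
  shows "(\<Sum>u\<in>words b (N + k). f u) =
    (\<Sum>x\<in>words b n. \<Sum>y\<in>words b k. \<Sum>z\<in>words b (N - n). f (x @ y @ z))"
proof -
  have "N + k = n + (k + (N - n))" using assms by simp
  then have "(\<Sum>u\<in>words b (N + k). f u) = (\<Sum>u\<in>words b (n + (k + (N - n))). f u)"
    by (rule arg_cong[where f = "\<lambda>m. \<Sum>u\<in>words b m. f u"])
  then show ?thesis by (simp add: sum_words_append)
qed

text \<open>Even if the windows at \<open>i\<close> and \<open>n\<close> overlap, they agree with probability \<open>b\<^sup>-\<^sup>k\<close>: the window
  at \<open>n\<close> is determined by the letters before it.\<close>

lemma card_equal_windows:
  assumes "i < n" "n \<le> N"
  shows "card {u \<in> words b (N + k). take k (drop i u) = take k (drop n u)} \<le> b ^ N"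
proof -
  let ?A = "{u \<in> words b (N + k). take k (drop i u) = take k (drop n u)}"
  \<comment> \<open>Erasing the window at \<open>n\<close> loses nothing: its letters are restored
    from left to right, because letter \<open>n + s\<close> equals the earlier letter
    \<open>i + s\<close>.\<close>
  let ?f = "\<lambda>u. take n u @ drop (n + k) u"
  have "inj_on ?f ?A"
  proof (rule inj_onI)
    fix u v assume u: "u \<in> ?A" and v: "v \<in> ?A" and eq: "?f u = ?f v"
    have len: "length u = N + k" "length v = N + k" using u v by (auto simp: words_def)
    have eq1: "take n u = take n v" and eq2: "drop (n + k) u = drop (n + k) v"
      using eq len by auto
    have copy: "x ! (n + s) = x ! (i + s)" if "x \<in> ?A" "s < k" for x s
    proof -
      have "length x = N + k" using that by (auto simp: words_def)
      then have "take k (drop n x) ! s = x ! (n + s)" "take k (drop i x) ! s = x ! (i + s)"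
        using that(2) assms by simp_all
      moreover have "take k (drop i x) = take k (drop n x)" using that(1) by simp
      ultimately show ?thesis by simp
    qed
    have "u ! t = v ! t" if "t < N + k" for t
      using that
    proof (induction t rule: less_induct)
      case (less t)
      consider "t < n" | "n + k \<le> t" | "n \<le> t" "t < n + k" by linarith
      then show ?case
      proof cases
        case 1
        then show ?thesis using eq1 by (metis nth_take)
      next
        case 2
        have "u ! t = drop (n + k) u ! (t - (n + k))" "v ! t = drop (n + k) v ! (t - (n + k))"
          using 2 len assms(2) by simp_all
        then show ?thesis using eq2 by simp
      next
        case 3
        define s where "s = t - n"
        have s: "t = n + s" "s < k" using 3 by (auto simp: s_def)
        have "u ! (i + s) = v ! (i + s)" using less s assms by simp
        then show ?thesis using copy[OF u s(2)] copy[OF v s(2)] s by simp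
      qed
    qed
    then show "u = v" using len by (intro nth_equalityI) auto
  qed
  moreover have "?f ` ?A \<subseteq> words b N"
    using assms by (auto simp: words_def dest!: in_set_takeD in_set_dropD)
  ultimately have "card ?A \<le> card (words b N)"
    by (intro card_inj_on_le) auto
  then show ?thesis by simp
qed

text \<open>A uniform text of \<open>N + k\<close> letters, with \<open>N + 1\<close> windows of
  length \<open>k\<close>, and an independent uniform word. Averaging over both turns the mean
  proportion of words with \<open>j\<close> occurrences into a probability for one random
  pair.\<close>

locale random_word_pair =
  fixes b k N :: nat
  assumes b: "b \<ge> 2"
begin

definition \<beta> :: real where "\<beta> = 1 / real b ^ k"

definition E :: "(nat list \<Rightarrow> nat list \<Rightarrow> real) \<Rightarrow> real" where
  "E f = (\<Sum>u\<in>words b (N + k). \<Sum>w\<in>words b k. f u w) / (real b ^ (N + k) * real b ^ k)"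

definition match :: "nat \<Rightarrow> nat list \<Rightarrow> nat list \<Rightarrow> bool" where
  "match i u w \<longleftrightarrow> take k (drop i u) = w"

definition \<pi> :: "nat \<Rightarrow> nat \<Rightarrow> real" where
  "\<pi> j n = E (\<lambda>u w. of_bool (occ n w u = j))"

lemma \<beta>_pos: "\<beta> > 0" and \<beta>_le_1: "\<beta> \<le> 1"
  using b by (auto simp: \<beta>_def)

lemma E_add: "E (\<lambda>u w. f u w + g u w) = E f + E g"
  by (simp add: E_def sum.distrib add_divide_distrib)

lemma E_diff: "E (\<lambda>u w. f u w - g u w) = E f - E g"
  by (simp add: E_def sum_subtractf diff_divide_distrib)

lemma E_sum: "E (\<lambda>u w. \<Sum>i\<in>I. f i u w) = (\<Sum>i\<in>I. E (f i))"
proof -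
  have "(\<Sum>u\<in>words b (N + k). \<Sum>w\<in>words b k. \<Sum>i\<in>I. f i u w) =
      (\<Sum>u\<in>words b (N + k). \<Sum>i\<in>I. \<Sum>w\<in>words b k. f i u w)"
    by (intro sum.cong refl sum.swap)
  also have "\<dots> = (\<Sum>i\<in>I. \<Sum>u\<in>words b (N + k). \<Sum>w\<in>words b k. f i u w)"
    by (rule sum.swap)
  finally show ?thesis by (simp add: E_def sum_divide_distrib)
qed

lemma E_abs_diff_le:
  assumes "\<And>u w. u \<in> words b (N + k) \<Longrightarrow> w \<in> words b k \<Longrightarrow> \<bar>f u w - g u w\<bar> \<le> h u w"
  shows "\<bar>E f - E g\<bar> \<le> E h"
proof -
  have "\<bar>\<Sum>u\<in>words b (N + k). \<Sum>w\<in>words b k. f u w - g u w\<bar> \<le> (\<Sum>u\<in>words b (N + k). \<Sum>w\<in>words b k. h u w)"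
    by (intro order_trans[OF sum_abs] sum_mono assms)
  then have "\<bar>E (\<lambda>u w. f u w - g u w)\<bar> \<le> E h"
    unfolding E_def abs_divide by (simp add: divide_right_mono)
  then show ?thesis by (simp add: E_diff)
qed

lemma E_match:
  assumes "i \<le> N"
  shows "E (\<lambda>u w. of_bool (match i u w)) = \<beta>"
proof -
  have "(\<Sum>w\<in>words b k. of_bool (match i u w)) = (1 :: real)" if "u \<in> words b (N + k)" for u
    using take_drop_words[OF that, of i k] assms by (simp add: match_def of_bool_def)
  then have "(\<Sum>u\<in>words b (N + k). \<Sum>w\<in>words b k. of_bool (match i u w)) = real b ^ (N + k)"
    by simp
  then show ?thesis using b by (simp add: E_def \<beta>_def)
qed

text \<open>For a given text at most one word matches at both places, and none unless the two
  windows agree. The agreement costs one factor \<open>\<beta>\<close>, meeting that word the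
  other.\<close>

lemma E_match_match:
  assumes "i < n" "n \<le> N"
  shows "E (\<lambda>u w. of_bool (match i u w \<and> match n u w)) \<le> \<beta>\<^sup>2"
proof -
  have "(\<Sum>w\<in>words b k. of_bool (match i u w \<and> match n u w)) \<le> (of_bool (take k (drop i u) = take k (drop n u)) :: real)" for u
  proof -
    have "(\<Sum>w\<in>words b k. of_bool (match i u w \<and> match n u w)) \<le>
        (\<Sum>w\<in>words b k. if take k (drop i u) = w then of_bool (take k (drop i u) = take k (drop n u)) else (0 :: real))"
      by (rule sum_mono) (auto simp: match_def)
    also have "\<dots> \<le> of_bool (take k (drop i u) = take k (drop n u))"
      by simp
    finally show ?thesis .
  qed
  then have "(\<Sum>u\<in>words b (N + k). \<Sum>w\<in>words b k. of_bool (match i u w \<and> match n u w)) \<le>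
      (\<Sum>u\<in>words b (N + k). (of_bool (take k (drop i u) = take k (drop n u)) :: real))"
    by (rule sum_mono)
  also have "\<dots> = real (card {u \<in> words b (N + k). take k (drop i u) = take k (drop n u)})"
    by (simp add: of_bool_def sum.If_cases Int_def)
  also have "\<dots> \<le> real b ^ N"
    using card_equal_windows[OF assms, of b k] by (metis of_nat_le_iff of_nat_power)
  finally have "E (\<lambda>u w. of_bool (match i u w \<and> match n u w)) \<le> real b ^ N / (real b ^ (N + k) * real b ^ k)"
    unfolding E_def by (rule divide_right_mono) simp
  also have "\<dots> = \<beta>\<^sup>2" using b by (simp add: \<beta>_def power_add power2_eq_square)
  finally show ?thesis .
qed

text \<open>Split the text into the letters before \<open>n\<close>, the window at \<open>n\<close>
  and the rest. For each fixed word the match concerns only the middle part and \<open>Q\<close>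
  only the first.\<close>

lemma E_match_independent:
  assumes "n \<le> N"
  shows "E (\<lambda>u w. of_bool (match n u w \<and> Q w (take n u))) = \<beta> * E (\<lambda>u w. of_bool (Q w (take n u)))"
proof -
  have "real b ^ k * (\<Sum>u\<in>words b (N + k). of_bool (match n u w \<and> Q w (take n u))) =
      (\<Sum>u\<in>words b (N + k). (of_bool (Q w (take n u)) :: real))" if w: "w \<in> words b k" for w
  proof -
    have "(\<Sum>u\<in>words b (N + k). (of_bool (match n u w \<and> Q w (take n u)) :: real)) =
        (\<Sum>x\<in>words b n. \<Sum>y\<in>words b k. \<Sum>z\<in>words b (N - n). if w = y then of_bool (Q w x) else 0)"
      unfolding sum_words_split3[OF assms]
      by (intro sum.cong refl) (auto simp: match_def length_words)
    also have "\<dots> = (\<Sum>x\<in>words b n. \<Sum>y\<in>words b k. if w = y then real b ^ (N - n) * of_bool (Q w x) else 0)"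
      by (intro sum.cong refl) auto
    also have "\<dots> = (\<Sum>x\<in>words b n. real b ^ (N - n) * of_bool (Q w x))"
      using w by simp
    finally have 1: "(\<Sum>u\<in>words b (N + k). (of_bool (match n u w \<and> Q w (take n u)) :: real)) =
        (\<Sum>x\<in>words b n. real b ^ (N - n) * of_bool (Q w x))" .
    have "(\<Sum>u\<in>words b (N + k). (of_bool (Q w (take n u)) :: real)) =
        (\<Sum>x\<in>words b n. \<Sum>y\<in>words b k. \<Sum>z\<in>words b (N - n). of_bool (Q w x))"
      unfolding sum_words_split3[OF assms]
      by (intro sum.cong refl) (auto simp: length_words)
    also have "\<dots> = real b ^ k * (\<Sum>x\<in>words b n. real b ^ (N - n) * of_bool (Q w x))"
      by (simp only: sum_constant card_words of_nat_power sum_distrib_left)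
    finally show ?thesis using 1 by simp
  qed
  then have "real b ^ k * (\<Sum>w\<in>words b k. \<Sum>u\<in>words b (N + k). of_bool (match n u w \<and> Q w (take n u))) =
      (\<Sum>w\<in>words b k. \<Sum>u\<in>words b (N + k). (of_bool (Q w (take n u)) :: real))"
    by (simp add: sum_distrib_left)
  then have "real b ^ k * (\<Sum>u\<in>words b (N + k). \<Sum>w\<in>words b k. of_bool (match n u w \<and> Q w (take n u))) =
      (\<Sum>u\<in>words b (N + k). \<Sum>w\<in>words b k. (of_bool (Q w (take n u)) :: real))"
    by (simp only: sum.swap[of _ "words b (N + k)"])
  then show ?thesis using b by (simp add: E_def \<beta>_def field_simps)
qed

text \<open>Only the \<open>k\<close> windows just before \<open>n\<close> can overlap the window at
  \<open>n\<close>, so they are forgotten. Dropping them while a match at \<open>n\<close> is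
  required costs \<open>k\<close> times the probability of a double match; then independence
  applies; putting them back costs \<open>\<beta>\<close> times the probability
  \<open>k * \<beta>\<close> of a match among them.\<close>

lemma match_correlation:
  assumes n: "n \<le> N"
  shows "\<bar>E (\<lambda>u w. of_bool (match n u w \<and> occ n w u = j)) - \<beta> * \<pi> j n\<bar> \<le> 2 * real k * \<beta>\<^sup>2"
proof -
  let ?I = "{n - k..<n}"
  have cardI: "real (card ?I) \<le> real k" by simp
  have same: "occ n w u = occ (n - k) w u" if "w \<in> words b k" "\<And>i. i \<in> ?I \<Longrightarrow> \<not> match i u w" for u w
    by (rule occ_eq_if_no_match) (use that in \<open>auto simp: match_def words_def\<close>)
  have "\<bar>E (\<lambda>u w. of_bool (match n u w \<and> occ n w u = j)) - E (\<lambda>u w. of_bool (match n u w \<and> occ (n - k) w u = j))\<bar>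
      \<le> E (\<lambda>u w. \<Sum>i\<in>?I. of_bool (match i u w \<and> match n u w))"
  proof (rule E_abs_diff_le)
    fix u w assume "u \<in> words b (N + k)" and w: "w \<in> words b k"
    show "\<bar>of_bool (match n u w \<and> occ n w u = j) - of_bool (match n u w \<and> occ (n - k) w u = j)\<bar>
        \<le> (\<Sum>i\<in>?I. (of_bool (match i u w \<and> match n u w) :: real))"
    proof (cases "match n u w \<and> (\<exists>i\<in>?I. match i u w)")
      case True
      then obtain i where i: "i \<in> ?I" "match i u w" "match n u w" by auto
      have "(1 :: real) = of_bool (match i u w \<and> match n u w)" using i by simp
      also have "\<dots> \<le> (\<Sum>i\<in>?I. of_bool (match i u w \<and> match n u w))"
        by (rule member_le_sum) (use i in auto)
      finally show ?thesis by (auto simp: of_bool_def)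
    next
      case False
      then show ?thesis using same[OF w, of u] by (auto simp: sum_nonneg)
    qed
  qed
  also have "\<dots> = (\<Sum>i\<in>?I. E (\<lambda>u w. of_bool (match i u w \<and> match n u w)))"
    by (rule E_sum)
  also have "\<dots> \<le> (\<Sum>i\<in>?I. \<beta>\<^sup>2)"
    by (intro sum_mono E_match_match) (use n in auto)
  also have "\<dots> \<le> real k * \<beta>\<^sup>2"
    using cardI by (simp add: mult_right_mono)
  finally have 1: "\<bar>E (\<lambda>u w. of_bool (match n u w \<and> occ n w u = j)) - E (\<lambda>u w. of_bool (match n u w \<and> occ (n - k) w u = j))\<bar>
      \<le> real k * \<beta>\<^sup>2" .
  have "\<bar>\<pi> j (n - k) - \<pi> j n\<bar> \<le> E (\<lambda>u w. \<Sum>i\<in>?I. of_bool (match i u w))"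
    unfolding \<pi>_def
  proof (rule E_abs_diff_le)
    fix u w assume "u \<in> words b (N + k)" and w: "w \<in> words b k"
    show "\<bar>of_bool (occ (n - k) w u = j) - of_bool (occ n w u = j)\<bar>
        \<le> (\<Sum>i\<in>?I. (of_bool (match i u w) :: real))"
    proof (cases "\<exists>i\<in>?I. match i u w")
      case True
      then obtain i where i: "i \<in> ?I" "match i u w" by auto
      have "(1 :: real) = of_bool (match i u w)" using i by simp
      also have "\<dots> \<le> (\<Sum>i\<in>?I. of_bool (match i u w))"
        by (rule member_le_sum) (use i in auto)
      finally show ?thesis by (auto simp: of_bool_def)
    next
      case False
      then show ?thesis using same[OF w, of u] by (auto simp: sum_nonneg)
    qed
  qed
  also have "\<dots> = (\<Sum>i\<in>?I. E (\<lambda>u w. of_bool (match i u w)))"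
    by (rule E_sum)
  also have "\<dots> = (\<Sum>i\<in>?I. \<beta>)"
    by (intro sum.cong refl E_match) (use n in auto)
  also have "\<dots> \<le> real k * \<beta>"
    using cardI \<beta>_pos by (simp add: mult_right_mono)
  finally have "\<beta> * \<bar>\<pi> j (n - k) - \<pi> j n\<bar> \<le> \<beta> * (real k * \<beta>)"
    using \<beta>_pos by (intro mult_left_mono) auto
  then have 2: "\<bar>\<beta> * \<pi> j (n - k) - \<beta> * \<pi> j n\<bar> \<le> real k * \<beta>\<^sup>2"
    using \<beta>_pos by (simp add: abs_mult right_diff_distrib[symmetric] power2_eq_square ac_simps)
  have "E (\<lambda>u w. of_bool (match n u w \<and> occ (n - k) w u = j)) =
      E (\<lambda>u w. of_bool (match n u w \<and> occ (n - k) w (take n u) = j))"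
    unfolding E_def by (intro arg_cong2[where f = "(/)"] sum.cong refl) (simp add: occ_take length_words)
  also have "\<dots> = \<beta> * E (\<lambda>u w. of_bool (occ (n - k) w (take n u) = j))"
    by (rule E_match_independent[OF n, of "\<lambda>w x. occ (n - k) w x = j"])
  also have "E (\<lambda>u w. of_bool (occ (n - k) w (take n u) = j)) = \<pi> j (n - k)"
    unfolding \<pi>_def E_def by (intro arg_cong2[where f = "(/)"] sum.cong refl) (simp add: occ_take length_words)
  finally have "E (\<lambda>u w. of_bool (match n u w \<and> occ (n - k) w u = j)) = \<beta> * \<pi> j (n - k)" .
  with 1 2 show ?thesis by linarith
qed

lemma \<pi>_0: "\<pi> j 0 = of_bool (j = 0)"
  using b by (simp add: \<pi>_def E_def power_add)

text \<open>A match at \<open>n\<close> moves the count from \<open>j\<close> to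
  \<open>j + 1\<close>. Both the outflow from \<open>j\<close> and the inflow from
  \<open>j - 1\<close> are estimated by \<open>match_correlation\<close>, which is why its error
  enters twice.\<close>

lemma \<pi>_step:
  assumes n: "n \<le> N"
  shows "\<bar>\<pi> j (Suc n) - ((1 - \<beta>) * \<pi> j n + (if j = 0 then 0 else \<beta> * \<pi> (j - 1) n))\<bar> \<le> 4 * real k * \<beta>\<^sup>2"
proof -
  define Q where "Q j = E (\<lambda>u w. of_bool (match n u w \<and> occ n w u = j))" for j
  have "\<pi> j (Suc n) = \<pi> j n - Q j + (if j = 0 then 0 else Q (j - 1))"
  proof (cases "j = 0")
    case True
    have "\<pi> j (Suc n) = E (\<lambda>u w. of_bool (occ n w u = j) - of_bool (match n u w \<and> occ n w u = j))"
      unfolding \<pi>_def E_def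
      by (intro arg_cong2[where f = "(/)"] sum.cong refl) (auto simp: occ_Suc match_def length_words True)
    then show ?thesis by (simp add: E_diff \<pi>_def Q_def True)
  next
    case False
    have "\<pi> j (Suc n) = E (\<lambda>u w. of_bool (occ n w u = j) - of_bool (match n u w \<and> occ n w u = j)
        + of_bool (match n u w \<and> occ n w u = j - 1))"
      unfolding \<pi>_def E_def
      by (intro arg_cong2[where f = "(/)"] sum.cong refl)
        (use False in \<open>auto simp: occ_Suc match_def length_words\<close>)
    then show ?thesis using False by (simp add: E_diff E_add \<pi>_def Q_def)
  qed
  moreover have "\<bar>Q i - \<beta> * \<pi> i n\<bar> \<le> 2 * real k * \<beta>\<^sup>2" for i
    unfolding Q_def by (rule match_correlation[OF n])
  from this[of j] this[of "j - 1"]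
  have "\<bar>Q j - \<beta> * \<pi> j n\<bar> \<le> 2 * real k * \<beta>\<^sup>2" "\<bar>Q (j - 1) - \<beta> * \<pi> (j - 1) n\<bar> \<le> 2 * real k * \<beta>\<^sup>2" .
  moreover have "0 \<le> real k * \<beta>\<^sup>2" by simp
  ultimately show ?thesis
    by (auto simp: left_diff_distrib)
qed

text \<open>The binomial law with parameter \<open>\<beta>\<close>: the solution of the recursion in
  \<open>\<pi>_step\<close> when the error is omitted.\<close>

definition binom :: "nat \<Rightarrow> nat \<Rightarrow> real" where
  "binom j n = real (n choose j) * \<beta> ^ j * (1 - \<beta>) ^ (n - j)"

lemma binom_step: "binom j (Suc n) = (1 - \<beta>) * binom j n + (if j = 0 then 0 else \<beta> * binom (j - 1) n)"
proof (cases j)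
  case 0
  then show ?thesis by (simp add: binom_def)
next
  case (Suc i)
  have *: "real (n choose Suc i) * (1 - \<beta>) ^ (n - i) = real (n choose Suc i) * ((1 - \<beta>) * (1 - \<beta>) ^ (n - Suc i))"
  proof (cases "Suc i \<le> n")
    case True
    then have "n - i = Suc (n - Suc i)" by simp
    then show ?thesis by simp
  qed (simp add: binomial_eq_0)
  have "binom j (Suc n) =
      \<beta> ^ Suc i * (real (n choose i) * (1 - \<beta>) ^ (n - i) + real (n choose Suc i) * (1 - \<beta>) ^ (n - i))"
    by (simp add: binom_def Suc algebra_simps)
  then show ?thesis unfolding * by (simp add: binom_def Suc algebra_simps)
qed

text \<open>The weights \<open>1 - \<beta>\<close> and \<open>\<beta>\<close> of the recursion are
  nonnegative and sum to 1, so old errors are averaged, not amplified, and the total grows only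
  linearly. For \<open>n\<close> of order \<open>1 / \<beta>\<close> it is of order
  \<open>k * \<beta>\<close>.\<close>

lemma \<pi>_binom:
  assumes "n \<le> Suc N"
  shows "\<bar>\<pi> j n - binom j n\<bar> \<le> 4 * real k * \<beta>\<^sup>2 * real n"
  using assms
proof (induction n arbitrary: j)
  case 0
  then show ?case by (simp add: \<pi>_0 binom_def)
next
  case (Suc n)
  let ?e = "4 * real k * \<beta>\<^sup>2"
  have IH: "\<bar>\<pi> i n - binom i n\<bar> \<le> ?e * real n" for i using Suc by simp
  have step: "\<bar>\<pi> j (Suc n) - ((1 - \<beta>) * \<pi> j n + (if j = 0 then 0 else \<beta> * \<pi> (j - 1) n))\<bar> \<le> ?e"
    using Suc.prems by (intro \<pi>_step) simp
  have a: "\<bar>(1 - \<beta>) * (\<pi> j n - binom j n)\<bar> \<le> (1 - \<beta>) * (?e * real n)"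
    using IH[of j] \<beta>_le_1 by (simp add: abs_mult mult_left_mono)
  have c: "\<bar>\<beta> * (\<pi> (j - 1) n - binom (j - 1) n)\<bar> \<le> \<beta> * (?e * real n)"
    using IH[of "j - 1"] \<beta>_pos by (simp add: abs_mult mult_left_mono)
  have e0: "0 \<le> \<beta> * (?e * real n)" using \<beta>_pos by simp
  have "\<bar>\<pi> j (Suc n) - binom j (Suc n)\<bar> \<le> ?e + ((1 - \<beta>) * (?e * real n) + \<beta> * (?e * real n))"
    using step a c e0 unfolding binom_step by (cases "j = 0") (simp_all add: right_diff_distrib)
  then show ?case by (simp add: algebra_simps)
qed

end

lemma mean_occurrences_count:
  assumes "b \<ge> 2"
  shows "mean b (N + k) (\<lambda>u. real (card {w \<in> words b k. occurrences w u = j}) / real b ^ k) =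
    random_word_pair.\<pi> b k N j (Suc N)"
proof -
  interpret random_word_pair b k N by standard (rule assms)
  have "real (card {w \<in> words b k. occurrences w u = j}) = (\<Sum>w\<in>words b k. of_bool (occ (Suc N) w u = j))"
    if "u \<in> words b (N + k)" for u
  proof -
    have "occurrences w u = occ (Suc N) w u" if "w \<in> words b k" for w
      by (rule occurrences_eq_occ) (use that \<open>u \<in> words b (N + k)\<close> in \<open>auto simp: words_def\<close>)
    then have "{w \<in> words b k. occurrences w u = j} = {w \<in> words b k. occ (Suc N) w u = j}" by auto
    then show ?thesis by (simp add: of_bool_def sum.If_cases Int_def)
  qed
  then show ?thesis
    by (simp add: mean_def \<pi>_def E_def sum_divide_distrib[symmetric] mult.commute)
qed

section \<open>Existence of a normal Poisson generic sequence\<close>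

text \<open>A word whose count changes is read, in one of the two sequences, at a position where
  their windows differ. The factor 2 stands for the two sequences.\<close>

lemma card_hits_neq:
  assumes "A \<subseteq> {w. length w = k \<and> hits d w n \<noteq> hits e w n}"
  shows "card A \<le> 2 * card {i. i < n \<and> window d i k \<noteq> window e i k}"
proof -
  let ?D = "{i. i < n \<and> window d i k \<noteq> window e i k}"
  have "A \<subseteq> (\<lambda>i. window d i k) ` ?D \<union> (\<lambda>i. window e i k) ` ?D"
  proof
    fix w assume "w \<in> A"
    then have w: "length w = k" and "hits d w n \<noteq> hits e w n" using assms by auto
    then have "{i. i < n \<and> window d i k = w} \<noteq> {i. i < n \<and> window e i k = w}"
      unfolding hits_def by metis
    then show "w \<in> (\<lambda>i. window d i k) ` ?D \<union> (\<lambda>i. window e i k) ` ?D" by auto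
  qed
  then have "card A \<le> card ((\<lambda>i. window d i k) ` ?D \<union> (\<lambda>i. window e i k) ` ?D)"
    by (intro card_mono) auto
  also have "\<dots> \<le> card ((\<lambda>i. window d i k) ` ?D) + card ((\<lambda>i. window e i k) ` ?D)"
    by (rule card_Un_le)
  also have "\<dots> \<le> card ?D + card ?D"
    by (intro add_mono card_image_le) auto
  finally show ?thesis by simp
qed

lemma hits_diff_le:
  "\<bar>real (hits d w n) - real (hits e w n)\<bar> \<le> real (card {i. i < n \<and> window d i (length w) \<noteq> window e i (length w)})"
proof -
  let ?k = "length w"
  let ?D = "{i. i < n \<and> window d i ?k \<noteq> window e i ?k}"
  have "hits f w n \<le> hits g w n + card ?D" if "{f, g} = {d, e}" for f g
  proof -
    have "hits f w n \<le> card ({i. i < n \<and> window g i ?k = w} \<union> ?D)"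
      unfolding hits_def by (rule card_mono) (use that in \<open>auto simp: doubleton_eq_iff\<close>)
    also have "\<dots> \<le> hits g w n + card ?D"
      unfolding hits_def by (rule card_Un_le)
    finally show ?thesis .
  qed
  from this[of d e] this[of e d] show ?thesis by (auto simp: insert_commute)
qed

lemma card_count_diff_le:
  assumes "finite A" "card {w \<in> A. f w \<noteq> g w} \<le> c"
  shows "\<bar>real (card {w \<in> A. f w = j}) - real (card {w \<in> A. g w = j})\<bar> \<le> real c"
proof -
  have "card {w \<in> A. f w = j} \<le> card {w \<in> A. g w = j} + c" if "card {w \<in> A. f w \<noteq> g w} \<le> c" for f g
  proof -
    have "card {w \<in> A. f w = j} \<le> card ({w \<in> A. g w = j} \<union> {w \<in> A. f w \<noteq> g w})"
      by (rule card_mono) (use assms(1) in auto)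
    also have "\<dots> \<le> card {w \<in> A. g w = j} + card {w \<in> A. f w \<noteq> g w}"
      by (rule card_Un_le)
    finally show ?thesis using that by simp
  qed
  moreover have "card {w \<in> A. g w \<noteq> f w} \<le> c" using assms(2) by (simp add: eq_commute)
  ultimately have "card {w \<in> A. f w = j} \<le> card {w \<in> A. g w = j} + c"
      "card {w \<in> A. g w = j} \<le> card {w \<in> A. f w = j} + c"
    using assms(2) by blast+
  then show ?thesis by auto
qed

definition seq_of :: "nat list \<Rightarrow> nat \<Rightarrow> nat" where
  "seq_of u i = u ! (i - 1)"

lemma occurrences_seq_of: "occurrences w u = hits (seq_of u) w (Suc (length u) - length w)"
proof -
  have "prefix_upto (seq_of u) (real (length u)) = u"
    by (rule nth_equalityI) (auto simp: prefix_upto_def seq_of_def simp del: upt_Suc)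
  then show ?thesis
    using occurrences_prefix_upto[of w "seq_of u" "real (length u)"] by simp
qed

lemma card_changed_windows:
  assumes "t < length u"
  shows "card {i. i < Suc (length u) - k \<and> window (seq_of (u[t := a])) i k \<noteq> window (seq_of u) i k} \<le> k"
proof -
  have "window (seq_of (u[t := a])) i k = window (seq_of u) i k" if "t \<notin> {i..<i + k}" for i
    using that by (auto simp: window_eq_iff seq_of_def nth_list_update_neq)
  then have "{i. i < Suc (length u) - k \<and> window (seq_of (u[t := a])) i k \<noteq> window (seq_of u) i k} \<subseteq> {Suc t - k..<Suc t}"
    by force
  then have "card {i. i < Suc (length u) - k \<and> window (seq_of (u[t := a])) i k \<noteq> window (seq_of u) i k}
      \<le> card {Suc t - k..<Suc t}"
    by (intro card_mono) auto
  then show ?thesis by simp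
qed

text \<open>One letter lies in at most \<open>k\<close> windows, and each altered window affects at
  most two words, the old one and the new one.\<close>

lemma bounded_differences_count:
  "bounded_differences b m (2 * real k / real b ^ k)
     (\<lambda>u. real (card {w \<in> words b k. occurrences w u = j}) / real b ^ k)"
  unfolding bounded_differences_def
proof (intro ballI allI impI)
  fix u t a assume u: "u \<in> words b m" and t: "t < m" and "a < b"
  let ?v = "u[t := a]" and ?n = "Suc (length u) - k"
  have "{w \<in> words b k. occurrences w ?v \<noteq> occurrences w u} \<subseteq>
      {w. length w = k \<and> hits (seq_of ?v) w ?n \<noteq> hits (seq_of u) w ?n}"
    by (auto simp: occurrences_seq_of words_def)
  then have "card {w \<in> words b k. occurrences w ?v \<noteq> occurrences w u} \<le>
      2 * card {i. i < ?n \<and> window (seq_of ?v) i k \<noteq> window (seq_of u) i k}"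
    by (rule card_hits_neq)
  also have "\<dots> \<le> 2 * k"
    using card_changed_windows[of t u k a] t u by (simp add: length_words)
  finally have "\<bar>real (card {w \<in> words b k. occurrences w ?v = j}) - real (card {w \<in> words b k. occurrences w u = j})\<bar> \<le> real (2 * k)"
    by (intro card_count_diff_le) auto
  then have "\<bar>real (card {w \<in> words b k. occurrences w ?v = j}) - real (card {w \<in> words b k. occurrences w u = j})\<bar> / real b ^ k
      \<le> 2 * real k / real b ^ k"
    by (intro divide_right_mono) auto
  then show "\<bar>real (card {w \<in> words b k. occurrences w ?v = j}) / real b ^ k - real (card {w \<in> words b k. occurrences w u = j}) / real b ^ k\<bar>
      \<le> 2 * real k / real b ^ k"
    by (simp add: diff_divide_distrib[symmetric] abs_divide)
qed

lemma bounded_differences_occurrences: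
  "bounded_differences b m (real (length w) / r) (\<lambda>u. real (occurrences w u) / r)" if "r > 0" for r :: real
  unfolding bounded_differences_def
proof (intro ballI allI impI)
  fix u t a assume u: "u \<in> words b m" and t: "t < m" and "a < b"
  let ?v = "u[t := a]" and ?n = "Suc (length u) - length w"
  have "\<bar>real (hits (seq_of ?v) w ?n) - real (hits (seq_of u) w ?n)\<bar> \<le> real (length w)"
    by (rule order_trans[OF hits_diff_le]) (use card_changed_windows[of t u "length w" a] t u in \<open>simp add: length_words\<close>)
  then have "\<bar>real (occurrences w ?v) - real (occurrences w u)\<bar> / r \<le> real (length w) / r"
    using that by (intro divide_right_mono) (auto simp: occurrences_seq_of)
  then show "\<bar>real (occurrences w ?v) / r - real (occurrences w u) / r\<bar> \<le> real (length w) / r"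
    using that by (simp add: diff_divide_distrib[symmetric] abs_divide)
qed

lemma mean_occurrences:
  assumes b: "b \<ge> 2" and w: "w \<in> words b l" and m: "l \<le> m"
  shows "mean b m (\<lambda>u. real (occurrences w u) / r) = real (Suc m - l) / real b ^ l / r"
proof -
  define N where "N = m - l"
  have mN: "m = N + l" using m by (simp add: N_def)
  have lw: "length w = l" using w by (simp add: words_def)
  have "(\<Sum>u\<in>words b m. real (occurrences w u)) = (\<Sum>u\<in>words b m. \<Sum>i\<in>{..<Suc N}. of_bool (take l (drop i u) = w))"
  proof (rule sum.cong[OF refl])
    fix u assume "u \<in> words b m"
    then have "occurrences w u = card {i. i < Suc N \<and> take l (drop i u) = w}"
      unfolding occurrences_def lw by (intro arg_cong[where f = card]) (auto simp: length_words mN)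
    also have "real \<dots> = (\<Sum>i\<in>{..<Suc N}. of_bool (take l (drop i u) = w))"
      by (simp add: of_bool_def sum.If_cases Int_def lessThan_def del: lessThan_Suc sum.lessThan_Suc)
    finally show "real (occurrences w u) = (\<Sum>i\<in>{..<Suc N}. of_bool (take l (drop i u) = w))" .
  qed
  also have "\<dots> = (\<Sum>i\<in>{..<Suc N}. \<Sum>u\<in>words b m. of_bool (take l (drop i u) = w))"
    by (rule sum.swap)
  also have "\<dots> = (\<Sum>i\<in>{..<Suc N}. real b ^ N)"
  proof (rule sum.cong[OF refl])
    fix i assume "i \<in> {..<Suc N}"
    then have i: "i \<le> N" by auto
    have "(\<Sum>u\<in>words b m. (of_bool (take l (drop i u) = w) :: real)) =
        (\<Sum>x\<in>words b i. \<Sum>y\<in>words b l. \<Sum>z\<in>words b (N - i). if w = y then 1 else 0)"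
      unfolding mN sum_words_split3[OF i]
      by (intro sum.cong refl) (auto simp: length_words)
    also have "\<dots> = (\<Sum>x\<in>words b i. \<Sum>y\<in>words b l. if w = y then real b ^ (N - i) else 0)"
      by (intro sum.cong refl) auto
    also have "\<dots> = real b ^ i * real b ^ (N - i)" using w by simp
    also have "\<dots> = real b ^ N" using i by (simp add: power_add[symmetric])
    finally show "(\<Sum>u\<in>words b m. (of_bool (take l (drop i u) = w) :: real)) = real b ^ N" .
  qed
  finally have "(\<Sum>u\<in>words b m. real (occurrences w u)) = real (Suc N) * real b ^ N" by simp
  then show ?thesis
    using b by (simp add: mean_def sum_divide_distrib[symmetric] mN power_add)
qed

section \<open>The Poisson limit of the binomial law, and of the mean counts\<close>

lemma binomial_tendsto_poisson:
  fixes n :: "nat \<Rightarrow> nat" and p :: "nat \<Rightarrow> real"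
  assumes n: "filterlim n at_top sequentially" and p: "filterlim p (at_right 0) sequentially"
    and np: "(\<lambda>k. real (n k) * p k) \<longlonglongrightarrow> L"
  shows "(\<lambda>k. real (n k choose j) * p k ^ j * (1 - p k) ^ (n k - j)) \<longlonglongrightarrow> exp (- L) * L ^ j / fact j"
proof -
  have ch: "(\<lambda>m. real (m choose j) / real m ^ j) \<longlonglongrightarrow> 1 / fact j"
  proof (rule LIMSEQ_offset[of _ j])
    have "(\<lambda>m. real ((j + m) choose m) / real (m ^ j)) \<longlonglongrightarrow> 1 / fact j"
      using fact_binomial_limit[of j, where 'a = real] by simp
    moreover have "(\<lambda>m. real m / real (m + j)) \<longlonglongrightarrow> 1"
      by real_asymp
    ultimately have "(\<lambda>m. real ((j + m) choose m) / real (m ^ j) * (real m / real (m + j)) ^ j) \<longlonglongrightarrow> 1 / fact j * 1 ^ j"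
      by (intro tendsto_mult tendsto_power)
    then have "(\<lambda>m. real ((j + m) choose m) / real (m ^ j) * (real m / real (m + j)) ^ j) \<longlonglongrightarrow> 1 / fact j"
      by simp
    moreover have "\<forall>\<^sub>F m in sequentially. real ((j + m) choose m) / real (m ^ j) * (real m / real (m + j)) ^ j
        = real ((m + j) choose j) / real (m + j) ^ j"
      using eventually_gt_at_top[of 0]
    proof eventually_elim
      case (elim m)
      have "(j + m) choose m = (m + j) choose j" by (metis add.commute add_diff_cancel_left' binomial_symmetric le_add2)
      then show ?case using elim by (simp add: power_divide)
    qed
    ultimately show "(\<lambda>m. real ((m + j) choose j) / real (m + j) ^ j) \<longlonglongrightarrow> 1 / fact j"
      by (rule Lim_transform_eventually)
  qed
  have 1: "(\<lambda>k. real (n k choose j) / real (n k) ^ j) \<longlonglongrightarrow> 1 / fact j"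
    by (rule filterlim_compose[OF ch n])
  have p0: "p \<longlonglongrightarrow> 0" using p by (simp add: filterlim_at)
  \<comment> \<open>Writing the n-th power of \<open>1 - p\<close> as the exponential of
    \<open>(n * p) * (ln (1 - p) / p)\<close> leaves two factors with known limits \<open>L\<close>
    and -1.\<close>
  have "((\<lambda>x::real. ln (1 - x) / x) \<longlongrightarrow> -1) (at_right 0)" by real_asymp
  then have "(\<lambda>k. ln (1 - p k) / p k) \<longlonglongrightarrow> -1"
    using p by (rule filterlim_compose)
  then have "(\<lambda>k. exp ((real (n k) * p k) * (ln (1 - p k) / p k))) \<longlonglongrightarrow> exp (L * (-1))"
    by (intro tendsto_intros np)
  then have 2: "(\<lambda>k. exp ((real (n k) * p k) * (ln (1 - p k) / p k))) \<longlonglongrightarrow> exp (- L)" by simp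
  \<comment> \<open>The binomial probability as three factors: the first tends to
    \<open>1 / fact j\<close>, the second to \<open>L ^ j\<close>, the third to
    \<open>exp (- L)\<close>.\<close>
  have "(\<lambda>k. real (n k choose j) / real (n k) ^ j * (real (n k) * p k) ^ j *
      (exp ((real (n k) * p k) * (ln (1 - p k) / p k)) / (1 - p k) ^ j)) \<longlonglongrightarrow>
      1 / fact j * L ^ j * (exp (- L) / (1 - 0) ^ j)"
    by (intro tendsto_mult tendsto_divide tendsto_power tendsto_diff tendsto_const 1 2 np p0) simp
  moreover have "1 / fact j * L ^ j * (exp (- L) / (1 - 0) ^ j) = exp (- L) * L ^ j / fact j" by simp
  ultimately have lim: "(\<lambda>k. real (n k choose j) / real (n k) ^ j * (real (n k) * p k) ^ j *
      (exp ((real (n k) * p k) * (ln (1 - p k) / p k)) / (1 - p k) ^ j)) \<longlonglongrightarrow> exp (- L) * L ^ j / fact j"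
    by (simp only:)
  have evp: "\<forall>\<^sub>F k in sequentially. p k \<in> {0<..<1}"
  proof -
    have "\<forall>\<^sub>F x in at_right (0::real). x \<in> {0<..<1}" by (rule eventually_at_right_real) simp
    then show ?thesis using p by (rule eventually_compose_filterlim)
  qed
  have evn: "\<forall>\<^sub>F k in sequentially. n k \<ge> Suc j"
    using n by (simp add: filterlim_at_top)
  have "\<forall>\<^sub>F k in sequentially. real (n k choose j) / real (n k) ^ j * (real (n k) * p k) ^ j *
      (exp ((real (n k) * p k) * (ln (1 - p k) / p k)) / (1 - p k) ^ j) =
      real (n k choose j) * p k ^ j * (1 - p k) ^ (n k - j)"
    using evp evn
  proof eventually_elim
    case (elim k)
    have "exp ((real (n k) * p k) * (ln (1 - p k) / p k)) = (1 - p k) ^ n k"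
      using elim by (simp add: exp_of_nat_mult)
    also have "\<dots> = (1 - p k) ^ (n k - j) * (1 - p k) ^ j"
      using elim by (simp add: power_add[symmetric])
    finally have "exp ((real (n k) * p k) * (ln (1 - p k) / p k)) / (1 - p k) ^ j = (1 - p k) ^ (n k - j)"
      using elim by simp
    then show ?case
      using elim by (simp add: power_mult_distrib)
  qed
  then show ?thesis by (rule Lim_transform_eventually[OF lim])
qed

lemma mean_count_tendsto_poisson:
  assumes b: "b \<ge> 2" and L: "L > 0"
  shows "(\<lambda>k. mean b (nat \<lfloor>L * real b ^ k\<rfloor> + k) (\<lambda>u. real (card {w \<in> words b k. occurrences w u = j}) / real b ^ k))
    \<longlonglongrightarrow> exp (- L) * L ^ j / fact j"
proof -
  define N where "N k = nat \<lfloor>L * real b ^ k\<rfloor>" for k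
  define p where "p k = 1 / real b ^ k" for k
  have bk: "real b ^ k > 0" for k using b by simp
  have N: "real (N k) \<le> L * real b ^ k" "L * real b ^ k < real (N k) + 1" for k
    using L bk[of k] unfolding N_def by (simp_all add: of_nat_nat)
  have p0: "p \<longlonglongrightarrow> 0"
  proof -
    have "(\<lambda>k. (1 / real b) ^ k) \<longlonglongrightarrow> 0" by (rule LIMSEQ_power_zero) (use b in auto)
    then show ?thesis by (simp add: p_def[abs_def] power_one_over)
  qed
  have p: "filterlim p (at_right 0) sequentially"
    using p0 bk by (auto simp: filterlim_at p_def)
  have np: "(\<lambda>k. real (Suc (N k)) * p k) \<longlonglongrightarrow> L"
  proof (rule tendsto_sandwich[of "\<lambda>_. L" _ _ "\<lambda>k. L + p k"])
    show "(\<lambda>k. L + p k) \<longlonglongrightarrow> L" using tendsto_add[OF tendsto_const p0] by fastforce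
    show "\<forall>\<^sub>F k in sequentially. L \<le> real (Suc (N k)) * p k"
      using N(2) bk by (intro always_eventually allI) (simp add: p_def pos_le_divide_eq less_imp_le add.commute)
    show "\<forall>\<^sub>F k in sequentially. real (Suc (N k)) * p k \<le> L + p k"
      using N(1) bk by (intro always_eventually allI) (simp add: p_def add_divide_distrib pos_divide_le_eq)
  qed simp
  have n: "filterlim (\<lambda>k. Suc (N k)) at_top sequentially"
  proof -
    have "filterlim (\<lambda>k. L * 2 ^ k) at_top sequentially" using L by real_asymp
    then have "filterlim (\<lambda>k. real (Suc (N k))) at_top sequentially"
    proof (rule filterlim_at_top_mono, intro always_eventually allI)
      fix k
      have "L * 2 ^ k \<le> L * real b ^ k" using L b by (intro mult_left_mono power_mono) auto
      then show "L * 2 ^ k \<le> real (Suc (N k))" using N(2)[of k] by simp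
    qed
    then show ?thesis
      unfolding filterlim_at_top by (metis (mono_tags, lifting) eventually_mono of_nat_le_iff)
  qed
  have binom: "(\<lambda>k. real (Suc (N k) choose j) * p k ^ j * (1 - p k) ^ (Suc (N k) - j)) \<longlonglongrightarrow> exp (- L) * L ^ j / fact j"
    by (rule binomial_tendsto_poisson[OF n p np])
  define \<mu> where "\<mu> k = mean b (N k + k) (\<lambda>u. real (card {w \<in> words b k. occurrences w u = j}) / real b ^ k)" for k
  \<comment> \<open>The error of \<open>\<pi>_binom\<close>, with one factor \<open>p k\<close>
    given to \<open>k\<close> and the other to the number of windows: the former product tends to 0,
    the latter to \<open>L\<close>.\<close>
  have err: "(\<lambda>k. 4 * (real k * p k) * (real (Suc (N k)) * p k)) \<longlonglongrightarrow> 4 * 0 * L"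
  proof (intro tendsto_mult tendsto_const np)
    have "(\<lambda>k. real k * (1 / real b) ^ k) \<longlonglongrightarrow> 0"
      by (rule powser_times_n_limit_0) (use b in auto)
    then show "(\<lambda>k. real k * p k) \<longlonglongrightarrow> 0" by (simp add: p_def power_one_over)
  qed
  have "(\<lambda>k. \<mu> k - real (Suc (N k) choose j) * p k ^ j * (1 - p k) ^ (Suc (N k) - j)) \<longlonglongrightarrow> 0"
  proof (rule Lim_null_comparison)
    show "\<forall>\<^sub>F k in sequentially. norm (\<mu> k - real (Suc (N k) choose j) * p k ^ j * (1 - p k) ^ (Suc (N k) - j))
        \<le> 4 * (real k * p k) * (real (Suc (N k)) * p k)"
    proof (intro always_eventually allI)
      fix k
      interpret random_word_pair b k "N k" by standard (rule b)
      have "\<mu> k = \<pi> j (Suc (N k))"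
        unfolding \<mu>_def by (rule mean_occurrences_count[OF b])
      moreover have "p k = \<beta>" by (simp add: p_def \<beta>_def)
      ultimately show "norm (\<mu> k - real (Suc (N k) choose j) * p k ^ j * (1 - p k) ^ (Suc (N k) - j))
        \<le> 4 * (real k * p k) * (real (Suc (N k)) * p k)"
        using \<pi>_binom[of "Suc (N k)" j] by (simp add: binom_def power2_eq_square mult_ac)
    qed
    show "(\<lambda>k. 4 * (real k * p k) * (real (Suc (N k)) * p k)) \<longlonglongrightarrow> 0" using err by simp
  qed
  from tendsto_add[OF this binom] show ?thesis
    unfolding \<mu>_def N_def by simp
qed

section \<open>Almost sure convergence for random digits\<close>

definition digit_measure :: "nat \<Rightarrow> (nat \<Rightarrow> nat) measure" where
  "digit_measure b = PiM UNIV (\<lambda>_. uniform_count_measure {..<b})"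

lemma prob_space_uniform_digits: "b \<ge> 2 \<Longrightarrow> prob_space (uniform_count_measure {..<b})" for b :: nat
  by (rule prob_space_uniform_count_measure) (auto simp: lessThan_empty_iff)

lemma prob_space_digit_measure: "b \<ge> 2 \<Longrightarrow> prob_space (digit_measure b)"
  unfolding digit_measure_def by (rule prob_space_PiM) (rule prob_space_uniform_digits)

lemma space_digit_measure: "space (digit_measure b) = {\<omega>. \<forall>i. \<omega> i < b}"
  by (auto simp: digit_measure_def space_PiM space_uniform_count_measure PiE_def Pi_def)

lemma measure_digit_prefix:
  assumes b: "b \<ge> 2" and S: "S \<subseteq> words b m"
  shows "{\<omega> \<in> space (digit_measure b). map \<omega> [1..<Suc m] \<in> S} \<in> sets (digit_measure b)" (is ?th1)
    and "measure (digit_measure b) {\<omega> \<in> space (digit_measure b). map \<omega> [1..<Suc m] \<in> S} \<le> real (card S) / real b ^ m" (is ?th2)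
proof -
  let ?M = "digit_measure b"
  interpret prob_space ?M by (rule prob_space_digit_measure[OF b])
  interpret U: prob_space "uniform_count_measure {..<b}" by (rule prob_space_uniform_digits[OF b])
  interpret P: product_prob_space "\<lambda>_. uniform_count_measure {..<b}" UNIV by unfold_locales
  define C where "C u = {\<omega> \<in> space ?M. \<forall>i\<in>{1..m}. \<omega> i \<in> {u ! (i - 1)}}" for u
  have C: "C u \<in> sets ?M" "measure ?M (C u) = 1 / real b ^ m" if u: "u \<in> words b m" for u
  proof -
    have ub: "u ! (i - 1) < b" if "i \<in> {1..m}" for i
    proof -
      have "u ! (i - 1) \<in> set u" using that u by (intro nth_mem) (auto simp: words_def)
      then show ?thesis using u by (auto simp: words_def)
    qed
    show "C u \<in> sets ?M"
    proof -
      have "C u = prod_emb UNIV (\<lambda>_. uniform_count_measure {..<b}) {1..m} (Pi\<^sub>E {1..m} (\<lambda>i. {u ! (i - 1)}))"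
        unfolding C_def digit_measure_def prod_emb_def by (auto simp: space_PiM Pi_iff)
      also have "\<dots> \<in> sets ?M"
        unfolding digit_measure_def
        by (rule sets_PiM_I) (use ub in \<open>auto simp: sets_uniform_count_measure\<close>)
      finally show ?thesis .
    qed
    have "emeasure ?M (C u) = (\<Prod>i\<in>{1..m}. emeasure (uniform_count_measure {..<b}) {u ! (i - 1)})"
      unfolding C_def digit_measure_def
      by (rule P.emeasure_PiM_Collect) (use ub in \<open>auto simp: sets_uniform_count_measure\<close>)
    also have "\<dots> = (\<Prod>i\<in>{1..m}. ennreal (1 / real b))"
      by (intro prod.cong refl) (use ub in \<open>simp add: emeasure_uniform_count_measure\<close>)
    also have "\<dots> = ennreal ((1 / real b) ^ m)"
      by (simp add: ennreal_power)
    finally show "measure ?M (C u) = 1 / real b ^ m"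
      by (simp add: measure_def power_one_over)
  qed
  have eq: "{\<omega> \<in> space ?M. map \<omega> [1..<Suc m] \<in> S} = (\<Union>u\<in>S. C u)"
  proof -
    have h: "map \<omega> [1..<Suc m] = u \<longleftrightarrow> (\<forall>i\<in>{1..m}. \<omega> i \<in> {u ! (i - 1)})" if "u \<in> S" for \<omega> u
    proof -
      have len: "length u = m" using that S by (auto simp: words_def)
      have "map \<omega> [1..<Suc m] = u \<longleftrightarrow> (\<forall>t<m. \<omega> (Suc t) = u ! t)"
        using len by (auto simp: list_eq_iff_nth_eq simp del: upt_Suc)
      also have "\<dots> \<longleftrightarrow> (\<forall>i\<in>{1..m}. \<omega> i \<in> {u ! (i - 1)})"
      proof safe
        fix i assume *: "\<forall>t<m. \<omega> (Suc t) = u ! t" and "i \<in> {1..m}"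
        then show "\<omega> i = u ! (i - 1)" using *[rule_format, of "i - 1"] by auto
      next
        fix t assume *: "\<forall>i\<in>{1..m}. \<omega> i \<in> {u ! (i - 1)}" and "t < m"
        then show "\<omega> (Suc t) = u ! t" using *[rule_format, of "Suc t"] by auto
      qed
      finally show ?thesis .
    qed
    have "{\<omega> \<in> space ?M. map \<omega> [1..<Suc m] \<in> S} = (\<Union>u\<in>S. {\<omega> \<in> space ?M. map \<omega> [1..<Suc m] = u})"
      by blast
    also have "\<dots> = (\<Union>u\<in>S. C u)"
      unfolding C_def by (rule SUP_cong[OF refl], rule Collect_cong) (simp only: h)
    finally show ?thesis .
  qed
  have finS: "finite S" using S finite_words finite_subset by blast
  show ?th1 unfolding eq using finS C(1) S by (intro sets.finite_UN) auto
  have "measure ?M (\<Union>u\<in>S. C u) \<le> (\<Sum>u\<in>S. measure ?M (C u))"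
    using finS C(1) S by (intro measure_UNION_le) auto
  also have "\<dots> = (\<Sum>u\<in>S. 1 / real b ^ m)"
    using C(2) S by (intro sum.cong) auto
  finally show ?th2 unfolding eq by simp
qed

text \<open>Chebyshev bounds the probability of a deviation of \<open>1 / Suc e\<close> by a
  multiple of the summable terms \<open>m * c ^ 2\<close>. Borel--Cantelli is applied to each
  \<open>e\<close>, and countably many null sets are discarded.\<close>

lemma AE_tendsto_bounded_differences:
  assumes b: "b \<ge> 2"
    and bd: "\<And>n. bounded_differences b (m n) (c n) (F n)" and c: "\<And>n. c n \<ge> 0"
    and sm: "summable (\<lambda>n. real (m n) * (c n)\<^sup>2)"
    and mean: "(\<lambda>n. mean b (m n) (F n)) \<longlonglongrightarrow> l"
  shows "AE \<omega> in digit_measure b. (\<lambda>n. F n (map \<omega> [1..<Suc (m n)])) \<longlonglongrightarrow> l"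
proof -
  let ?M = "digit_measure b"
  interpret prob_space ?M by (rule prob_space_digit_measure[OF b])
  define S where "S e n = {u \<in> words b (m n). 1 / real (Suc e) \<le> \<bar>F n u - mean b (m n) (F n)\<bar>}" for e n
  define A where "A e n = {\<omega> \<in> space ?M. map \<omega> [1..<Suc (m n)] \<in> S e n}" for e n
  have S: "S e n \<subseteq> words b (m n)" for e n by (auto simp: S_def)
  have "AE \<omega> in ?M. \<forall>\<^sub>F n in sequentially. \<omega> \<in> space ?M - A e n" for e
  proof (rule borel_cantelli_AE1)
    fix n
    show "A e n \<in> sets ?M" unfolding A_def by (rule measure_digit_prefix(1)[OF b S])
    show "emeasure ?M (A e n) < \<infinity>" by (simp add: emeasure_eq_measure)
  next
    show "summable (\<lambda>n. measure ?M (A e n))"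
    proof (rule summable_comparison_test)
      show "summable (\<lambda>n. real (m n) * (c n)\<^sup>2 * (real (Suc e))\<^sup>2)"
        by (rule summable_mult2[OF sm])
      show "\<exists>N. \<forall>n\<ge>N. norm (measure ?M (A e n)) \<le> real (m n) * (c n)\<^sup>2 * (real (Suc e))\<^sup>2"
      proof (intro exI allI impI)
        fix n
        have "measure ?M (A e n) \<le> real (card (S e n)) / real b ^ m n"
          unfolding A_def by (rule measure_digit_prefix(2)[OF b S])
        also have "\<dots> \<le> real (m n) * (c n)\<^sup>2 / (1 / real (Suc e))\<^sup>2"
          unfolding S_def by (rule chebyshev_bounded_differences) (use b c bd in auto)
        finally show "norm (measure ?M (A e n)) \<le> real (m n) * (c n)\<^sup>2 * (real (Suc e))\<^sup>2"
          by (simp add: power_one_over)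
      qed
    qed
  qed
  then have "AE \<omega> in ?M. \<forall>e. \<forall>\<^sub>F n in sequentially. \<omega> \<in> space ?M - A e n"
    by (simp add: AE_all_countable)
  then show ?thesis
  proof (rule AE_mp, intro AE_I2 impI)
    fix \<omega> assume \<omega>: "\<omega> \<in> space ?M" and *: "\<forall>e. \<forall>\<^sub>F n in sequentially. \<omega> \<in> space ?M - A e n"
    let ?u = "\<lambda>n. map \<omega> [1..<Suc (m n)]"
    have word: "?u n \<in> words b (m n)" for n
      using \<omega> by (auto simp: words_def space_digit_measure simp del: upt_Suc)
    have "(\<lambda>n. F n (?u n) - mean b (m n) (F n)) \<longlonglongrightarrow> 0"
      unfolding LIMSEQ_iff_Suc
    proof
      fix e
      obtain N where N: "\<And>n. n \<ge> N \<Longrightarrow> \<omega> \<in> space ?M - A e n"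
        using * unfolding eventually_sequentially by blast
      have "\<bar>F n (?u n) - mean b (m n) (F n) - 0\<bar> < 1 / real (Suc e)" if "n \<ge> N" for n
      proof -
        have "?u n \<notin> S e n" using N[OF that] \<omega> unfolding A_def by blast
        then show ?thesis using word[of n] unfolding S_def by (simp add: not_le del: upt_Suc)
      qed
      then show "\<exists>N. \<forall>n\<ge>N. \<bar>F n (?u n) - mean b (m n) (F n) - 0\<bar> < 1 / real (Suc e)" by blast
    qed
    from tendsto_add[OF this mean] show "(\<lambda>n. F n (?u n)) \<longlonglongrightarrow> l" by simp
  qed
qed

lemma AE_poisson:
  assumes b: "b \<ge> 2" and L: "L > 0"
  shows "AE \<omega> in digit_measure b. (\<lambda>k. Z_freq b \<omega> L j k) \<longlonglongrightarrow> exp (- L) * L ^ j / fact j"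
proof -
  let ?m = "\<lambda>k. nat \<lfloor>L * real b ^ k\<rfloor> + k"
  let ?F = "\<lambda>k u. real (card {w \<in> words b k. occurrences w u = j}) / real b ^ k"
  have "AE \<omega> in digit_measure b. (\<lambda>k. ?F k (map \<omega> [1..<Suc (?m k)])) \<longlonglongrightarrow> exp (- L) * L ^ j / fact j"
  proof (rule AE_tendsto_bounded_differences[OF b])
    show "bounded_differences b (?m k) (2 * real k / real b ^ k) (?F k)" for k
      by (rule bounded_differences_count)
    show "(\<lambda>k. mean b (?m k) (?F k)) \<longlonglongrightarrow> exp (- L) * L ^ j / fact j"
      by (rule mean_count_tendsto_poisson[OF b L])
    \<comment> \<open>About \<open>L * b ^ k\<close> digits, each of influence at most
      \<open>2 * k / b ^ k\<close>: squaring the influence beats the number of digits.\<close>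
    show "summable (\<lambda>k. real (?m k) * (2 * real k / real b ^ k)\<^sup>2)"
    proof (rule summable_comparison_test)
      \<comment> \<open>Any ratio strictly between 1/2 and 1 would do; it absorbs the polynomial
        factor.\<close>
      have "summable (\<lambda>k. norm ((3 / 4 :: real) ^ k))" by simp
      moreover have "(\<lambda>k. (L + real k) * (4 * real k ^ 2) * (1 / 2) ^ k) \<in> O(\<lambda>k. (3 / 4 :: real) ^ k)"
        by real_asymp
      ultimately show "summable (\<lambda>k. (L + real k) * (4 * real k ^ 2) * (1 / 2) ^ k)"
        by (rule summable_comparison_test_bigo)
      show "\<exists>K. \<forall>k\<ge>K. norm (real (?m k) * (2 * real k / real b ^ k)\<^sup>2) \<le> (L + real k) * (4 * real k ^ 2) * (1 / 2) ^ k"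
      proof (intro exI allI impI)
        fix k
        have bk: "real b ^ k \<ge> 1" using b by simp
        have "real (?m k) \<le> L * real b ^ k + real k"
          using L bk by (simp add: of_nat_nat)
        also have "\<dots> \<le> L * real b ^ k + real k * real b ^ k"
          using bk by (intro add_left_mono) (simp add: mult_le_cancel_left1)
        finally have "real (?m k) \<le> (L + real k) * real b ^ k" by (simp add: distrib_right)
        then have "real (?m k) * (2 * real k / real b ^ k)\<^sup>2 \<le> (L + real k) * real b ^ k * (2 * real k / real b ^ k)\<^sup>2"
          by (intro mult_right_mono) auto
        also have "\<dots> = (L + real k) * (4 * real k ^ 2) * (1 / real b) ^ k"
          using b by (simp add: power2_eq_square power_one_over)
        also have "\<dots> \<le> (L + real k) * (4 * real k ^ 2) * (1 / 2) ^ k"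
          using b L by (intro mult_left_mono power_mono) (auto simp: field_simps)
        finally show "norm (real (?m k) * (2 * real k / real b ^ k)\<^sup>2) \<le> (L + real k) * (4 * real k ^ 2) * (1 / 2) ^ k"
          by simp
      qed
    qed
  qed simp
  moreover have "?F k (map \<omega> [1..<Suc (?m k)]) = Z_freq b \<omega> L j k" for \<omega> k
  proof -
    have "nat \<lfloor>L * real b ^ k + real k\<rfloor> = ?m k"
    proof -
      have "\<lfloor>L * real b ^ k + real k\<rfloor> = \<lfloor>L * real b ^ k\<rfloor> + int k" by linarith
      moreover have "\<lfloor>L * real b ^ k\<rfloor> \<ge> 0" using L by simp
      ultimately show ?thesis by (simp add: nat_add_distrib)
    qed
    then show ?thesis by (simp add: Z_freq_def prefix_upto_def words_def conj_assoc del: upt_Suc)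
  qed
  ultimately show ?thesis by simp
qed

text \<open>For a frequency in a prefix of length \<open>n\<close> the variance bound is of order
  \<open>1 / n\<close>, which is not summable; along the squares it is. Monotone counts fill the
  gaps, because consecutive squares have ratio tending to 1.\<close>

lemma tendsto_ratio_from_squares:
  fixes f :: "nat \<Rightarrow> real"
  assumes "mono f" and f0: "\<And>n. f n \<ge> 0" and lim: "(\<lambda>n. f (n\<^sup>2) / real (n\<^sup>2)) \<longlonglongrightarrow> c"
  shows "(\<lambda>n. f n / real n) \<longlonglongrightarrow> c"
proof -
  have sq: "filterlim floor_sqrt at_top sequentially"
    unfolding filterlim_at_top eventually_sequentially
    by (metis le_floor_sqrt_iff)
  have "(\<lambda>m. f (m\<^sup>2) / real (m\<^sup>2) * (real m / real (Suc m))\<^sup>2) \<longlonglongrightarrow> c * 1\<^sup>2"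
    by (intro tendsto_mult tendsto_power lim) real_asymp
  then have lo: "(\<lambda>n. f ((floor_sqrt n)\<^sup>2) / real ((floor_sqrt n)\<^sup>2) * (real (floor_sqrt n) / real (Suc (floor_sqrt n)))\<^sup>2) \<longlonglongrightarrow> c"
    by (auto intro: filterlim_compose[OF _ sq])
  have "(\<lambda>m. f ((Suc m)\<^sup>2) / real ((Suc m)\<^sup>2) * (real (Suc m) / real m)\<^sup>2) \<longlonglongrightarrow> c * 1\<^sup>2"
    by (intro tendsto_mult tendsto_power LIMSEQ_Suc[OF lim]) real_asymp
  then have hi: "(\<lambda>n. f ((Suc (floor_sqrt n))\<^sup>2) / real ((Suc (floor_sqrt n))\<^sup>2) * (real (Suc (floor_sqrt n)) / real (floor_sqrt n))\<^sup>2) \<longlonglongrightarrow> c"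
    by (auto intro: filterlim_compose[OF _ sq])
  show ?thesis
  proof (rule tendsto_sandwich[OF _ _ lo hi])
    show "\<forall>\<^sub>F n in sequentially. f ((floor_sqrt n)\<^sup>2) / real ((floor_sqrt n)\<^sup>2) * (real (floor_sqrt n) / real (Suc (floor_sqrt n)))\<^sup>2 \<le> f n / real n"
      using eventually_gt_at_top[of 0]
    proof eventually_elim
      case (elim n)
      let ?m = "floor_sqrt n"
      have m: "?m > 0" using elim by simp
      have "f (?m\<^sup>2) / real (?m\<^sup>2) * (real ?m / real (Suc ?m))\<^sup>2 = f (?m\<^sup>2) / real ((Suc ?m)\<^sup>2)"
        using m by (simp add: power_divide)
      also have "\<dots> \<le> f n / real n"
      proof (rule frac_le)
        show "f (?m\<^sup>2) \<le> f n" by (rule monoD[OF assms(1)]) simp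
        show "real n \<le> real ((Suc ?m)\<^sup>2)" using Suc_floor_sqrt_power2_gt[of n] by linarith
      qed (use elim f0 in auto)
      finally show ?case .
    qed
    show "\<forall>\<^sub>F n in sequentially. f n / real n \<le> f ((Suc (floor_sqrt n))\<^sup>2) / real ((Suc (floor_sqrt n))\<^sup>2) * (real (Suc (floor_sqrt n)) / real (floor_sqrt n))\<^sup>2"
      using eventually_gt_at_top[of 0]
    proof eventually_elim
      case (elim n)
      let ?m = "floor_sqrt n"
      have m: "?m > 0" using elim by simp
      have "f n / real n \<le> f ((Suc ?m)\<^sup>2) / real (?m\<^sup>2)"
      proof (rule frac_le)
        show "f n \<le> f ((Suc ?m)\<^sup>2)" by (rule monoD[OF assms(1)]) (use Suc_floor_sqrt_power2_gt[of n] in linarith)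
        show "real (?m\<^sup>2) \<le> real n" by (simp only: of_nat_le_iff floor_sqrt_power2_le)
      qed (use m f0 in auto)
      also have "\<dots> = f ((Suc ?m)\<^sup>2) / real ((Suc ?m)\<^sup>2) * (real (Suc ?m) / real ?m)\<^sup>2"
        using m by (simp add: power_divide del: of_nat_Suc)
      finally show ?case .
    qed
  qed
qed

lemma AE_normal_word:
  assumes b: "b \<ge> 2" and w: "set w \<subseteq> {..<b}"
  shows "AE \<omega> in digit_measure b. (\<lambda>n. real (occurrences w (prefix_upto \<omega> (real n))) / real n) \<longlonglongrightarrow> 1 / real b ^ length w"
proof -
  define l where "l = length w"
  have wl: "w \<in> words b l" using w by (simp add: words_def l_def)
  let ?F = "\<lambda>n u. real (occurrences w u) / real ((Suc n)\<^sup>2)"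
  have "AE \<omega> in digit_measure b. (\<lambda>n. ?F n (map \<omega> [1..<Suc ((Suc n)\<^sup>2)])) \<longlonglongrightarrow> 1 / real b ^ l"
  proof (rule AE_tendsto_bounded_differences[OF b])
    show "bounded_differences b ((Suc n)\<^sup>2) (real l / real ((Suc n)\<^sup>2)) (?F n)" for n
      unfolding l_def by (rule bounded_differences_occurrences) (simp only: of_nat_0_less_iff zero_less_power zero_less_Suc)
    show "0 \<le> real l / real ((Suc n)\<^sup>2)" for n by simp
    have "summable (\<lambda>n. (real l)\<^sup>2 * (1 / real (Suc n) ^ 2))"
      by (intro summable_mult) (use inverse_power_summable[of 2, where 'a = real] summable_Suc_iff[of "\<lambda>n. 1 / real n ^ 2"] in \<open>simp add: inverse_eq_divide\<close>)
    moreover have "real ((Suc n)\<^sup>2) * (real l / real ((Suc n)\<^sup>2))\<^sup>2 = (real l)\<^sup>2 * (1 / real (Suc n) ^ 2)" for n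
    proof -
      define x where "x = real ((Suc n)\<^sup>2)"
      have "x \<noteq> 0" by (simp add: x_def del: of_nat_Suc)
      then have "x * (real l / x)\<^sup>2 = (real l)\<^sup>2 * (1 / x)" by (simp add: power2_eq_square)
      then show ?thesis by (simp only: x_def of_nat_power)
    qed
    ultimately show "summable (\<lambda>n. real ((Suc n)\<^sup>2) * (real l / real ((Suc n)\<^sup>2))\<^sup>2)" by (simp only:)
    have "(\<lambda>n. (real ((Suc n)\<^sup>2) + 1 - real l) / real b ^ l / real ((Suc n)\<^sup>2)) \<longlonglongrightarrow> 1 / real b ^ l"
    proof -
      have "(\<lambda>n. (real ((Suc n)\<^sup>2) + 1 - real l) / real ((Suc n)\<^sup>2)) \<longlonglongrightarrow> 1" by real_asymp
      from tendsto_divide[OF this tendsto_const[of "real b ^ l"]] show ?thesis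
        using b by (simp add: mult.commute)
    qed
    moreover have "\<forall>\<^sub>F n in sequentially. (real ((Suc n)\<^sup>2) + 1 - real l) / real b ^ l / real ((Suc n)\<^sup>2) = mean b ((Suc n)\<^sup>2) (?F n)"
      using eventually_ge_at_top[of l]
    proof eventually_elim
      case (elim n)
      have "l \<le> (Suc n)\<^sup>2" using elim by (simp add: power2_eq_square)
      then show ?case
        unfolding mean_occurrences[OF b wl \<open>l \<le> (Suc n)\<^sup>2\<close>] by (simp add: of_nat_diff)
    qed
    ultimately show "(\<lambda>n. mean b ((Suc n)\<^sup>2) (?F n)) \<longlonglongrightarrow> 1 / real b ^ l"
      by (rule Lim_transform_eventually)
  qed
  then show ?thesis
  proof (rule AE_mp, intro AE_I2 impI)
    fix \<omega> assume *: "(\<lambda>n. ?F n (map \<omega> [1..<Suc ((Suc n)\<^sup>2)])) \<longlonglongrightarrow> 1 / real b ^ l"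
    define f where "f n = real (occurrences w (prefix_upto \<omega> (real n)))" for n
    have "map \<omega> [1..<Suc ((Suc n)\<^sup>2)] = prefix_upto \<omega> (real ((Suc n)\<^sup>2))" for n
      unfolding prefix_upto_def by (simp only: floor_of_nat nat_int)
    then have "(\<lambda>n. f ((Suc n)\<^sup>2) / real ((Suc n)\<^sup>2)) \<longlonglongrightarrow> 1 / real b ^ l"
      using * by (simp only: f_def)
    then have "(\<lambda>n. f (n\<^sup>2) / real (n\<^sup>2)) \<longlonglongrightarrow> 1 / real b ^ l"
      by (rule LIMSEQ_imp_Suc)
    then have "(\<lambda>n. f n / real n) \<longlonglongrightarrow> 1 / real b ^ l"
      by (rule tendsto_ratio_from_squares[rotated 2])
        (auto simp: f_def mono_def occurrences_prefix_upto intro!: hits_mono)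
    then show "(\<lambda>n. real (occurrences w (prefix_upto \<omega> (real n))) / real n) \<longlonglongrightarrow> 1 / real b ^ length w"
      by (simp add: f_def l_def)
  qed
qed

text \<open>Each property is a countable conjunction of almost sure events: over words for
  normality, over rational parameters and counts for Poisson genericity by
  \<open>poisson_seq_rat\<close>.\<close>

lemma exists_normal_poisson_sequence:
  assumes b: "b \<ge> 2"
  obtains a where "\<And>i. a i < b" "normal_seq b a" "poisson_seq b a"
proof -
  interpret prob_space "digit_measure b" by (rule prob_space_digit_measure[OF b])
  have "AE \<omega> in digit_measure b. normal_seq b \<omega>"
    unfolding normal_seq_def AE_all_countable
    by (intro allI AE_impI AE_normal_word[OF b])
  moreover have "AE \<omega> in digit_measure b. poisson_seq b \<omega>"
    unfolding poisson_seq_rat AE_all_countable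
    by (intro allI AE_impI AE_poisson[OF b]) simp
  ultimately have ae: "AE \<omega> in digit_measure b. normal_seq b \<omega> \<and> poisson_seq b \<omega> \<and> (\<forall>i. \<omega> i < b)"
    using AE_space[of "digit_measure b"] by eventually_elim (auto simp: space_digit_measure)
  have "\<exists>\<omega>. normal_seq b \<omega> \<and> poisson_seq b \<omega> \<and> (\<forall>i. \<omega> i < b)"
  proof (rule ccontr)
    assume none: "\<nexists>\<omega>. normal_seq b \<omega> \<and> poisson_seq b \<omega> \<and> (\<forall>i. \<omega> i < b)"
    have "AE \<omega> in digit_measure b. False"
      by (rule eventually_mono[OF ae]) (use none in blast)
    then show False by simp
  qed
  then show ?thesis using that by blast
qed

section \<open>Block modifications of a sequence\<close>

lemma hits_add_le: "hits d w (m + k) \<le> hits d w m + k"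
proof -
  have "hits d w (m + k) \<le> card ({i. i < m \<and> window d i (length w) = w} \<union> {m..<m + k})"
    unfolding hits_def by (rule card_mono) auto
  also have "\<dots> \<le> hits d w m + card {m..<m + k}"
    unfolding hits_def by (rule card_Un_le)
  finally show ?thesis by simp
qed

lemma hits_sum: "real (hits d w n) = (\<Sum>i<n. of_bool (window d i (length w) = w))"
  by (simp add: hits_def of_bool_def sum.If_cases Int_def)

lemma normal_seq_hits:
  "normal_seq b d \<longleftrightarrow> (\<forall>w. set w \<subseteq> {..<b} \<longrightarrow>
     (\<lambda>n. real (hits d w n) / real n) \<longlonglongrightarrow> 1 / real b ^ length w)"
proof -
  have "(\<lambda>n. real (occurrences w (prefix_upto d (real n))) / real n) \<longlonglongrightarrow> c \<longleftrightarrow>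
      (\<lambda>n. real (hits d w n) / real n) \<longlonglongrightarrow> c" for w c
  proof (rule Lim_transform_eq, rule Lim_null_comparison)
    show "\<forall>\<^sub>F n in sequentially. norm (real (occurrences w (prefix_upto d (real n))) / real n - real (hits d w n) / real n)
        \<le> real (Suc (length w)) / real n"
    proof (intro always_eventually allI)
      fix n
      let ?m = "Suc n - length w"
      have "hits d w ?m \<le> hits d w (n + 1)" by (rule hits_mono) simp
      also have "\<dots> \<le> hits d w n + 1" by (rule hits_add_le)
      finally have 1: "hits d w ?m \<le> hits d w n + Suc (length w)" by simp
      have "hits d w n \<le> hits d w (?m + length w)" by (rule hits_mono) simp
      also have "\<dots> \<le> hits d w ?m + length w" by (rule hits_add_le)
      finally have "\<bar>real (hits d w ?m) - real (hits d w n)\<bar> \<le> real (Suc (length w))" using 1 by linarith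
      then have "\<bar>real (hits d w ?m) - real (hits d w n)\<bar> / real n \<le> real (Suc (length w)) / real n"
        by (rule divide_right_mono) simp
      then show "norm (real (occurrences w (prefix_upto d (real n))) / real n - real (hits d w n) / real n)
        \<le> real (Suc (length w)) / real n"
        by (simp add: occurrences_prefix_upto diff_divide_distrib[symmetric] abs_divide)
    qed
    show "(\<lambda>n. real (Suc (length w)) / real n) \<longlonglongrightarrow> 0" by real_asymp
  qed
  then show ?thesis by (simp add: normal_seq_def)
qed

text \<open>Meant for lengths that need not grow, such as the part of a copied block seen by a
  prefix: the constant \<open>K\<close> takes care of the short ones.\<close>

lemma tendsto_ratio_linear_bound:
  fixes f :: "nat \<Rightarrow> real"
  assumes "(\<lambda>n. f n / real n) \<longlonglongrightarrow> c" "\<epsilon> > 0"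
  obtains K where "K \<ge> 0" "\<And>n. \<bar>f n - c * real n\<bar> \<le> \<epsilon> * real n + K"
proof -
  obtain n0 where n0: "\<And>n. n \<ge> n0 \<Longrightarrow> \<bar>f n / real n - c\<bar> < \<epsilon>"
    using assms unfolding lim_sequentially dist_real_def by blast
  define K where "K = (\<Sum>n\<le>n0. \<bar>f n - c * real n\<bar>)"
  show ?thesis
  proof
    show "K \<ge> 0" by (simp add: K_def sum_nonneg)
    fix n
    show "\<bar>f n - c * real n\<bar> \<le> \<epsilon> * real n + K"
    proof (cases "n \<le> n0")
      case True
      then have "\<bar>f n - c * real n\<bar> \<le> K"
        unfolding K_def by (intro member_le_sum) auto
      then show ?thesis using assms(2) by (simp add: add_increasing)
    next
      case False
      then have n: "real n > 0" by simp
      have "\<bar>f n / real n - c\<bar> * real n \<le> \<epsilon> * real n"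
        using n0[of n] False by (intro mult_right_mono) auto
      moreover have "\<bar>f n / real n - c\<bar> * real n = \<bar>(f n / real n - c) * real n\<bar>"
        by (simp only: abs_mult abs_of_nat)
      moreover have "(f n / real n - c) * real n = f n - c * real n"
        using n by (simp add: left_diff_distrib)
      ultimately show ?thesis using \<open>K \<ge> 0\<close> by simp
    qed
  qed
qed

locale block_modification =
  fixes b :: nat and a r :: "nat \<Rightarrow> nat"
  assumes b: "b \<ge> 2" and a: "\<And>i. a i < b"
begin

definition N :: "nat \<Rightarrow> nat" where "N i = b ^ (i * i)"

text \<open>At most \<open>N i\<close>, so the block ends by \<open>2 * N i\<close>, hence before
  block \<open>i + 1\<close> begins, and an odd block copies only what already occurs among the
  first \<open>N i\<close> digits of \<open>a\<close>.\<close>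

definition len :: "nat \<Rightarrow> nat" where "len i = N i div Suc (r i)"

definition blk :: "nat \<Rightarrow> nat" where "blk s = (LEAST i. s < N (Suc i))"

text \<open>Digit \<open>Suc s\<close> sits at position \<open>s\<close>. Even blocks are overwritten by zeros, which spoils
  normality when it happens on a fixed proportion of the prefix; odd blocks are overwritten by an
  initial segment of \<open>a\<close>, which keeps all frequencies but produces no new words.\<close>

definition d :: "nat \<Rightarrow> nat" where
  "d j = (let s = j - 1; i = blk s in
     if N i \<le> s \<and> s < N i + len i then (if even i then 0 else a (Suc (s - N i))) else a j)"

text \<open>All blocks before block \<open>i\<close> end by this position; from here up to
  \<open>N (Suc i)\<close> only block \<open>i\<close> deviates from \<open>a\<close>.\<close>

definition old :: "nat \<Rightarrow> nat" where "old i = (if i = 0 then 0 else 2 * N (i - 1))"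

lemma N_pos: "N i > 0" using b by (simp add: N_def)

lemma N_Suc: "N (Suc i) = N i * b ^ (2 * i + 1)"
  unfolding N_def power_add[symmetric] by (rule arg_cong[where f = "\<lambda>n. b ^ n"]) simp

lemma N_double: "2 * N i \<le> N (Suc i)"
proof -
  have "2 \<le> b ^ (2 * i + 1)" using b self_le_power[of b "2 * i + 1"] by linarith
  then show ?thesis unfolding N_Suc by (simp add: mult.commute)
qed

lemma N_mono: "i \<le> j \<Longrightarrow> N i \<le> N j"
  unfolding N_def using b by (intro power_increasing mult_mono) auto

lemma le_N: "i \<le> N i"
proof (induction i)
  case (Suc i)
  then show ?case using N_double[of i] N_pos[of i] by linarith
qed simp

lemma len_le: "len i \<le> N i"
  by (simp add: len_def)

lemma blk_upper: "s < N (Suc (blk s))"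
  unfolding blk_def by (rule LeastI[of _ s]) (use le_N[of "Suc s"] in simp)

lemma blk_lower: "s > 0 \<Longrightarrow> N (blk s) \<le> s"
proof (cases "blk s")
  case 0
  assume "s > 0"
  then show ?thesis using 0 by (simp add: N_def)
next
  case (Suc i)
  then have "\<not> s < N (Suc i)" unfolding blk_def by (intro not_less_Least) simp
  then show ?thesis using Suc by simp
qed

lemma blk_eq: "N i \<le> s \<Longrightarrow> s < N (Suc i) \<Longrightarrow> blk s = i"
proof -
  assume s: "N i \<le> s" "s < N (Suc i)"
  then have "blk s \<le> i" unfolding blk_def by (intro Least_le)
  moreover have "\<not> blk s < i"
    using blk_upper[of s] N_mono[of "Suc (blk s)" i] s by linarith
  ultimately show ?thesis by simp
qed

lemma blk_at_top: "filterlim blk at_top sequentially"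
  unfolding filterlim_at_top eventually_sequentially
proof (intro allI exI impI)
  fix Z n assume "N Z \<le> n"
  then show "Z \<le> blk n"
    using blk_upper[of n] N_mono[of "Suc (blk n)" Z] by linarith
qed

lemma d_block:
  assumes "N i \<le> s" "s < N i + len i"
  shows "d (Suc s) = (if even i then 0 else a (Suc (s - N i)))"
proof -
  have "s < N (Suc i)" using assms len_le[of i] N_double[of i] by linarith
  then have "blk s = i" using assms by (intro blk_eq)
  then show ?thesis using assms by (simp add: d_def Let_def)
qed

lemma d_unmodified:
  assumes "old i \<le> s" "s < N (Suc i)" "\<not> (N i \<le> s \<and> s < N i + len i)"
  shows "d (Suc s) = a (Suc s)"
proof (cases "N i \<le> s")
  case True
  then have "blk s = i" using assms by (intro blk_eq)
  moreover have "\<not> s < N i + len i" using assms(3) True by blast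
  ultimately show ?thesis by (simp add: d_def Let_def)
next
  case False
  show ?thesis
  proof (cases i)
    case 0
    \<comment> \<open>\<open>N 0 = 1\<close>, so position 0 is the only one in front of the first
      block.\<close>
    then have "s = 0" using False by (simp add: N_def)
    then show ?thesis using N_pos[of "blk 0"] by (simp add: d_def Let_def)
  next
    case (Suc l)
    then have s: "2 * N l \<le> s" "s < N (Suc l)" using assms(1) False by (auto simp: old_def)
    then have "blk s = l" by (intro blk_eq) auto
    moreover have "\<not> s < N l + len l" using s len_le[of l] by linarith
    ultimately show ?thesis by (simp add: d_def Let_def)
  qed
qed

lemma d_less: "d j < b"
  using a b by (simp add: d_def Let_def)

text \<open>\<open>N i\<close> is \<open>N (i - 1)\<close> times \<open>b ^ (2 * i - 1)\<close>. It
  is the quadratic exponent in \<open>N\<close> that makes this ratio grow; a linear one would leave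
  it constant and the earlier blocks not negligible.\<close>

lemma old_le: "real (old i) \<le> 4 * (1 / 4) ^ i * real (N i)"
proof (cases i)
  case (Suc l)
  have "(2::real) ^ (2 * l + 1) \<le> real b ^ (2 * l + 1)" using b by (intro power_mono) auto
  then have "real (N l) * 2 ^ (2 * l + 1) \<le> real (N (Suc l))"
    unfolding N_Suc by (simp add: mult_left_mono)
  then have "(1 / 4) ^ l * (real (N l) * 2 ^ (2 * l + 1)) \<le> (1 / 4) ^ l * real (N (Suc l))"
    by (intro mult_left_mono) auto
  moreover have "(1 / 4 :: real) ^ l * 2 ^ (2 * l) = 1"
    by (simp add: power_mult power_one_over)
  then have "(1 / 4) ^ l * (real (N l) * 2 ^ (2 * l + 1)) = 2 * real (N l)"
    by (simp add: mult.left_commute)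
  ultimately have "2 * real (N l) \<le> (1 / 4) ^ l * real (N (Suc l))" by linarith
  then show ?thesis by (simp add: Suc old_def)
qed (simp add: old_def)

lemma len_le_real: "real (len i) \<le> 1 / real (Suc (r i)) * real (N i)"
  unfolding len_def using of_nat_div_le_of_nat[of "N i" "Suc (r i)", where 'a = real] by simp

lemma window_unmodified:
  assumes "old i \<le> s" "s + k \<le> N (Suc i)" "s + k \<le> N i \<or> N i + len i \<le> s"
  shows "window d s k = window a s k"
  unfolding window_eq_iff
proof (intro allI impI)
  fix t assume "t < k"
  then show "d (Suc (s + t)) = a (Suc (s + t))"
    by (intro d_unmodified[of i]) (use assms in auto)
qed

lemma window_copied:
  assumes "odd i" "N i \<le> s" "s + k \<le> N i + len i"
  shows "window d s k = window a (s - N i) k"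
  unfolding window_eq_iff
proof (intro allI impI)
  fix t assume "t < k"
  then have "d (Suc (s + t)) = a (Suc (s + t - N i))"
    using d_block[of i "s + t"] assms by simp
  also have "s + t - N i = s - N i + t" using assms by simp
  finally show "d (Suc (s + t)) = a (Suc (s - N i + t))" .
qed

lemma card_changed:
  assumes "n + k < N (Suc i)"
  shows "card {s. s < n \<and> window d s k \<noteq> window a s k} \<le> old i + len i + k"
proof -
  have "{s. s < n \<and> window d s k \<noteq> window a s k} \<subseteq> {..<old i} \<union> {N i - k..<N i + len i}"
  proof
    fix s assume "s \<in> {s. s < n \<and> window d s k \<noteq> window a s k}"
    then have s: "s < n" "window d s k \<noteq> window a s k" by auto
    then have "old i \<le> s \<Longrightarrow> \<not> (s + k \<le> N i \<or> N i + len i \<le> s)"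
      using window_unmodified[of i s k] assms by auto
    then show "s \<in> {..<old i} \<union> {N i - k..<N i + len i}" by auto
  qed
  then have "card {s. s < n \<and> window d s k \<noteq> window a s k} \<le> card ({..<old i} \<union> {N i - k..<N i + len i})"
    by (intro card_mono) auto
  also have "\<dots> \<le> card {..<old i} + card {N i - k..<N i + len i}" by (rule card_Un_le)
  also have "\<dots> \<le> old i + len i + k" by simp
  finally show ?thesis .
qed

text \<open>Bound for the altered proportion of a prefix that reaches stage \<open>i\<close>: the
  first term accounts for the earlier blocks, the second for block \<open>i\<close>.\<close>

definition \<delta> :: "nat \<Rightarrow> real" where
  "\<delta> i = 4 * (1 / 4) ^ i + 1 / real (Suc (r i))"

lemma card_changed_real:
  assumes "n + k > 0"
  shows "real (card {s. s < n \<and> window d s k \<noteq> window a s k}) \<le> \<delta> (blk (n + k)) * real (n + k) + real k"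
proof -
  let ?i = "blk (n + k)"
  have "real (card {s. s < n \<and> window d s k \<noteq> window a s k}) \<le> real (old ?i + len ?i + k)"
    using card_changed[OF blk_upper] by (simp only: of_nat_le_iff)
  also have "\<dots> \<le> \<delta> ?i * real (N ?i) + real k"
    using old_le[of ?i] len_le_real[of ?i] by (simp add: \<delta>_def distrib_right)
  also have "\<dots> \<le> \<delta> ?i * real (n + k) + real k"
    using blk_lower[OF assms] by (intro add_right_mono mult_left_mono) (auto simp: \<delta>_def simp del: of_nat_Suc of_nat_add)
  finally show ?thesis .
qed

text \<open>At most two words per altered window change their count. Among about
  \<open>L * b ^ k\<close> windows the altered ones are a vanishing proportion, so they are
  negligible against the \<open>b ^ k\<close> words.\<close>

lemma poisson_modified:
  assumes r: "filterlim r at_top sequentially" and pa: "poisson_seq b a"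
  shows "poisson_seq b d"
  unfolding poisson_seq_def
proof (intro allI impI)
  fix L :: real and j assume L: "L > 0"
  define n where "n k = Suc (nat \<lfloor>L * real b ^ k\<rfloor>)" for k
  have n_le: "real (n k) \<le> L * real b ^ k + 1" for k
    using L unfolding n_def by (simp add: of_nat_nat)
  have bk: "real b ^ k > 0" for k using b by simp
  have \<delta>: "\<delta> \<longlonglongrightarrow> 0"
  proof -
    have "(\<lambda>i. 1 / real (Suc (r i))) \<longlonglongrightarrow> 0"
      by (rule filterlim_compose[OF _ r]) real_asymp
    moreover have "(\<lambda>i. 4 * (1 / 4 :: real) ^ i) \<longlonglongrightarrow> 0" by real_asymp
    ultimately have "(\<lambda>i. 4 * (1 / 4) ^ i + 1 / real (Suc (r i))) \<longlonglongrightarrow> 0 + 0"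
      by (intro tendsto_add)
    then show ?thesis by (simp add: \<delta>_def[abs_def])
  qed
  have "filterlim (\<lambda>k. n k + k) at_top sequentially"
    by (rule filterlim_at_top_mono[OF filterlim_ident]) simp
  from filterlim_compose[OF blk_at_top this]
  have "(\<lambda>k. \<delta> (blk (n k + k))) \<longlonglongrightarrow> 0" by (rule filterlim_compose[OF \<delta>])
  moreover have kb: "(\<lambda>k. real k / real b ^ k) \<longlonglongrightarrow> 0"
    using powser_times_n_limit_0[of "1 / real b"] b by (simp add: power_one_over)
  moreover have ob: "(\<lambda>k. 1 / real b ^ k) \<longlonglongrightarrow> 0"
    using LIMSEQ_power_zero[of "1 / real b"] b by (simp add: power_one_over)
  ultimately have "(\<lambda>k. 2 * (\<delta> (blk (n k + k)) * (L + 1 / real b ^ k + real k / real b ^ k) + real k / real b ^ k))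
      \<longlonglongrightarrow> 2 * (0 * (L + 0 + 0) + 0)"
    by (intro tendsto_intros)
  then have err: "(\<lambda>k. 2 * (\<delta> (blk (n k + k)) * (L + 1 / real b ^ k + real k / real b ^ k) + real k / real b ^ k)) \<longlonglongrightarrow> 0"
    by simp
  have "(\<lambda>k. Z_freq b d L j k - Z_freq b a L j k) \<longlonglongrightarrow> 0"
  proof (rule Lim_null_comparison[OF always_eventually err], intro allI)
    fix k
    let ?D = "card {s. s < n k \<and> window d s k \<noteq> window a s k}"
    have "card {w \<in> words b k. hits d w (n k) \<noteq> hits a w (n k)} \<le> 2 * ?D"
      by (rule card_hits_neq) (auto simp: words_def)
    then have "\<bar>real (card {w \<in> words b k. hits d w (n k) = j}) - real (card {w \<in> words b k. hits a w (n k) = j})\<bar> \<le> real (2 * ?D)"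
      by (intro card_count_diff_le) auto
    also have "\<dots> \<le> 2 * (\<delta> (blk (n k + k)) * real (n k + k) + real k)"
      using card_changed_real[of "n k" k] by (simp add: n_def)
    also have "\<dots> \<le> 2 * (\<delta> (blk (n k + k)) * (L * real b ^ k + 1 + real k) + real k)"
      using n_le[of k] by (intro mult_left_mono add_right_mono) (auto simp: \<delta>_def)
    finally have "\<bar>real (card {w \<in> words b k. hits d w (n k) = j}) - real (card {w \<in> words b k. hits a w (n k) = j})\<bar> / real b ^ k
        \<le> 2 * (\<delta> (blk (n k + k)) * (L * real b ^ k + 1 + real k) + real k) / real b ^ k"
      using bk[of k] by (intro divide_right_mono) auto
    also have "\<dots> = 2 * (\<delta> (blk (n k + k)) * (L + 1 / real b ^ k + real k / real b ^ k) + real k / real b ^ k)"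
      using bk[of k] by (simp add: field_simps)
    finally show "norm (Z_freq b d L j k - Z_freq b a L j k) \<le>
        2 * (\<delta> (blk (n k + k)) * (L + 1 / real b ^ k + real k / real b ^ k) + real k / real b ^ k)"
      by (simp add: Z_freq_hits[OF L] n_def words_def conj_assoc diff_divide_distrib[symmetric] abs_divide)
  qed
  moreover have "(\<lambda>k. Z_freq b a L j k) \<longlonglongrightarrow> exp (- L) * L ^ j / fact j"
    using pa L by (simp add: poisson_seq_def)
  ultimately have "(\<lambda>k. (Z_freq b d L j k - Z_freq b a L j k) + Z_freq b a L j k) \<longlonglongrightarrow> 0 + exp (- L) * L ^ j / fact j"
    by (rule tendsto_add)
  then show "(\<lambda>k. Z_freq b d L j k) \<longlonglongrightarrow> exp (- L) * L ^ j / fact j" by simp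
qed

section \<open>Effect of the blocks on word frequencies\<close>

lemma hits_diff_even:
  assumes "n + length w < N (Suc i)"
  shows "\<bar>real (hits d w n) - real (hits a w n)\<bar> \<le> real (old i) + real (len i) + real (length w)"
proof -
  have "\<bar>real (hits d w n) - real (hits a w n)\<bar> \<le> real (card {s. s < n \<and> window d s (length w) \<noteq> window a s (length w)})"
    by (rule hits_diff_le)
  also have "\<dots> \<le> real (old i + len i + length w)"
    using card_changed[OF assms] by (simp only: of_nat_le_iff)
  finally show ?thesis by simp
qed

text \<open>\<open>t\<close> is the number of positions below \<open>n\<close> in block
  \<open>i\<close>. There \<open>d\<close> reads the first \<open>t\<close> positions of
  \<open>a\<close>, whereas \<open>a\<close> reads its own positions from \<open>N i\<close> to
  \<open>N i + t\<close>; the last absolute value compares the two. The rest is the earlier blocks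
  and the windows crossing either end of the copy.\<close>

lemma hits_diff_odd:
  assumes i: "odd i" and n: "n + length w < N (Suc i)"
  obtains t where "t \<le> n"
    "\<bar>real (hits d w n) - real (hits a w n)\<bar> \<le> real (old i) + 2 * real (length w)
       + \<bar>real (hits a w t) - real (hits a w (N i + t)) + real (hits a w (N i))\<bar>"
proof -
  define l where "l = length w"
  define t where "t = min (n - N i) (len i)"
  define x where "x e s = (of_bool (window e s l = w) :: real)" for e s
  have hits_x: "real (hits e w m) = (\<Sum>s<m. x e s)" for e m
    unfolding x_def l_def by (rule hits_sum)
  have x01: "\<bar>x e s - x e' s'\<bar> \<le> 1" for e e' s s' by (simp add: x_def)
  have xeq: "x e s = x e' s'" if "window e s l = window e' s' l" for e e' s s'
    using that by (simp add: x_def)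
  let ?I = "{N i..<N i + t}"
  have I: "?I \<subseteq> {..<n}" by (auto simp: t_def)
  have split: "(\<Sum>s<n. x e s) = (\<Sum>s\<in>{..<n} - ?I. x e s) + (\<Sum>s\<in>?I. x e s)" for e
    using sum.subset_diff[OF I] by simp
  have shift: "(\<Sum>s\<in>?I. x e s) = (\<Sum>s<t. x e (s + N i))" for e
    using sum.shift_bounds_nat_ivl[of "x e" 0 "N i" t] by (simp add: add.commute atLeast0LessThan)
  have 1: "\<bar>(\<Sum>s\<in>{..<n} - ?I. x d s) - (\<Sum>s\<in>{..<n} - ?I. x a s)\<bar> \<le> real (old i) + real l"
  proof -
    let ?B = "{s \<in> {..<n} - ?I. window d s l \<noteq> window a s l}"
    have "\<bar>(\<Sum>s\<in>{..<n} - ?I. x d s) - (\<Sum>s\<in>{..<n} - ?I. x a s)\<bar> \<le> (\<Sum>s\<in>{..<n} - ?I. \<bar>x d s - x a s\<bar>)"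
      unfolding sum_subtractf[symmetric] by (rule sum_abs)
    also have "\<dots> \<le> (\<Sum>s\<in>{..<n} - ?I. if window d s l \<noteq> window a s l then 1 else 0)"
    proof (rule sum_mono)
      fix s show "\<bar>x d s - x a s\<bar> \<le> (if window d s l \<noteq> window a s l then 1 else 0)"
        using xeq[of d s a s] x01[of d s a s] by auto
    qed
    also have "\<dots> = real (card ?B)"
      by (simp add: sum.If_cases Int_def)
    also have "\<dots> \<le> real (old i + l)"
    proof -
      have "?B \<subseteq> {..<old i} \<union> {N i - l..<N i}"
      proof
        fix s assume s: "s \<in> ?B"
        then have "s + l \<le> N (Suc i)" using n by (auto simp: l_def)
        then have "old i \<le> s \<Longrightarrow> \<not> (s + l \<le> N i \<or> N i + len i \<le> s)"
          using window_unmodified[of i s l] s by auto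
        moreover have "\<not> (N i \<le> s \<and> s < N i + len i)"
          using s by (auto simp: t_def)
        ultimately show "s \<in> {..<old i} \<union> {N i - l..<N i}" by auto
      qed
      then have "card ?B \<le> card ({..<old i} \<union> {N i - l..<N i})" by (intro card_mono) auto
      also have "\<dots> \<le> card {..<old i} + card {N i - l..<N i}" by (rule card_Un_le)
      finally have "card ?B \<le> old i + l" by simp
      then show ?thesis by (simp only: of_nat_le_iff)
    qed
    finally show ?thesis by simp
  qed
  have 2: "\<bar>(\<Sum>s\<in>?I. x d s) - (\<Sum>s<t. x a s)\<bar> \<le> real l"
  proof -
    let ?B = "{s \<in> {..<t}. window d (s + N i) l \<noteq> window a s l}"
    have "\<bar>(\<Sum>s\<in>?I. x d s) - (\<Sum>s<t. x a s)\<bar> \<le> (\<Sum>s<t. \<bar>x d (s + N i) - x a s\<bar>)"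
      unfolding shift sum_subtractf[symmetric] by (rule sum_abs)
    also have "\<dots> \<le> (\<Sum>s<t. if window d (s + N i) l \<noteq> window a s l then 1 else 0)"
    proof (rule sum_mono)
      fix s show "\<bar>x d (s + N i) - x a s\<bar> \<le> (if window d (s + N i) l \<noteq> window a s l then 1 else 0)"
        using xeq[of d "s + N i" a s] x01[of d "s + N i" a s] by auto
    qed
    also have "\<dots> = real (card ?B)"
      by (simp add: sum.If_cases Int_def)
    also have "\<dots> \<le> real l"
    proof -
      have "?B \<subseteq> {len i - l..<len i}"
      proof
        fix s assume s: "s \<in> ?B"
        then have "s < len i" by (auto simp: t_def)
        moreover have "\<not> s + l \<le> len i"
          using window_copied[OF i, of "s + N i" l] s by auto
        ultimately show "s \<in> {len i - l..<len i}" by auto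
      qed
      then have "card ?B \<le> card {len i - l..<len i}" by (intro card_mono) auto
      then show ?thesis by simp
    qed
    finally show ?thesis .
  qed
  have 3: "(\<Sum>s\<in>?I. x a s) = (\<Sum>s<N i + t. x a s) - (\<Sum>s<N i. x a s)"
    using sum.atLeastLessThan_concat[of 0 "N i" "N i + t" "x a"] by (simp add: atLeast0LessThan)
  show ?thesis
  proof
    show "t \<le> n" by (simp add: t_def)
    show "\<bar>real (hits d w n) - real (hits a w n)\<bar> \<le> real (old i) + 2 * real (length w)
       + \<bar>real (hits a w t) - real (hits a w (N i + t)) + real (hits a w (N i))\<bar>"
      unfolding hits_x l_def[symmetric] using 1 2 3 split[of d] split[of a] by linarith
  qed
qed

text \<open>Zero blocks are negligible since \<open>r\<close> grows along even indices. Copied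
  blocks may have any length: in the bound of \<open>hits_diff_odd\<close> the main terms
  \<open>c * t\<close>, \<open>c * (N i + t)\<close> and \<open>c * N i\<close> cancel, and only the
  deviations of \<open>a\<close> from its frequencies remain.\<close>

lemma normal_modified:
  assumes r: "filterlim (\<lambda>m. r (2 * m)) at_top sequentially" and na: "normal_seq b a"
  shows "normal_seq b d"
  unfolding normal_seq_hits
proof (intro allI impI)
  fix w assume w: "set w \<subseteq> {..<b}"
  define c where "c = 1 / real b ^ length w"
  define l where "l = length w"
  have lim_a: "(\<lambda>n. real (hits a w n) / real n) \<longlonglongrightarrow> c"
    using na w unfolding normal_seq_hits c_def by blast
  have "(\<lambda>n. real (hits d w n) / real n - real (hits a w n) / real n) \<longlonglongrightarrow> 0"
  proof (rule LIMSEQ_I)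
    fix e :: real assume e: "e > 0"
    \<comment> \<open>The errors below add up to \<open>7 * \<epsilon> * n\<close> plus a constant,
      so any divisor above 7 is enough.\<close>
    define \<epsilon> where "\<epsilon> = e / 16"
    have \<epsilon>: "\<epsilon> > 0" using e by (simp add: \<epsilon>_def)
    obtain K where K: "K \<ge> 0" "\<And>n. \<bar>real (hits a w n) - c * real n\<bar> \<le> \<epsilon> * real n + K"
      using tendsto_ratio_linear_bound[OF lim_a \<epsilon>] by blast
    have "\<forall>\<^sub>F i in sequentially. 4 * (1 / 4 :: real) ^ i < \<epsilon>"
    proof -
      have "(\<lambda>i. 4 * (1 / 4 :: real) ^ i) \<longlonglongrightarrow> 0" by real_asymp
      then show ?thesis using \<epsilon> by (rule order_tendstoD(2))
    qed
    moreover have "\<forall>\<^sub>F i in sequentially. even i \<longrightarrow> 1 / real (Suc (r i)) < \<epsilon>"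
    proof -
      obtain Z where Z: "1 / real (Suc Z) < \<epsilon>" using \<epsilon> by (metis nat_approx_posE)
      obtain M where M: "\<And>m. m \<ge> M \<Longrightarrow> Z \<le> r (2 * m)"
        using r unfolding filterlim_at_top eventually_sequentially by blast
      show ?thesis
      proof (rule eventually_sequentiallyI[of "2 * M"], intro impI)
        fix i assume "2 * M \<le> i" "even i"
        then have "Z \<le> r i" using M[of "i div 2"] by auto
        then have "1 / real (Suc (r i)) \<le> 1 / real (Suc Z)" by (intro divide_left_mono) auto
        then show "1 / real (Suc (r i)) < \<epsilon>" using Z by linarith
      qed
    qed
    ultimately have "\<forall>\<^sub>F i in sequentially. 4 * (1 / 4 :: real) ^ i < \<epsilon> \<and> (even i \<longrightarrow> 1 / real (Suc (r i)) < \<epsilon>)"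
      by eventually_elim simp
    moreover have "filterlim (\<lambda>n. blk (n + l)) at_top sequentially"
      by (rule filterlim_compose[OF blk_at_top]) (rule filterlim_add_const_nat_at_top)
    ultimately have ev: "\<forall>\<^sub>F n in sequentially. 4 * (1 / 4 :: real) ^ blk (n + l) < \<epsilon> \<and>
        (even (blk (n + l)) \<longrightarrow> 1 / real (Suc (r (blk (n + l)))) < \<epsilon>)"
      by (rule eventually_compose_filterlim)
    define C where "C = 7 * \<epsilon> * real l + 2 * real l + 3 * K"
    have main: "\<bar>real (hits d w n) - real (hits a w n)\<bar> \<le> 7 * \<epsilon> * real n + C"
      if n: "n > 0" and small: "4 * (1 / 4 :: real) ^ blk (n + l) < \<epsilon>"
        "even (blk (n + l)) \<Longrightarrow> 1 / real (Suc (r (blk (n + l)))) < \<epsilon>" for n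
    proof -
      let ?i = "blk (n + l)"
      have up: "n + length w < N (Suc ?i)" using blk_upper[of "n + l"] by (simp add: l_def)
      have lo: "real (N ?i) \<le> real n + real l" using blk_lower[of "n + l"] n by linarith
      have "4 * (1 / 4) ^ ?i * real (N ?i) \<le> \<epsilon> * real (N ?i)"
        using small(1) by (intro mult_right_mono) auto
      then have old: "real (old ?i) \<le> \<epsilon> * real (N ?i)" using old_le[of ?i] by linarith
      have N\<epsilon>: "\<epsilon> * real (N ?i) \<le> \<epsilon> * real n + \<epsilon> * real l"
        using mult_left_mono[OF lo, of \<epsilon>] \<epsilon> by (simp add: distrib_left)
      have pos: "0 \<le> \<epsilon> * real n" "0 \<le> \<epsilon> * real l" using \<epsilon> by auto
      show ?thesis
      proof (cases "even ?i")
        case True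
        have "1 / real (Suc (r ?i)) * real (N ?i) \<le> \<epsilon> * real (N ?i)"
          using small(2)[OF True] by (intro mult_right_mono) auto
        then have "real (len ?i) \<le> \<epsilon> * real (N ?i)" using len_le_real[of ?i] by linarith
        moreover have "\<bar>real (hits d w n) - real (hits a w n)\<bar> \<le> real (old ?i) + real (len ?i) + real l"
          using hits_diff_even[OF up] unfolding l_def .
        ultimately have "\<bar>real (hits d w n) - real (hits a w n)\<bar> \<le> (\<epsilon> * real (N ?i)) + (\<epsilon> * real (N ?i)) + real l"
          using old by linarith
        also have "\<dots> \<le> (\<epsilon> * real n + \<epsilon> * real l) + (\<epsilon> * real n + \<epsilon> * real l) + real l"
          by (intro add_mono N\<epsilon> order_refl)
        also have "\<dots> \<le> 7 * \<epsilon> * real n + C"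
          unfolding C_def using pos K(1) by simp
        finally show ?thesis .
      next
        case False
        obtain t where t: "t \<le> n"
          "\<bar>real (hits d w n) - real (hits a w n)\<bar> \<le> real (old ?i) + 2 * real (length w)
             + \<bar>real (hits a w t) - real (hits a w (N ?i + t)) + real (hits a w (N ?i))\<bar>"
          by (rule hits_diff_odd[OF False up])
        have ct: "c * real (N ?i + t) = c * real (N ?i) + c * real t" by (simp add: distrib_left)
        have "\<bar>real (hits a w t) - real (hits a w (N ?i + t)) + real (hits a w (N ?i))\<bar>
            \<le> (\<epsilon> * real t + K) + (\<epsilon> * real (N ?i + t) + K) + (\<epsilon> * real (N ?i) + K)"
          using K(2)[of t] K(2)[of "N ?i + t"] K(2)[of "N ?i"] ct by linarith
        also have "\<dots> = 2 * (\<epsilon> * real t) + 2 * (\<epsilon> * real (N ?i)) + 3 * K"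
          by (simp add: distrib_left)
        also have "\<dots> \<le> 2 * (\<epsilon> * real n) + 2 * (\<epsilon> * real n + \<epsilon> * real l) + 3 * K"
          using t(1) \<epsilon> by (intro add_mono mult_left_mono N\<epsilon> order_refl) auto
        finally have ha: "\<bar>real (hits a w t) - real (hits a w (N ?i + t)) + real (hits a w (N ?i))\<bar>
            \<le> 2 * (\<epsilon> * real n) + 2 * (\<epsilon> * real n + \<epsilon> * real l) + 3 * K" .
        have "\<bar>real (hits d w n) - real (hits a w n)\<bar> \<le> real (old ?i) + 2 * real l
             + \<bar>real (hits a w t) - real (hits a w (N ?i + t)) + real (hits a w (N ?i))\<bar>"
          using t(2) unfolding l_def .
        also have "\<dots> \<le> (\<epsilon> * real n + \<epsilon> * real l) + 2 * real l
            + (2 * (\<epsilon> * real n) + 2 * (\<epsilon> * real n + \<epsilon> * real l) + 3 * K)"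
          by (intro add_mono order_trans[OF old N\<epsilon>] ha order_refl)
        also have "\<dots> \<le> 7 * \<epsilon> * real n + C"
          unfolding C_def using pos by simp
        finally show ?thesis .
      qed
    qed
    have "(\<lambda>n. 7 * \<epsilon> + C / real n) \<longlonglongrightarrow> 7 * \<epsilon>"
    proof -
      have "(\<lambda>n. C / real n) \<longlonglongrightarrow> 0" by (rule lim_const_over_n)
      from tendsto_add[OF tendsto_const this] show ?thesis by simp
    qed
    then have "\<forall>\<^sub>F n in sequentially. 7 * \<epsilon> + C / real n < e"
      by (rule order_tendstoD(2)) (use e in \<open>simp add: \<epsilon>_def\<close>)
    then have "\<forall>\<^sub>F n in sequentially. \<bar>real (hits d w n) / real n - real (hits a w n) / real n\<bar> < e"
      using ev eventually_gt_at_top[of 0]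
    proof eventually_elim
      case (elim n)
      have "\<bar>real (hits d w n) - real (hits a w n)\<bar> / real n \<le> (7 * \<epsilon> * real n + C) / real n"
        using elim by (intro divide_right_mono main) auto
      also have "\<dots> = 7 * \<epsilon> + C / real n" using elim by (simp add: add_divide_distrib)
      finally show ?case using elim by (simp add: diff_divide_distrib[symmetric] abs_divide)
    qed
    then show "\<exists>n0. \<forall>n\<ge>n0. norm (real (hits d w n) / real n - real (hits a w n) / real n - 0) < e"
      by (simp add: eventually_sequentially)
  qed
  from tendsto_add[OF this lim_a] show "(\<lambda>n. real (hits d w n) / real n) \<longlonglongrightarrow> 1 / real b ^ length w"
    by (simp add: c_def)
qed

section \<open>Blocks of a fixed proportion\<close>

lemma N_at_top: "filterlim N at_top sequentially"
  by (rule filterlim_at_top_mono[OF filterlim_ident]) (simp add: le_N)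

lemma len_ratio:
  fixes \<phi> :: "nat \<Rightarrow> nat"
  assumes \<phi>: "strict_mono \<phi>" and r: "\<And>m. r (\<phi> m) = v"
  shows "(\<lambda>m. real (len (\<phi> m)) / real (N (\<phi> m))) \<longlonglongrightarrow> 1 / real (Suc v)"
proof (rule tendsto_sandwich)
  have N\<phi>: "filterlim (\<lambda>m. N (\<phi> m)) at_top sequentially"
    using N_at_top filterlim_subseq[OF \<phi>] by (rule filterlim_compose)
  have "(\<lambda>m. 1 / real (N (\<phi> m))) \<longlonglongrightarrow> 0"
    by (rule filterlim_compose[OF lim_1_over_n N\<phi>])
  from tendsto_diff[OF tendsto_const this, of "1 / real (Suc v)"]
  show "(\<lambda>m. 1 / real (Suc v) - 1 / real (N (\<phi> m))) \<longlonglongrightarrow> 1 / real (Suc v)" by simp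
  show "\<forall>\<^sub>F m in sequentially. 1 / real (Suc v) - 1 / real (N (\<phi> m)) \<le> real (len (\<phi> m)) / real (N (\<phi> m))"
  proof (intro always_eventually allI)
    fix m
    have "real (N (\<phi> m)) / real (Suc v) \<le> real (len (\<phi> m)) + 1"
      using floor_divide_of_nat_eq[of "N (\<phi> m)" "Suc v", where 'a = real] unfolding len_def r by linarith
    then have "real (N (\<phi> m)) / real (Suc v) / real (N (\<phi> m)) \<le> (real (len (\<phi> m)) + 1) / real (N (\<phi> m))"
      by (rule divide_right_mono) simp
    then show "1 / real (Suc v) - 1 / real (N (\<phi> m)) \<le> real (len (\<phi> m)) / real (N (\<phi> m))"
      using N_pos[of "\<phi> m"] by (simp add: add_divide_distrib del: of_nat_Suc)
  qed
  show "\<forall>\<^sub>F m in sequentially. real (len (\<phi> m)) / real (N (\<phi> m)) \<le> 1 / real (Suc v)"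
  proof (intro always_eventually allI)
    fix m
    show "real (len (\<phi> m)) / real (N (\<phi> m)) \<le> 1 / real (Suc v)"
      using len_le_real[of "\<phi> m"] N_pos[of "\<phi> m"] unfolding r by (simp add: pos_divide_le_eq del: of_nat_Suc)
  qed
qed simp

text \<open>Compare the zeros before a block with those after it. If both frequencies tended to
  \<open>1 / b\<close> while the block adds a proportion \<open>\<theta>\<close> of zeros, then
  \<open>(1 + \<theta>) / b = 1 / b + \<theta>\<close>, which forces \<open>b = 1\<close>.\<close>

lemma not_normal_modified:
  fixes \<phi> :: "nat \<Rightarrow> nat"
  assumes \<phi>: "strict_mono \<phi>" and r: "\<And>m. r (\<phi> m) = v" and ev: "\<And>m. even (\<phi> m)"
  shows "\<not> normal_seq b d"
proof
  assume "normal_seq b d"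
  then have lim: "(\<lambda>n. real (hits d [0] n) / real n) \<longlonglongrightarrow> 1 / real b"
    using b unfolding normal_seq_hits by (auto dest!: spec[of _ "[0]"])
  define \<theta> where "\<theta> = 1 / real (Suc v)"
  let ?N = "\<lambda>m. N (\<phi> m)" and ?l = "\<lambda>m. len (\<phi> m)"
  have Np: "real (?N m) > 0" for m using N_pos by simp
  have N\<phi>: "filterlim ?N at_top sequentially"
    using N_at_top filterlim_subseq[OF \<phi>] by (rule filterlim_compose)
  have x: "(\<lambda>m. real (hits d [0] (?N m)) / real (?N m)) \<longlonglongrightarrow> 1 / real b"
    by (rule filterlim_compose[OF lim N\<phi>])
  have "filterlim (\<lambda>m. ?N m + ?l m) at_top sequentially"
    by (rule filterlim_at_top_mono[OF N\<phi>]) simp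
  then have y: "(\<lambda>m. real (hits d [0] (?N m + ?l m)) / real (?N m + ?l m)) \<longlonglongrightarrow> 1 / real b"
    by (rule filterlim_compose[OF lim])
  have l: "(\<lambda>m. real (?l m) / real (?N m)) \<longlonglongrightarrow> \<theta>"
    unfolding \<theta>_def by (rule len_ratio[OF \<phi> r])
  have hits: "real (hits d [0] (?N m + ?l m)) = real (hits d [0] (?N m)) + real (?l m)" for m
  proof -
    have "(\<Sum>s\<in>{?N m..<?N m + ?l m}. (of_bool (window d s (length [0::nat]) = [0]) :: real)) = (\<Sum>s\<in>{?N m..<?N m + ?l m}. 1)"
    proof (rule sum.cong[OF refl])
      fix s assume "s \<in> {?N m..<?N m + ?l m}"
      then have "d (Suc s) = 0" using d_block[of "\<phi> m" s] ev[of m] by simp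
      then show "(of_bool (window d s (length [0::nat]) = [0]) :: real) = 1" by (simp add: window_def)
    qed
    then show ?thesis
      unfolding hits_sum
      using sum.atLeastLessThan_concat[of 0 "?N m" "?N m + ?l m" "\<lambda>s. (of_bool (window d s (length [0::nat]) = [0]) :: real)"]
      by (simp add: atLeast0LessThan)
  qed
  have "(\<lambda>m. (1 + real (?l m) / real (?N m)) * (real (hits d [0] (?N m + ?l m)) / real (?N m + ?l m))) \<longlonglongrightarrow> (1 + \<theta>) * (1 / real b)"
    by (intro tendsto_mult tendsto_add tendsto_const l y)
  moreover have "(1 + real (?l m) / real (?N m)) * (real (hits d [0] (?N m + ?l m)) / real (?N m + ?l m)) =
      real (hits d [0] (?N m)) / real (?N m) + real (?l m) / real (?N m)" for m
  proof -
    have T: "real (?N m + ?l m) \<noteq> 0" using Np[of m] by linarith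
    have "1 + real (?l m) / real (?N m) = real (?N m + ?l m) / real (?N m)"
      using Np[of m] by (simp add: add_divide_distrib)
    then have "(1 + real (?l m) / real (?N m)) * (real (hits d [0] (?N m + ?l m)) / real (?N m + ?l m)) =
        real (?N m + ?l m) / real (?N m) * (real (hits d [0] (?N m + ?l m)) / real (?N m + ?l m))"
      by (simp only:)
    also have "\<dots> = real (hits d [0] (?N m + ?l m)) / real (?N m)"
      using T by (simp del: of_nat_add)
    finally show ?thesis by (simp only: hits add_divide_distrib)
  qed
  ultimately have "(\<lambda>m. real (hits d [0] (?N m)) / real (?N m) + real (?l m) / real (?N m)) \<longlonglongrightarrow> (1 + \<theta>) * (1 / real b)"
    by (simp only:)
  moreover have "(\<lambda>m. real (hits d [0] (?N m)) / real (?N m) + real (?l m) / real (?N m)) \<longlonglongrightarrow> 1 / real b + \<theta>"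
    by (intro tendsto_add x l)
  ultimately have "(1 + \<theta>) * (1 / real b) = 1 / real b + \<theta>" by (rule LIMSEQ_unique)
  then have "\<theta> * (1 / real b) = \<theta> * 1" by (simp add: add_divide_distrib)
  moreover have "\<theta> \<noteq> 0" by (simp add: \<theta>_def)
  ultimately have "1 / real b = 1" using mult_left_cancel by blast
  then show False using b by simp
qed

text \<open>Up to the end of the block, every window of \<open>d\<close> at an ordinary position is
  a window of \<open>a\<close> starting at or before \<open>N i\<close>: it is unmodified or copied,
  and \<open>len i \<le> N i\<close>. So a word missing from \<open>a\<close> can be gained only at
  an exceptional position.\<close>

lemma missing_words_modified:
  assumes i: "odd i" and k: "k = i * i"
  shows "card {w \<in> words b k. hits a w (Suc (N i)) = 0} \<le>
    card {w \<in> words b k. hits d w (Suc (N i + len i)) = 0} + (old i + 2 * k + 1)"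
proof -
  let ?n = "Suc (N i + len i)"
  \<comment> \<open>The exceptional positions: the region of earlier blocks, the windows crossing
    the start of block \<open>i\<close>, and those crossing its end. The last range includes the
    final position, whence the extra 1 in the bound.\<close>
  let ?bad = "{..<old i} \<union> {N i - k..<N i} \<union> {N i + len i - k..<?n}"
  have "{w \<in> words b k. hits a w (Suc (N i)) = 0} \<subseteq>
      {w \<in> words b k. hits d w ?n = 0} \<union> (\<lambda>s. window d s k) ` ?bad"
  proof
    fix w assume "w \<in> {w \<in> words b k. hits a w (Suc (N i)) = 0}"
    then have w: "w \<in> words b k" "length w = k" and 0: "hits a w (Suc (N i)) = 0"
      by (auto simp: words_def)
    have none: "window a s k \<noteq> w" if "s \<le> N i" for s
    proof -
      have "{s. s < Suc (N i) \<and> window a s k = w} = {}" using 0 w by (simp add: hits_def)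
      then show ?thesis using that by auto
    qed
    show "w \<in> {w \<in> words b k. hits d w ?n = 0} \<union> (\<lambda>s. window d s k) ` ?bad"
    proof (cases "hits d w ?n = 0")
      case False
      then obtain s where s: "s < ?n" "window d s k = w"
        using w by (auto simp: hits_def)
      have "s \<in> ?bad"
      proof (rule ccontr)
        assume "s \<notin> ?bad"
        then have nb: "old i \<le> s" "s + k \<le> N i \<or> N i \<le> s" "s + k \<le> N i + len i"
          using s(1) by auto
        show False
        proof (cases "N i \<le> s")
          case True
          then have "window a (s - N i) k = w"
            using window_copied[OF i True nb(3)] s(2) by simp
          moreover have "s - N i \<le> N i" using nb(3) len_le[of i] by linarith
          ultimately show False using none by blast
        next
          case False
          then have "s + k \<le> N i" using nb(2) by simp
          then have "window a s k = w"
            using window_unmodified[of i s k] nb(1) N_double[of i] s(2) by simp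
          then show False using none[of s] False by simp
        qed
      qed
      then show ?thesis using s(2) by blast
    qed (use w in simp)
  qed
  then have "card {w \<in> words b k. hits a w (Suc (N i)) = 0} \<le>
      card ({w \<in> words b k. hits d w ?n = 0} \<union> (\<lambda>s. window d s k) ` ?bad)"
    by (intro card_mono) auto
  also have "\<dots> \<le> card {w \<in> words b k. hits d w ?n = 0} + card ((\<lambda>s. window d s k) ` ?bad)"
    by (rule card_Un_le)
  also have "card ((\<lambda>s. window d s k) ` ?bad) \<le> old i + 2 * k + 1"
  proof -
    have "card ((\<lambda>s. window d s k) ` ?bad) \<le> card ?bad"
      by (rule card_image_le) simp
    moreover have "card ?bad \<le> card ({..<old i} \<union> {N i - k..<N i}) + card {N i + len i - k..<?n}"
      by (rule card_Un_le)
    moreover have "card ({..<old i} \<union> {N i - k..<N i}) \<le> card {..<old i} + card {N i - k..<N i}"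
      by (rule card_Un_le)
    moreover have "card {..<old i} = old i" "card {N i - k..<N i} \<le> k" "card {N i + len i - k..<?n} \<le> k + 1"
      by auto
    ultimately show ?thesis by linarith
  qed
  finally show ?thesis by simp
qed

lemma not_poisson_modified:
  fixes \<phi> :: "nat \<Rightarrow> nat"
  assumes \<phi>: "strict_mono \<phi>" and r: "\<And>m. r (\<phi> m) = v" and od: "\<And>m. odd (\<phi> m)" and pa: "poisson_seq b a"
  shows "\<not> poisson_seq b d"
proof
  assume pd: "poisson_seq b d"
  \<comment> \<open>Chosen so that for words of length \<open>\<phi> m * \<phi> m\<close> the floor
    of \<open>L * b ^ k\<close> is exactly \<open>N i + len i\<close> at
    \<open>i = \<phi> m\<close>: the starting positions stop at the end of the copied block.\<close>
  define L where "L = 1 + 1 / real (Suc v)"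
  have L: "L > 1" by (simp add: L_def)
  let ?k = "\<lambda>m. \<phi> m * \<phi> m"
  have \<phi>_top: "filterlim \<phi> at_top sequentially" by (rule filterlim_subseq[OF \<phi>])
  have k: "filterlim ?k at_top sequentially"
    by (rule filterlim_at_top_mono[OF \<phi>_top]) (simp add: always_eventually)
  have "(\<lambda>k. Z_freq b d L 0 k) \<longlonglongrightarrow> exp (- L) * L ^ 0 / fact 0"
    using pd L unfolding poisson_seq_def by (meson less_trans zero_less_one)
  then have "(\<lambda>k. Z_freq b d L 0 k) \<longlonglongrightarrow> exp (- L)" by simp
  from filterlim_compose[OF this k] have zd: "(\<lambda>m. Z_freq b d L 0 (?k m)) \<longlonglongrightarrow> exp (- L)" .
  have "(\<lambda>k. Z_freq b a 1 0 k) \<longlonglongrightarrow> exp (- 1) * 1 ^ 0 / fact 0"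
    using pa unfolding poisson_seq_def by (meson zero_less_one)
  then have "(\<lambda>k. Z_freq b a 1 0 k) \<longlonglongrightarrow> exp (- 1)" by simp
  from filterlim_compose[OF this k] have za: "(\<lambda>m. Z_freq b a 1 0 (?k m)) \<longlonglongrightarrow> exp (- 1)" .
  have kb: "(\<lambda>k. real k / real b ^ k) \<longlonglongrightarrow> 0"
    using powser_times_n_limit_0[of "1 / real b"] b by (simp add: power_one_over)
  have ob: "(\<lambda>k. 1 / real b ^ k) \<longlonglongrightarrow> 0"
    using LIMSEQ_power_zero[of "1 / real b"] b by (simp add: power_one_over)
  have "(\<lambda>i. 4 * (1 / 4 :: real) ^ i) \<longlonglongrightarrow> 0" by real_asymp
  from filterlim_compose[OF this \<phi>_top] filterlim_compose[OF kb k] filterlim_compose[OF ob k]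
  have err: "(\<lambda>m. 4 * (1 / 4) ^ \<phi> m + 2 * (real (?k m) / real b ^ ?k m) + 1 / real b ^ ?k m) \<longlonglongrightarrow> 0 + 2 * 0 + 0"
    by (intro tendsto_add tendsto_mult tendsto_const)
  have "exp (- 1) \<le> exp (- L) + (0 + 2 * 0 + 0)"
  proof (rule tendsto_le[OF _ tendsto_add[OF zd err] za])
    show "\<forall>\<^sub>F m in sequentially. Z_freq b a 1 0 (?k m) \<le>
        Z_freq b d L 0 (?k m) + (4 * (1 / 4) ^ \<phi> m + 2 * (real (?k m) / real b ^ ?k m) + 1 / real b ^ ?k m)"
    proof (intro always_eventually allI)
      fix m
      let ?i = "\<phi> m"
      have NN: "real b ^ ?k m = real (N ?i)" by (simp add: N_def)
      have "nat \<lfloor>1 * real b ^ ?k m\<rfloor> = N ?i" unfolding NN by simp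
      then have Za: "Z_freq b a 1 0 (?k m) = real (card {w \<in> words b (?k m). hits a w (Suc (N ?i)) = 0}) / real (N ?i)"
        by (simp only: Z_freq_hits[OF zero_less_one] words_def mem_Collect_eq conj_assoc NN)
      have "\<lfloor>L * real (N ?i)\<rfloor> = int (N ?i + len ?i)"
      proof -
        have "L * real (N ?i) = real (N ?i) + real (N ?i) / real (Suc v)"
          by (simp add: L_def distrib_right)
        moreover have "\<lfloor>real (N ?i) / real (Suc v)\<rfloor> = int (len ?i)"
          unfolding len_def r by (rule floor_divide_of_nat_eq)
        ultimately show ?thesis by simp
      qed
      then have "nat \<lfloor>L * real b ^ ?k m\<rfloor> = N ?i + len ?i" unfolding NN by simp
      moreover have "L > 0" using L by simp
      ultimately have Zd: "Z_freq b d L 0 (?k m) = real (card {w \<in> words b (?k m). hits d w (Suc (N ?i + len ?i)) = 0}) / real (N ?i)"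
        by (simp only: Z_freq_hits[OF \<open>L > 0\<close>] words_def mem_Collect_eq conj_assoc NN)
      have "real (card {w \<in> words b (?k m). hits a w (Suc (N ?i)) = 0}) \<le>
          real (card {w \<in> words b (?k m). hits d w (Suc (N ?i + len ?i)) = 0} + (old ?i + 2 * ?k m + 1))"
        using missing_words_modified[OF od refl] by (simp only: of_nat_le_iff)
      also have "\<dots> \<le> real (card {w \<in> words b (?k m). hits d w (Suc (N ?i + len ?i)) = 0}) +
          (4 * (1 / 4) ^ ?i * real (N ?i) + 2 * real (?k m) + 1)"
        using old_le[of ?i] by simp
      finally have "Z_freq b a 1 0 (?k m) \<le> (real (card {w \<in> words b (?k m). hits d w (Suc (N ?i + len ?i)) = 0}) +
          (4 * (1 / 4) ^ ?i * real (N ?i) + 2 * real (?k m) + 1)) / real (N ?i)"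
        unfolding Za by (rule divide_right_mono) simp
      also have "\<dots> = Z_freq b d L 0 (?k m) + (4 * (1 / 4) ^ ?i + 2 * (real (?k m) / real b ^ ?k m) + 1 / real b ^ ?k m)"
        using N_pos[of ?i] unfolding Zd NN by (simp add: add_divide_distrib)
      finally show "Z_freq b a 1 0 (?k m) \<le>
        Z_freq b d L 0 (?k m) + (4 * (1 / 4) ^ ?i + 2 * (real (?k m) / real b ^ ?k m) + 1 / real b ^ ?k m)" .
    qed
  qed simp
  then show False using L by simp
qed

text \<open>Needed twice: digit 1 makes the expansion nonterminating, digit 0 keeps the number below
  1. Normality gives \<open>a\<close> about \<open>N i / b\<close> occurrences of \<open>c\<close>
  before \<open>N i\<close>, more than the \<open>old i\<close> positions that earlier blocks can
  touch, so one lies in the unmodified stretch in between.\<close>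

lemma infinite_digit_modified:
  assumes na: "normal_seq b a" and c: "c < b"
  shows "infinite {j. 1 \<le> j \<and> d j = c}"
  unfolding infinite_nat_iff_unbounded
proof
  fix m
  have lim: "(\<lambda>n. real (hits a [c] n) / real n) \<longlonglongrightarrow> 1 / real b"
    using na c unfolding normal_seq_hits by (auto dest!: spec[of _ "[c]"])
  have "(\<lambda>i. real (hits a [c] (N i)) / real (N i) - 4 * (1 / 4) ^ i) \<longlonglongrightarrow> 1 / real b - 0"
    by (intro tendsto_diff filterlim_compose[OF lim N_at_top]) real_asymp
  then have "\<forall>\<^sub>F i in sequentially. 0 < real (hits a [c] (N i)) / real (N i) - 4 * (1 / 4) ^ i"
    using b by (intro order_tendstoD(1)) auto
  then have "\<forall>\<^sub>F i in sequentially. 0 < real (hits a [c] (N i)) / real (N i) - 4 * (1 / 4) ^ i \<and> Suc (Suc m) \<le> i"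
    using eventually_ge_at_top by (rule eventually_conj)
  then obtain i where i: "0 < real (hits a [c] (N i)) / real (N i) - 4 * (1 / 4) ^ i" "Suc (Suc m) \<le> i"
    using eventually_happens'[OF sequentially_bot] by blast
  have "4 * (1 / 4) ^ i * real (N i) < real (hits a [c] (N i))"
    using i(1) N_pos[of i] by (simp add: pos_less_divide_eq)
  then have "real (old i) < real (hits a [c] (N i))" using old_le[of i] by linarith
  then have "old i < hits a [c] (N i)" by simp
  have "\<exists>s. old i \<le> s \<and> s < N i \<and> window a s 1 = [c]"
  proof (rule ccontr)
    assume none: "\<nexists>s. old i \<le> s \<and> s < N i \<and> window a s 1 = [c]"
    have "hits a [c] (N i) \<le> card {..<old i}"
      unfolding hits_def by (rule card_mono) (use none in \<open>auto simp: not_le[symmetric]\<close>)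
    then show False using \<open>old i < hits a [c] (N i)\<close> by simp
  qed
  then obtain s where s: "old i \<le> s" "s < N i" "window a s 1 = [c]" by blast
  have "a (Suc s) = c" using s(3) by (simp add: window_def)
  moreover have "d (Suc s) = a (Suc s)"
    using s N_double[of i] by (intro d_unmodified[of i]) auto
  moreover have "m < Suc s"
  proof -
    have "m \<le> N (i - 1)" using le_N[of "i - 1"] i(2) by linarith
    also have "\<dots> \<le> old i" using i(2) by (simp add: old_def)
    finally show ?thesis using s(1) by simp
  qed
  ultimately show "\<exists>n>m. n \<in> {j. 1 \<le> j \<and> d j = c}" by (intro exI[of _ "Suc s"]) simp
qed

end

section \<open>The reduction\<close>

text \<open>Pigeonhole on the infinitely many values below some bound. A constant value, not just a
  bounded one, is wanted so that the blocks have one fixed limiting proportion.\<close>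

lemma not_at_top_imp_constant_subsequence:
  fixes z :: "nat \<Rightarrow> nat"
  assumes "\<not> filterlim z at_top sequentially"
  shows "\<exists>v (\<phi> :: nat \<Rightarrow> nat). strict_mono \<phi> \<and> (\<forall>m. z (\<phi> m) = v)"
proof -
  obtain M where M: "\<not> (\<forall>\<^sub>F m in sequentially. M \<le> z m)"
    using assms unfolding filterlim_at_top by blast
  have "infinite {m. z m < M}"
    using M unfolding cofinite_eq_sequentially[symmetric] eventually_cofinite by (simp add: not_le)
  moreover have "{m. z m < M} = (\<Union>v<M. {m. z m = v})" by auto
  ultimately obtain v where v: "infinite {m. z m = v}" by auto
  show ?thesis
  proof (intro exI conjI allI)
    show "strict_mono (enumerate {m. z m = v})" by (rule strict_mono_enumerate[OF v])
    show "z (enumerate {m. z m = v} m) = v" for m using enumerate_in_set[OF v] by blast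
  qed
qed

lemma filterlim_interleave:
  fixes p q :: "nat \<Rightarrow> nat"
  assumes "filterlim p at_top sequentially" "filterlim q at_top sequentially"
  shows "filterlim (\<lambda>i. if even i then p (i div 2) else q (i div 2)) at_top sequentially"
  unfolding filterlim_at_top eventually_sequentially
proof
  fix Z
  obtain M1 M2 where M: "\<And>m. m \<ge> M1 \<Longrightarrow> Z \<le> p m" "\<And>m. m \<ge> M2 \<Longrightarrow> Z \<le> q m"
    using assms unfolding filterlim_at_top eventually_sequentially by metis
  show "\<exists>N. \<forall>i\<ge>N. Z \<le> (if even i then p (i div 2) else q (i div 2))"
    by (rule exI[of _ "2 * (M1 + M2)"]) (auto intro!: M)
qed

context block_modification
begin

definition val :: real where "val = (\<Sum>j. real (d (Suc j)) / real b ^ Suc j)"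

lemma is_expansion_val:
  assumes "normal_seq b a"
  shows "is_expansion b val d"
  unfolding is_expansion_def
proof (intro conjI allI impI)
  show "d j < b" for j by (rule d_less)
  have "infinite {j. 1 \<le> j \<and> d j = 1}"
    using b by (intro infinite_digit_modified assms) simp
  then show "infinite {j. 1 \<le> j \<and> d j \<noteq> 0}"
    by (rule infinite_super[rotated]) auto
  have "summable (\<lambda>j. real (d (Suc j)) / real b ^ Suc j)"
  proof (rule summable_comparison_test)
    show "summable (\<lambda>j. (1 / real b) ^ j)" by (rule summable_geometric) (use b in simp)
    have "real (d (Suc j)) / real b ^ Suc j \<le> real b / real b ^ Suc j" for j
      using d_less[of "Suc j"] by (intro divide_right_mono) auto
    then show "\<exists>n0. \<forall>j\<ge>n0. norm (real (d (Suc j)) / real b ^ Suc j) \<le> (1 / real b) ^ j"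
      using b by (simp add: power_one_over)
  qed
  then show "(\<lambda>j. real (d (Suc j)) / real b ^ Suc j) sums val"
    unfolding val_def by (rule summable_sums)
qed

text \<open>The value 1 is reached only by the expansion with all digits \<open>b - 1\<close>, and
  \<open>d\<close> contains zeros.\<close>

lemma val_range:
  assumes "normal_seq b a"
  shows "val \<in> {0..<1}"
proof -
  note ex = is_expansion_val[OF assms]
  have "0 < val" "val \<le> 1" using expansion_remainder[OF b ex, of 0] by simp_all
  moreover have "val \<noteq> 1"
  proof
    assume 1: "val = 1"
    have "infinite {j. 1 \<le> j \<and> d j = 0}"
      using b by (intro infinite_digit_modified assms) simp
    then obtain j where j: "1 \<le> j" "d j = 0"
      using not_finite_existsD by auto
    have "d j = cdigit b 1 j" using expansion_eq_cdigit[OF b ex j(1)] 1 by simp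
    also have "\<dots> = nat ((int b ^ j - 1) mod int b)"
    proof -
      have "real b ^ j * 1 = real_of_int (int b ^ j)" by simp
      then show ?thesis unfolding cdigit_def by (simp only: ceiling_of_int)
    qed
    finally have "(int b ^ j - 1) mod int b = 0" using j b by (simp add: dual_order.antisym)
    then have "int b dvd int b ^ j - 1" by (simp add: mod_eq_0_iff_dvd)
    moreover have "int b dvd int b ^ j" using j(1) by (simp add: dvd_power)
    ultimately have "int b dvd 1" by (metis diff_diff_eq2 add_diff_cancel_left' dvd_diff_commute dvd_diff)
    then show False using b by simp
  qed
  ultimately show ?thesis by simp
qed

end

section \<open>Continuity and correctness of the reduction\<close>

lemma expansions_agree_dist:
  assumes b: "b \<ge> 2" and x: "is_expansion b x d" and y: "is_expansion b y e"
    and eq: "\<And>j. j \<in> {1..n} \<Longrightarrow> d j = e j"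
  shows "\<bar>x - y\<bar> \<le> 1 / real b ^ n"
proof -
  have "(\<Sum>j<n. real (d (Suc j)) / real b ^ Suc j) = (\<Sum>j<n. real (e (Suc j)) / real b ^ Suc j)"
    by (rule sum.cong) (auto simp: eq)
  then show ?thesis
    using expansion_remainder[OF b x, of n] expansion_remainder[OF b y, of n] by linarith
qed

lemma continuous_map_expansion:
  assumes b: "b \<ge> 2" and ex: "\<And>x. x \<in> topspace X \<Longrightarrow> is_expansion b (f x) (D x)"
    and lc: "\<And>j. locally_constant X (\<lambda>x. D x j)"
  shows "continuous_map X euclideanreal f"
  unfolding continuous_map_def
proof (intro conjI allI impI)
  fix V :: "real set" assume "openin euclideanreal V"
  then have V: "open V" by simp
  show "openin X {x \<in> topspace X. f x \<in> V}"
  proof (subst openin_subopen, intro ballI)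
    fix x assume "x \<in> {x \<in> topspace X. f x \<in> V}"
    then have x: "x \<in> topspace X" "f x \<in> V" by auto
    obtain \<epsilon> where \<epsilon>: "\<epsilon> > 0" "\<And>y. \<bar>y - f x\<bar> < \<epsilon> \<Longrightarrow> y \<in> V"
      using V x(2) unfolding open_dist dist_real_def by blast
    have "(\<lambda>n. (1 / real b) ^ n) \<longlonglongrightarrow> 0"
      by (rule LIMSEQ_power_zero) (use b in auto)
    then have "\<forall>\<^sub>F n in sequentially. (1 / real b) ^ n < \<epsilon>"
      using \<epsilon>(1) by (rule order_tendstoD(2))
    then obtain n where n: "(1 / real b) ^ n < \<epsilon>"
      using eventually_happens'[OF sequentially_bot] by blast
    have "\<exists>U. openin X U \<and> x \<in> U \<and> (\<forall>y\<in>U. \<forall>j\<in>{1..n}. D y j = D x j)"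
      by (rule locally_constant_finite_family[of "{1..n}" X "\<lambda>j x. D x j" x]) (simp_all add: lc x(1))
    then obtain U where U: "openin X U" "x \<in> U" "\<forall>y\<in>U. \<forall>j\<in>{1..n}. D y j = D x j" by blast
    have "U \<subseteq> {x \<in> topspace X. f x \<in> V}"
    proof
      fix y assume y: "y \<in> U"
      then have yX: "y \<in> topspace X" using U(1) openin_subset by blast
      have "\<bar>f y - f x\<bar> \<le> 1 / real b ^ n"
      proof (rule expansions_agree_dist[OF b ex[OF yX] ex[OF x(1)]])
        show "D y j = D x j" if "j \<in> {1..n}" for j using U(3) y that by blast
      qed
      then have "f y \<in> V" using n by (intro \<epsilon>(2)) (simp add: power_one_over)
      then show "y \<in> {x \<in> topspace X. f x \<in> V}" using yX by simp
    qed
    then show "\<exists>T. openin X T \<and> x \<in> T \<and> T \<subseteq> {x \<in> topspace X. f x \<in> V}"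
      using U(1,2) by blast
  qed
qed simp

text \<open>Outside \<open>A\<close> the zero blocks destroy normality, whatever the odd blocks do.
  Inside \<open>A\<close> normality is safe and the zeros are negligible, so the odd blocks alone
  decide Poisson genericity: it holds on \<open>B\<close> and fails off \<open>B\<close>.\<close>

lemma continuously_reducible_normal_not_poisson:
  assumes b: "b \<ge> 2" and X: "zero_dim_polish X" and A: "Pi03_in X A" and B: "Pi03_in X B"
  shows "continuously_reducible X (A - B) (top_of_set {0..<1}) (borel_normal b - poisson_generic b)"
proof -
  obtain p :: "'a \<Rightarrow> nat \<Rightarrow> nat" where
    lcp: "\<And>i. locally_constant X (\<lambda>x. p x i)" and
    p: "\<And>x. x \<in> topspace X \<Longrightarrow> x \<in> A \<longleftrightarrow> filterlim (p x) at_top sequentially"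
    using Pi03_locally_constant_code[OF X A] by blast
  obtain q :: "'a \<Rightarrow> nat \<Rightarrow> nat" where
    lcq: "\<And>i. locally_constant X (\<lambda>x. q x i)" and
    q: "\<And>x. x \<in> topspace X \<Longrightarrow> x \<in> B \<longleftrightarrow> filterlim (q x) at_top sequentially"
    using Pi03_locally_constant_code[OF X B] by blast
  obtain a where a: "\<And>i. a i < b" and na: "normal_seq b a" and pa: "poisson_seq b a"
    using exists_normal_poisson_sequence[OF b] by blast
  define r where "r x i = (if even i then p x (i div 2) else q x (i div 2))" for x i
  define D where "D x = block_modification.d b a (r x)" for x
  define f where "f x = block_modification.val b a (r x)" for x
  have bm: "block_modification b a" by unfold_locales (use b a in auto)
  have ex: "is_expansion b (f x) (D x)" and ran: "f x \<in> {0..<1}" for x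
    unfolding f_def D_def
    using block_modification.is_expansion_val[OF bm na] block_modification.val_range[OF bm na] by auto
  have "locally_constant X (\<lambda>x. r x i)" for i
    unfolding r_def by (cases "even i") (simp_all add: lcp lcq)
  then have lcD: "locally_constant X (\<lambda>x. D x j)" for j
  proof -
    \<comment> \<open>The block positions are the same for all \<open>x\<close>; digit
      \<open>j\<close> depends on \<open>x\<close> only through the length of this one
      block.\<close>
    let ?i = "block_modification.blk b (j - 1)"
    show ?thesis
    proof (rule locally_constant_of_finite[of "{?i}" X "\<lambda>i x. r x i"])
      fix x y assume "\<forall>i\<in>{?i}. r y i = r x i"
      then show "D y j = D x j"
        unfolding D_def block_modification.d_def[OF bm] block_modification.len_def[OF bm] Let_def by simp
    qed (use \<open>\<And>i. locally_constant X (\<lambda>x. r x i)\<close> in auto)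
  qed
  have "continuous_map X euclideanreal f"
    by (rule continuous_map_expansion[OF b ex lcD])
  then have "continuous_map X (top_of_set {0..<1}) f"
    using ran by (auto simp: continuous_map_in_subtopology)
  moreover have "x \<in> A - B \<longleftrightarrow> f x \<in> borel_normal b - poisson_generic b" if x: "x \<in> topspace X" for x
  proof -
    interpret block_modification b a "r x" by (rule bm)
    have dD: "d = D x" by (simp add: D_def)
    have normal_iff: "f x \<in> borel_normal b \<longleftrightarrow> normal_seq b (D x)"
      by (rule borel_normal_iff[OF b ex ran])
    have poisson_iff: "f x \<in> poisson_generic b \<longleftrightarrow> poisson_seq b (D x)"
      by (rule poisson_generic_iff[OF b ex ran])
    show ?thesis
    proof (cases "x \<in> A")
      case False
      then have "\<not> filterlim (p x) at_top sequentially" using p[OF x] by simp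
      then obtain v and \<phi> :: "nat \<Rightarrow> nat" where \<phi>: "strict_mono \<phi>" "\<forall>m. p x (\<phi> m) = v"
        by (blast dest: not_at_top_imp_constant_subsequence)
      have "\<not> normal_seq b d"
        by (rule not_normal_modified[of "\<lambda>m. 2 * \<phi> m" v]) (use \<phi> in \<open>auto simp: r_def strict_mono_def\<close>)
      then show ?thesis using False normal_iff dD by simp
    next
      case True
      then have p_top: "filterlim (p x) at_top sequentially" using p[OF x] by simp
      then have "filterlim (\<lambda>m. r x (2 * m)) at_top sequentially" by (simp add: r_def)
      then have normal: "normal_seq b d" using na by (rule normal_modified)
      show ?thesis
      proof (cases "x \<in> B")
        case True
        then have "filterlim (q x) at_top sequentially" using q[OF x] by simp
        with p_top have "filterlim (r x) at_top sequentially"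
          unfolding r_def by (rule filterlim_interleave)
        then have "poisson_seq b d" using pa by (rule poisson_modified)
        then show ?thesis using True poisson_iff dD by simp
      next
        case False
        then have "\<not> filterlim (q x) at_top sequentially" using q[OF x] by simp
        then obtain v and \<phi> :: "nat \<Rightarrow> nat" where \<phi>: "strict_mono \<phi>" "\<forall>m. q x (\<phi> m) = v"
          by (blast dest: not_at_top_imp_constant_subsequence)
        have "\<not> poisson_seq b d"
          by (rule not_poisson_modified[of "\<lambda>m. Suc (2 * \<phi> m)" v])
            (use \<phi> pa in \<open>auto simp: r_def strict_mono_def\<close>)
        then show ?thesis using True False normal normal_iff poisson_iff dD by simp
      qed
    qed
  qed
  ultimately show ?thesis unfolding continuously_reducible_def by blast
qed

theorem theorem2:
  fixes b :: nat
  assumes "b \<ge> 2"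
  shows "D2_Pi03_complete TYPE('a) (top_of_set {0..<1}) (borel_normal b - poisson_generic b)"
  unfolding D2_Pi03_complete_def
proof (intro conjI allI impI)
  show "D2_Pi03_in (top_of_set {0..<1}) (borel_normal b - poisson_generic b)"
    unfolding D2_Pi03_in_def
    using Pi03_borel_normal[OF assms] Pi03_poisson_generic[OF assms] by blast
  fix X :: "'a topology" and C
  assume "zero_dim_polish X \<and> D2_Pi03_in X C"
  then obtain A B where "zero_dim_polish X" "Pi03_in X A" "Pi03_in X B" "C = A - B"
    unfolding D2_Pi03_in_def by blast
  then show "continuously_reducible X C (top_of_set {0..<1}) (borel_normal b - poisson_generic b)"
    using continuously_reducible_normal_not_poisson[OF assms] by blast
qed

end
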